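(* Let $\mathcal{G}$ be a groupoid with a length function $\ell$, and let $(\mathcal{G}^{(0)},\mathcal{R},\mu)$ be a (not necessarily finite) measure space. Let $P\in\mathfrak{B}(L^2(\mathcal{G}^{(0)},\mu))$ be a rank-one projection, and let $\nu$ be the associated probability measure on $\mathcal{G}^{(0)}$. Then the following are equivalent: (1) $P\in\mathbf{C}^*_{\mathrm{dyn}}(\mathcal{G})$; (2) $P\in\mathbf{C}^*_{\mathrm{dyn},\mathrm{q}}(\mathcal{G})$; (3) $\mathcal{G}$ is asymptotically expanding in measure $\nu$.
   Context: Groupoids. A groupoid $\mathcal{G}$ (no topology assumed) has unit space $\mathcal{G}^{(0)}\subseteq\mathcal{G}$ and source and range maps $\mathrm{s},\mathrm{r}:\mathcal{G}\to\mathcal{G}^{(0)}$; $\gamma_1\gamma_2$ is defined when $\mathrm{s}(\gamma_1)=\mathrm{r}(\gamma_2)$. For $K\subseteq\mathcal{G}$ put $K^{-1}=\{\gamma^{-1}:\gamma\in K\}$; for $A\subseteq\mathcal{G}^{(0)}$, $\mathrm{r}(K\cdot A)=\{\mathrm{r}(\gamma):\gamma\in K,\mathrm{s}(\gamma)\in A\}$. $K$ is symmetric if $K=K^{-1}$, unital if $\mathcal{G}^{(0)}\subseteq K$, and a bisection if $\mathrm{s}|_K,\mathrm{r}|_K$ are injective; then $\tau_K:=\mathrm{r}|_K\circ(\mathrm{s}|_K)^{-1}:\mathrm{s}(K)\to\mathrm{r}(K)$. A length function is a map $\ell:\mathcal{G}\to[0,\infty)$ with $\ell=0$ on $\mathcal{G}^{(0)}$,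 $\ell(\gamma^{-1})=\ell(\gamma)$, and $\ell(\gamma_1\gamma_2)\le\ell(\gamma_1)+\ell(\gamma_2)$ for composable pairs; $\ell(K):=\sup_{\gamma\in K}\ell(\gamma)$. With respect to a given measure $\mu$ on $(\mathcal{G}^{(0)},\mathcal{R})$: a bisection $K$ is admissible if $\mathrm{s}(K),\mathrm{r}(K)\in\mathcal{R}$, $\tau_K$ is a measurable isomorphism preserving the measure class of $\mu$ (it and its inverse send null sets to null sets), and $\ell(K)<\infty$. A subset is decomposable if it is a finite union of admissible bisections. A unital symmetric decomposable $K$ is $N$-decomposable if $K=\bigcup_{i=1}^N K_i$ with admissible bisections $K_i$ such that some $K_i=\mathcal{G}^{(0)}$ and there is a bijection $\sigma$ of $\{1,\dots,N\}$ with $K_i^{-1}=K_{\sigma(i)}$. Operators. $T\in\mathfrak{B}(L^2(\mathcal{G}^{(0)},\mu))$ has finite dynamical propagation if there is a unital symmetric $N$-decomposable $K\subseteq\mathcal{G}$ with $\ell(K)\le L$ for some $N,L>0$ such that $\chi_AT\chi_B=0$ for all $A,B\in\mathcal{R}$ with $\mu(\mathrm{r}(K\cdot A)\cap B)=0$ ($\chi_A$ denotes multiplication by the characteristic function). The dynamical Roe algebra $\mathbf{C}^*_{\mathrm{dyn}}(\mathcal{G})$ is the operator-norm closure of the set of such operators. $T$ is dynamically quasi-local if for every $\epsilon>0$ there is a unital symmetric $N_\epsilon$-decomposable $K_\epsilon$ with $\ell(K_\epsilon)\le L_\epsilon$ for some $N_\epsilon,L_\epsilon>0$ such that $\|\chi_AT\chi_B\|<\epsilon$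 for all $A,B\in\mathcal{R}$ with $\mu(\mathrm{r}(K_\epsilon\cdot A)\cap B)=0$; $\mathbf{C}^*_{\mathrm{dyn},\mathrm{q}}(\mathcal{G})$ is the set of dynamically quasi-local operators. In (1) and (2) these notions are with respect to $\mu$. Associated measure. If $\xi\in L^2(\mathcal{G}^{(0)},\mu)$ is a unit vector in the range of the rank-one orthogonal projection $P$ (so $P\eta=\langle\eta,\xi\rangle\xi$), then the associated probability measure is $d\nu(x)=|\xi(x)|^2\,d\mu(x)$; it depends only on $P$. Asymptotic expansion. For a probability measure $\nu$ on $(\mathcal{G}^{(0)},\mathcal{R})$, $\mathcal{G}$ is asymptotically expanding in measure $\nu$ if for every $\alpha\in(0,\frac12]$ there are $C_\alpha,N_\alpha,L_\alpha>0$ and a unital symmetric $K_\alpha\subseteq\mathcal{G}$, $N_\alpha$-decomposable with respect to $\nu$, with $\ell(K_\alpha)\le L_\alpha$, such that $\nu(\mathrm{r}(K_\alpha\cdot A)\setminus A)>C_\alpha\nu(A)$ for all $A\in\mathcal{R}$ with $\alpha\le\nu(A)\le\frac12$. *)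

theory Defs
  imports "HOL-Analysis.Analysis"
begin

section \<open>Groupoids and length functions\<close>

record 'g groupoid =
  arrows :: "'g set"
  units :: "'g set"
  src :: "'g \<Rightarrow> 'g"
  rng :: "'g \<Rightarrow> 'g"
  gmult :: "'g \<Rightarrow> 'g \<Rightarrow> 'g"
  ginv :: "'g \<Rightarrow> 'g"

text \<open>The product \<open>gmult G a b\<close> is meaningful only if \<open>src G a = rng G b\<close>;
  all operations are irrelevant outside of \<open>arrows G\<close>.\<close>

locale groupoid =
  fixes G :: "'g groupoid"
  assumes units_subset: "units G \<subseteq> arrows G"
    and src_in_units: "a \<in> arrows G \<Longrightarrow> src G a \<in> units G"
    and rng_in_units: "a \<in> arrows G \<Longrightarrow> rng G a \<in> units G"
    and src_unit: "x \<in> units G \<Longrightarrow> src G x = x"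
    and rng_unit: "x \<in> units G \<Longrightarrow> rng G x = x"
    and mult_closed: "\<lbrakk>a \<in> arrows G; b \<in> arrows G; src G a = rng G b\<rbrakk> \<Longrightarrow> gmult G a b \<in> arrows G"
    and src_mult: "\<lbrakk>a \<in> arrows G; b \<in> arrows G; src G a = rng G b\<rbrakk> \<Longrightarrow> src G (gmult G a b) = src G b"
    and rng_mult: "\<lbrakk>a \<in> arrows G; b \<in> arrows G; src G a = rng G b\<rbrakk> \<Longrightarrow> rng G (gmult G a b) = rng G a"
    and mult_assoc: "\<lbrakk>a \<in> arrows G; b \<in> arrows G; c \<in> arrows G; src G a = rng G b; src G b = rng G c\<rbrakk>
      \<Longrightarrow> gmult G (gmult G a b) c = gmult G a (gmult G b c)"
    and mult_src: "a \<in> arrows G \<Longrightarrow> gmult G a (src G a) = a"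
    and rng_mult_left: "a \<in> arrows G \<Longrightarrow> gmult G (rng G a) a = a"
    and inv_closed: "a \<in> arrows G \<Longrightarrow> ginv G a \<in> arrows G"
    and src_inv: "a \<in> arrows G \<Longrightarrow> src G (ginv G a) = rng G a"
    and rng_inv: "a \<in> arrows G \<Longrightarrow> rng G (ginv G a) = src G a"
    and mult_inv: "a \<in> arrows G \<Longrightarrow> gmult G a (ginv G a) = rng G a"
    and inv_mult: "a \<in> arrows G \<Longrightarrow> gmult G (ginv G a) a = src G a"

definition length_function :: "'g groupoid \<Rightarrow> ('g \<Rightarrow> real) \<Rightarrow> bool" where
  "length_function G l \<longleftrightarrow>
     (\<forall>a\<in>arrows G. 0 \<le> l a) \<and>
     (\<forall>x\<in>units G. l x = 0) \<and>
     (\<forall>a\<in>arrows G. l (ginv G a) = l a) \<and>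
     (\<forall>a\<in>arrows G. \<forall>b\<in>arrows G. src G a = rng G b \<longrightarrow> l (gmult G a b) \<le> l a + l b)"

text \<open>The supremum is taken in \<open>[0, \<infinity>]\<close>, so it may be infinite, and it is \<open>0\<close> on the empty set.\<close>

definition set_length :: "('g \<Rightarrow> real) \<Rightarrow> 'g set \<Rightarrow> ennreal" where
  "set_length l K = (SUP a\<in>K. ennreal (l a))"

definition range_act :: "'g groupoid \<Rightarrow> 'g set \<Rightarrow> 'g set \<Rightarrow> 'g set" where
  "range_act G K A = {rng G a | a. a \<in> K \<and> src G a \<in> A}"

definition symmetric_subset :: "'g groupoid \<Rightarrow> 'g set \<Rightarrow> bool" where
  "symmetric_subset G K \<longleftrightarrow> K \<subseteq> arrows G \<and> ginv G ` K = K"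

definition unital_subset :: "'g groupoid \<Rightarrow> 'g set \<Rightarrow> bool" where
  "unital_subset G K \<longleftrightarrow> K \<subseteq> arrows G \<and> units G \<subseteq> K"

definition bisection :: "'g groupoid \<Rightarrow> 'g set \<Rightarrow> bool" where
  "bisection G K \<longleftrightarrow> K \<subseteq> arrows G \<and> inj_on (src G) K \<and> inj_on (rng G) K"

definition bisection_map :: "'g groupoid \<Rightarrow> 'g set \<Rightarrow> 'g \<Rightarrow> 'g" where
  "bisection_map G K x = rng G (the_inv_into K (src G) x)"

section \<open>Decomposable subsets\<close>

text \<open>Below, \<open>M\<close> is a measure on the unit space, i.e. \<open>space M = units G\<close>.\<close>

definition measure_class_iso ::
    "'g measure \<Rightarrow> 'g set \<Rightarrow> 'g set \<Rightarrow> ('g \<Rightarrow> 'g) \<Rightarrow> bool" where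
  "measure_class_iso M S R t \<longleftrightarrow>
     bij_betw t S R \<and>
     t \<in> restrict_space M S \<rightarrow>\<^sub>M restrict_space M R \<and>
     the_inv_into S t \<in> restrict_space M R \<rightarrow>\<^sub>M restrict_space M S \<and>
     (\<forall>A\<in>null_sets M. A \<subseteq> S \<longrightarrow> t ` A \<in> null_sets M) \<and>
     (\<forall>A\<in>null_sets M. A \<subseteq> R \<longrightarrow> the_inv_into S t ` A \<in> null_sets M)"

definition admissible_bisection ::
    "'g groupoid \<Rightarrow> ('g \<Rightarrow> real) \<Rightarrow> 'g measure \<Rightarrow> 'g set \<Rightarrow> bool" where
  "admissible_bisection G l M K \<longleftrightarrow>
     bisection G K \<and> src G ` K \<in> sets M \<and> rng G ` K \<in> sets M \<and>
     measure_class_iso M (src G ` K) (rng G ` K) (bisection_map G K) \<and>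
     set_length l K < \<infinity>"

definition decomposable ::
    "'g groupoid \<Rightarrow> ('g \<Rightarrow> real) \<Rightarrow> 'g measure \<Rightarrow> 'g set \<Rightarrow> bool" where
  "decomposable G l M K \<longleftrightarrow>
     (\<exists>F. finite F \<and> (\<forall>B\<in>F. admissible_bisection G l M B) \<and> K = \<Union>F)"

definition N_decomposable ::
    "'g groupoid \<Rightarrow> ('g \<Rightarrow> real) \<Rightarrow> 'g measure \<Rightarrow> nat \<Rightarrow> 'g set \<Rightarrow> bool" where
  "N_decomposable G l M N K \<longleftrightarrow>
     unital_subset G K \<and> symmetric_subset G K \<and> decomposable G l M K \<and>
     (\<exists>Ki :: nat \<Rightarrow> 'g set.
        (\<forall>i\<in>{1..N}. admissible_bisection G l M (Ki i)) \<and>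
        K = (\<Union>i\<in>{1..N}. Ki i) \<and>
        (\<exists>i\<in>{1..N}. Ki i = units G) \<and>
        (\<exists>\<sigma>. bij_betw \<sigma> {1..N} {1..N} \<and> (\<forall>i\<in>{1..N}. ginv G ` Ki i = Ki (\<sigma> i))))"

section \<open>Bounded operators on \<open>L\<^sup>2\<close>\<close>

text \<open>Elements of complex \<open>L\<^sup>2\<close> are represented by square-integrable functions, equality in \<open>L\<^sup>2\<close>
  being equality almost everywhere. Accordingly, an operator is a map on such representatives that
  is linear up to null sets and bounded; compatibility with almost everywhere equality is
  required explicitly. Its values on functions outside of \<open>L\<^sup>2\<close> are irrelevant.\<close>

definition L2 :: "'a measure \<Rightarrow> ('a \<Rightarrow> complex) set" where
  "L2 M = {f. f \<in> borel_measurable M \<and> integrable M (\<lambda>x. (cmod (f x))\<^sup>2)}"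

definition L2_eq :: "'a measure \<Rightarrow> ('a \<Rightarrow> complex) \<Rightarrow> ('a \<Rightarrow> complex) \<Rightarrow> bool" where
  "L2_eq M f g \<longleftrightarrow> (AE x in M. f x = g x)"

definition L2_inner :: "'a measure \<Rightarrow> ('a \<Rightarrow> complex) \<Rightarrow> ('a \<Rightarrow> complex) \<Rightarrow> complex" where
  "L2_inner M f g = (\<integral>x. f x * cnj (g x) \<partial>M)"

definition L2_norm :: "'a measure \<Rightarrow> ('a \<Rightarrow> complex) \<Rightarrow> real" where
  "L2_norm M f = sqrt (\<integral>x. (cmod (f x))\<^sup>2 \<partial>M)"

type_synonym 'a operator = "('a \<Rightarrow> complex) \<Rightarrow> ('a \<Rightarrow> complex)"

definition bounded_operator :: "'a measure \<Rightarrow> 'a operator \<Rightarrow> bool" where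
  "bounded_operator M T \<longleftrightarrow>
     (\<forall>f\<in>L2 M. T f \<in> L2 M) \<and>
     (\<forall>f\<in>L2 M. \<forall>g\<in>L2 M. L2_eq M f g \<longrightarrow> L2_eq M (T f) (T g)) \<and>
     (\<forall>f\<in>L2 M. \<forall>g\<in>L2 M. L2_eq M (T (\<lambda>x. f x + g x)) (\<lambda>x. T f x + T g x)) \<and>
     (\<forall>c. \<forall>f\<in>L2 M. L2_eq M (T (\<lambda>x. c * f x)) (\<lambda>x. c * T f x)) \<and>
     (\<exists>C. \<forall>f\<in>L2 M. L2_norm M (T f) \<le> C * L2_norm M f)"

definition operator_norm :: "'a measure \<Rightarrow> 'a operator \<Rightarrow> real" where
  "operator_norm M T = Sup {L2_norm M (T f) | f. f \<in> L2 M \<and> L2_norm M f \<le> 1}"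

definition operator_diff :: "'a operator \<Rightarrow> 'a operator \<Rightarrow> 'a operator" where
  "operator_diff T S = (\<lambda>f x. T f x - S f x)"

definition zero_operator :: "'a measure \<Rightarrow> 'a operator \<Rightarrow> bool" where
  "zero_operator M T \<longleftrightarrow> (\<forall>f\<in>L2 M. L2_eq M (T f) (\<lambda>x. 0))"

definition char_mult :: "'a set \<Rightarrow> 'a operator" where
  "char_mult A = (\<lambda>f x. indicator A x * f x)"

definition rank_one_projection :: "'a measure \<Rightarrow> 'a operator \<Rightarrow> bool" where
  "rank_one_projection M P \<longleftrightarrow>
     bounded_operator M P \<and>
     (\<forall>f\<in>L2 M. L2_eq M (P (P f)) (P f)) \<and>
     (\<forall>f\<in>L2 M. \<forall>g\<in>L2 M. L2_inner M (P f) g = L2_inner M f (P g)) \<and>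
     (\<exists>e\<in>L2 M. \<not> L2_eq M e (\<lambda>x. 0) \<and>
        (\<exists>f\<in>L2 M. L2_eq M (P f) e) \<and>
        (\<forall>f\<in>L2 M. \<exists>c. L2_eq M (P f) (\<lambda>x. c * e x)))"

text \<open>Any two unit vectors in the range of a rank-one projection differ by a phase, so there is
  exactly one associated measure.\<close>

definition associated_measure :: "'a measure \<Rightarrow> 'a operator \<Rightarrow> 'a measure \<Rightarrow> bool" where
  "associated_measure M P \<nu> \<longleftrightarrow>
     (\<exists>\<xi>\<in>L2 M. L2_norm M \<xi> = 1 \<and> (\<exists>f\<in>L2 M. L2_eq M (P f) \<xi>) \<and>
        \<nu> = density M (\<lambda>x. ennreal ((cmod (\<xi> x))\<^sup>2)))"

section \<open>Dynamical Roe algebras and asymptotic expansion\<close>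

definition finite_dynamical_propagation ::
    "'g groupoid \<Rightarrow> ('g \<Rightarrow> real) \<Rightarrow> 'g measure \<Rightarrow> 'g operator \<Rightarrow> bool" where
  "finite_dynamical_propagation G l M T \<longleftrightarrow>
     bounded_operator M T \<and>
     (\<exists>K (N::nat) (L::real). N > 0 \<and> L > 0 \<and> N_decomposable G l M N K \<and>
        set_length l K \<le> ennreal L \<and>
        (\<forall>A\<in>sets M. \<forall>B\<in>sets M. emeasure M (range_act G K A \<inter> B) = 0 \<longrightarrow>
           zero_operator M (char_mult A \<circ> T \<circ> char_mult B)))"

definition dynamical_Roe_algebra ::
    "'g groupoid \<Rightarrow> ('g \<Rightarrow> real) \<Rightarrow> 'g measure \<Rightarrow> 'g operator set" where
  "dynamical_Roe_algebra G l M =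
     {T. bounded_operator M T \<and>
         (\<forall>\<epsilon>>0. \<exists>S. finite_dynamical_propagation G l M S \<and> operator_norm M (operator_diff T S) < \<epsilon>)}"

definition dynamically_quasi_local ::
    "'g groupoid \<Rightarrow> ('g \<Rightarrow> real) \<Rightarrow> 'g measure \<Rightarrow> 'g operator set" where
  "dynamically_quasi_local G l M =
     {T. bounded_operator M T \<and>
         (\<forall>\<epsilon>>0. \<exists>K (N::nat) (L::real). N > 0 \<and> L > 0 \<and> N_decomposable G l M N K \<and>
            set_length l K \<le> ennreal L \<and>
            (\<forall>A\<in>sets M. \<forall>B\<in>sets M. emeasure M (range_act G K A \<inter> B) = 0 \<longrightarrow>
               operator_norm M (char_mult A \<circ> T \<circ> char_mult B) < \<epsilon>))}"

definition asymptotically_expanding ::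
    "'g groupoid \<Rightarrow> ('g \<Rightarrow> real) \<Rightarrow> 'g measure \<Rightarrow> bool" where
  "asymptotically_expanding G l \<nu> \<longleftrightarrow>
     (\<forall>\<alpha>::real. 0 < \<alpha> \<and> \<alpha> \<le> 1/2 \<longrightarrow>
        (\<exists>(C::real) (N::nat) (L::real) K. C > 0 \<and> N > 0 \<and> L > 0 \<and> N_decomposable G l \<nu> N K \<and>
           set_length l K \<le> ennreal L \<and>
           (\<forall>A\<in>sets \<nu>. \<alpha> \<le> measure \<nu> A \<and> measure \<nu> A \<le> 1/2 \<longrightarrow>
              measure \<nu> (range_act G K A - A) > C * measure \<nu> A)))"

end

theory Submission
  imports Defs
begin

text \<open>
  Let \<open>\<xi>\<close> be a unit vector in the range of \<open>P\<close> and \<open>X = {\<xi> \<noteq> 0}\<close>. The measures \<open>\<mu>\<close> and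
  \<open>\<nu> = |\<xi>|\<^sup>2 \<mu>\<close> have the same null sets inside \<open>X\<close>, so cutting a subset of the groupoid down to the
  arrows with both ends in \<open>X\<close> turns decomposability with respect to one measure into decomposability
  with respect to the other (\<open>controlled_restrict\<close>). Moreover \<open>f \<mapsto> f / \<xi>\<close> carries \<open>P\<close> to the projection of
  \<open>L\<^sup>2(\<nu>)\<close> onto the constants, \<open>f \<mapsto> \<integral> f d\<nu>\<close>.

  The Roe algebra consists of quasi-local operators because \<open>\<chi>\<^sub>A T \<chi>\<^sub>B = \<chi>\<^sub>A (T - S) \<chi>\<^sub>B\<close> whenever \<open>A\<close>
  and \<open>B\<close> are too far apart for \<open>S\<close> to connect them. For a quasi-local \<open>P\<close>, the operator
  \<open>\<chi>\<^sub>A P \<chi>\<^sub>B\<close> has norm \<open>\<surd>(\<nu>(A) \<nu>(B))\<close>; taking for \<open>B\<close> the part of \<open>X\<close> that \<open>K\<close> does not reach from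
  \<open>A\<close> shows that \<open>\<nu>(B)\<close> is small as soon as \<open>\<nu>(A) \<ge> \<alpha>\<close>, which is asymptotic expansion.

  The substantial step is to approximate the projection onto the constants by operators of finite
  propagation when \<open>G\<close> is asymptotically expanding in measure. Given \<open>\<alpha>\<close>, the finitely many
  bisections that make up \<open>K\<close> are truncated to pieces whose Radon--Nikodym derivatives are bounded above
  and below (\<open>truncate_bisection\<close>); because only sets of measure at least \<open>\<alpha>\<close> matter, little expansion is
  lost. The resulting partial transformations form a graph on the unit space in which every set of
  measure between \<open>\<alpha>\<close> and \<open>1 - \<alpha>\<close> has an edge boundary of measure at least some \<open>\<delta> > 0\<close>. A maximal
  poorly expanding set of measure at most \<open>\<alpha>\<close> is removed, and in its complement \<open>Y\<close> all sets of at most half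
  measure expand, however small they are (\<open>exists_expanding_domain\<close>). Cheeger's inequality now gives a
  spectral gap for the graph Laplacian on \<open>L\<^sup>2(Y)\<close> (\<open>spectral_gap\<close>), so the iterates of
  \<open>I - s \<Delta>\<close> converge in operator norm to the projection onto the constants on \<open>Y\<close>. The
  operator \<open>I - s \<Delta>\<close> relates the value at a point only to values at its neighbours in the graph,
  hence its powers have finite propagation (\<open>expanding_imp_local_approximation\<close>).
\<close>

section \<open>Square-integrable functions\<close>
definition square_integrable :: "'a measure \<Rightarrow> ('a \<Rightarrow> real) \<Rightarrow> bool" where
  "square_integrable M f \<longleftrightarrow> f \<in> borel_measurable M \<and> integrable M (\<lambda>x. (f x)\<^sup>2)"

lemma square_integrable_measurable [measurable_dest]:
  "square_integrable M f \<Longrightarrow> f \<in> borel_measurable M"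
  by (simp add: square_integrable_def)

lemma square_integrable_mult:
  assumes "square_integrable M f" "square_integrable M g"
  shows "integrable M (\<lambda>x. f x * g x)"
proof (rule Bochner_Integration.integrable_bound)
  show "integrable M (\<lambda>x. (f x)\<^sup>2 + (g x)\<^sup>2)" 
    using assms by (simp add: square_integrable_def)
  show "(\<lambda>x. f x * g x) \<in> borel_measurable M"
    using assms by measurable
  show "AE x in M. norm (f x * g x) \<le> norm ((f x)\<^sup>2 + (g x)\<^sup>2)"
  proof (rule AE_I2)
    fix x
    have "\<bar>f x\<bar> * \<bar>g x\<bar> \<le> (f x)\<^sup>2 + (g x)\<^sup>2"
      using sum_squares_bound[of "\<bar>f x\<bar>" "\<bar>g x\<bar>"] mult_nonneg_nonneg[OF abs_ge_zero[of "f x"] abs_ge_zero[of "g x"]]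
      by (simp only: power2_abs)
    then show "norm (f x * g x) \<le> norm ((f x)\<^sup>2 + (g x)\<^sup>2)"
      by (simp add: abs_mult)
  qed
qed

lemma square_integrable_bound:
  assumes "square_integrable M g" "f \<in> borel_measurable M" 
    "\<And>x. x \<in> space M \<Longrightarrow> \<bar>f x\<bar> \<le> \<bar>g x\<bar>"
  shows "square_integrable M f"
  unfolding square_integrable_def
proof
  show "integrable M (\<lambda>x. (f x)\<^sup>2)"
  proof (rule Bochner_Integration.integrable_bound)
    show "integrable M (\<lambda>x. (g x)\<^sup>2)" using assms by (simp add: square_integrable_def)
    show "AE x in M. norm ((f x)\<^sup>2) \<le> norm ((g x)\<^sup>2)"
      using assms(3) by (intro AE_I2) (simp add: abs_le_square_iff)
  qed (use assms in measurable)
qed fact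

lemma square_integrable_scale:
  "square_integrable M f \<Longrightarrow> square_integrable M (\<lambda>x. c * f x)"
  by (auto simp: square_integrable_def power_mult_distrib)

lemma square_integrable_add:
  assumes "square_integrable M f" "square_integrable M g"
  shows "square_integrable M (\<lambda>x. f x + g x)"
  using assms square_integrable_mult[OF assms]
  by (auto simp: square_integrable_def power2_sum mult.assoc)

lemma square_integrable_diff:
  assumes "square_integrable M f" "square_integrable M g"
  shows "square_integrable M (\<lambda>x. f x - g x)"
  using square_integrable_add[OF assms(1) square_integrable_scale[OF assms(2), of "-1"]] by simp

lemma square_integrable_sum:
  assumes "finite I" "\<And>i. i \<in> I \<Longrightarrow> square_integrable M (f i)"
  shows "square_integrable M (\<lambda>x. \<Sum>i\<in>I. f i x)"
  using assms
proof (induction I rule: finite_induct)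
  case empty then show ?case by (simp add: square_integrable_def)
next
  case (insert i I) then show ?case by (simp add: square_integrable_add)
qed

lemma square_integrable_indicator:
  "square_integrable M f \<Longrightarrow> A \<in> sets M \<Longrightarrow> square_integrable M (\<lambda>x. indicator A x * f x)"
  by (rule square_integrable_bound[of M f]) (auto simp: indicator_def)

lemma (in finite_measure) square_integrable_const: "square_integrable M (\<lambda>x. c)"
  by (simp add: square_integrable_def)

lemma (in finite_measure) square_integrable_integrable:
  "square_integrable M f \<Longrightarrow> integrable M f"
  using square_integrable_mult[OF _ square_integrable_const[of 1]] by simp

text \<open>A crude substitute for the triangle inequality that avoids square roots; constants do not matter below.\<close>

lemma square_integral_diff_le:
  assumes "square_integrable M f" "square_integrable M g"
  shows "(\<integral>x. (f x - g x)\<^sup>2 \<partial>M) \<le> 2 * (\<integral>x. (f x)\<^sup>2 \<partial>M) + 2 * (\<integral>x. (g x)\<^sup>2 \<partial>M)"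
proof -
  have i: "integrable M (\<lambda>x. (f x)\<^sup>2)" "integrable M (\<lambda>x. (g x)\<^sup>2)"
    using assms by (auto simp: square_integrable_def)
  have "(\<integral>x. (f x - g x)\<^sup>2 \<partial>M) \<le> (\<integral>x. 2 * (f x)\<^sup>2 + 2 * (g x)\<^sup>2 \<partial>M)"
  proof (rule integral_mono)
    show "integrable M (\<lambda>x. (f x - g x)\<^sup>2)" 
      using square_integrable_diff[OF assms] by (simp add: square_integrable_def)
    fix x
    have "0 \<le> (f x + g x)\<^sup>2" by simp
    then show "(f x - g x)\<^sup>2 \<le> 2 * (f x)\<^sup>2 + 2 * (g x)\<^sup>2" by (simp add: power2_eq_square algebra_simps)
  qed (use i in auto)
  also have "\<dots> = 2 * (\<integral>x. (f x)\<^sup>2 \<partial>M) + 2 * (\<integral>x. (g x)\<^sup>2 \<partial>M)" using i by simp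
  finally show ?thesis .
qed

section \<open>Graphs of partial transformations and their Laplacian\<close>

text \<open>Finitely many partial injections \<open>S i \<rightarrow> space M\<close>, extended by the identity to total maps \<open>t i\<close>, with
  partial inverses \<open>u i\<close>. The extension makes the difference \<open>f (t i x) - f x\<close> vanish outside \<open>S i\<close>
  by itself. The function \<open>\<rho> i\<close> is the Radon--Nikodym derivative of the pushforward of \<open>M\<close> restricted
  to \<open>S i\<close>; its bound \<open>D\<close> is what makes composition with \<open>t i\<close> and its adjoint bounded on
  \<open>L\<^sup>2\<close>.\<close>

locale bounded_graph = finite_measure M for M :: "'a measure" +
  fixes I :: "'i set" and S :: "'i \<Rightarrow> 'a set" and t u :: "'i \<Rightarrow> 'a \<Rightarrow> 'a"
    and \<rho> :: "'i \<Rightarrow> 'a \<Rightarrow> real" and D :: real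
  assumes finite_I: "finite I"
    and D_pos: "0 < D"
    and S_sets [measurable]: "i \<in> I \<Longrightarrow> S i \<in> sets M"
    and t_measurable [measurable]: "i \<in> I \<Longrightarrow> t i \<in> measurable M M"
    and u_measurable [measurable]: "i \<in> I \<Longrightarrow> u i \<in> measurable M M"
    and t_outside: "i \<in> I \<Longrightarrow> x \<in> space M \<Longrightarrow> x \<notin> S i \<Longrightarrow> t i x = x"
    and u_t: "i \<in> I \<Longrightarrow> x \<in> S i \<Longrightarrow> u i (t i x) = x"
    and \<rho>_measurable [measurable]: "i \<in> I \<Longrightarrow> \<rho> i \<in> borel_measurable M"
    and \<rho>_nonneg: "0 \<le> \<rho> i x"
    and \<rho>_le: "\<rho> i x \<le> D"
    and pushforward: "i \<in> I \<Longrightarrow>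
      distr (density M (indicator (S i))) M (t i) = density M (\<lambda>x. ennreal (\<rho> i x))"
begin

definition energy :: "('a \<Rightarrow> real) \<Rightarrow> real" where
  "energy f = (\<Sum>i\<in>I. \<integral>x. (f (t i x) - f x)\<^sup>2 \<partial>M)"

text \<open>This is \<open>\<Sum>i. (\<nabla>\<^sub>i)\<^sup>* \<nabla>\<^sub>i\<close> for the gradients \<open>\<nabla>\<^sub>i f = f \<circ> t i - f\<close>: the adjoint of composition with
  \<open>t i\<close> on \<open>S i\<close> is \<open>g \<mapsto> \<rho> i \<cdot> (g \<circ> u i)\<close>. An explicit formula, rather than an abstract adjoint, keeps
  locality visible pointwise. The type of values is left open because estimates are made for real
  functions and applied to the real and imaginary parts of complex ones.\<close>

definition laplacian :: "('a \<Rightarrow> 'b::real_vector) \<Rightarrow> 'a \<Rightarrow> 'b" where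
  "laplacian f y = (\<Sum>i\<in>I. \<rho> i y *\<^sub>R (f y - f (u i y)) - (f (t i y) - f y))"

lemma integral_pushforward:
  fixes h :: "'a \<Rightarrow> real"
  assumes i: "i \<in> I" and [measurable]: "h \<in> borel_measurable M"
  shows "(\<integral>x. \<rho> i x * h x \<partial>M) = (\<integral>x. indicator (S i) x * h (t i x) \<partial>M)"
    and "integrable M (\<lambda>x. \<rho> i x * h x) \<longleftrightarrow> integrable M (\<lambda>x. indicator (S i) x * h (t i x))"
proof -
  note [measurable] = i
  have d: "density M (indicator (S i)) = density M (\<lambda>x. ennreal (indicator (S i) x))"
    by (simp add: ennreal_indicator)
  have "(\<integral>x. \<rho> i x * h x \<partial>M) = integral\<^sup>L (density M (\<lambda>x. ennreal (\<rho> i x))) h"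
    by (subst integral_density) (auto simp: \<rho>_nonneg)
  also have "\<dots> = integral\<^sup>L (distr (density M (indicator (S i))) M (t i)) h"
    by (simp add: pushforward[OF i])
  also have "\<dots> = integral\<^sup>L (density M (indicator (S i))) (\<lambda>x. h (t i x))"
    by (rule integral_distr) auto
  also have "\<dots> = (\<integral>x. indicator (S i) x * h (t i x) \<partial>M)"
    unfolding d by (subst integral_density) auto
  finally show "(\<integral>x. \<rho> i x * h x \<partial>M) = (\<integral>x. indicator (S i) x * h (t i x) \<partial>M)" .
  have "integrable M (\<lambda>x. \<rho> i x * h x) \<longleftrightarrow> integrable (density M (\<lambda>x. ennreal (\<rho> i x))) h"
    by (subst integrable_density) (auto simp: \<rho>_nonneg)
  also have "\<dots> \<longleftrightarrow> integrable (distr (density M (indicator (S i))) M (t i)) h"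
    by (simp add: pushforward[OF i])
  also have "\<dots> \<longleftrightarrow> integrable (density M (indicator (S i))) (\<lambda>x. h (t i x))"
    by (rule integrable_distr_eq) auto
  also have "\<dots> \<longleftrightarrow> integrable M (\<lambda>x. indicator (S i) x * h (t i x))"
    unfolding d by (subst integrable_density) auto
  finally show "integrable M (\<lambda>x. \<rho> i x * h x) \<longleftrightarrow> integrable M (\<lambda>x. indicator (S i) x * h (t i x))" .
qed

lemma integrable_\<rho>_mult:
  fixes h :: "'a \<Rightarrow> real"
  assumes "i \<in> I" "integrable M h"
  shows "integrable M (\<lambda>x. \<rho> i x * h x)"
proof (rule Bochner_Integration.integrable_bound)
  show "integrable M (\<lambda>x. D * h x)" using assms by simp
  show "(\<lambda>x. \<rho> i x * h x) \<in> borel_measurable M" using assms by measurable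
  show "AE x in M. norm (\<rho> i x * h x) \<le> norm (D * h x)"
    using \<rho>_nonneg \<rho>_le D_pos by (intro AE_I2) (auto simp: abs_mult intro!: mult_right_mono)
qed

lemma compose_integrable:
  fixes h :: "'a \<Rightarrow> real"
  assumes i: "i \<in> I" and h: "integrable M h"
  shows "integrable M (\<lambda>x. h (t i x))"
proof -
  note [measurable] = i
  have [measurable]: "h \<in> borel_measurable M" using h by auto
  have "integrable M (\<lambda>x. indicator (S i) x * h (t i x))"
    using integrable_\<rho>_mult[OF i h] integral_pushforward(2)[OF i] by simp
  moreover have "integrable M (\<lambda>x. indicator (space M - S i) x * h x)"
    using integrable_mult_indicator[OF _ h, of "space M - S i"] by simp
  ultimately have "integrable M (\<lambda>x. indicator (S i) x * h (t i x) + indicator (space M - S i) x * h x)"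
    by simp
  then show ?thesis
    by (rule Bochner_Integration.integrable_cong[THEN iffD1, rotated 2])
      (auto simp: indicator_def t_outside[OF i])
qed

lemma compose_integral_le:
  fixes h :: "'a \<Rightarrow> real"
  assumes i: "i \<in> I" and h: "integrable M h" and nn: "\<And>x. 0 \<le> h x"
  shows "(\<integral>x. h (t i x) \<partial>M) \<le> (D + 1) * (\<integral>x. h x \<partial>M)"
proof -
  note [measurable] = i
  have [measurable]: "h \<in> borel_measurable M" using h by auto
  have i1: "integrable M (\<lambda>x. indicator (S i) x * h (t i x))"
    using integrable_\<rho>_mult[OF i h] integral_pushforward(2)[OF i] by simp
  have "(\<integral>x. h (t i x) \<partial>M) \<le> (\<integral>x. indicator (S i) x * h (t i x) + h x \<partial>M)"
  proof (rule integral_mono)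
    show "integrable M (\<lambda>x. indicator (S i) x * h (t i x) + h x)"
      using i1 h by (rule Bochner_Integration.integrable_add)
  qed (use compose_integrable[OF i h] t_outside[OF i] nn in \<open>auto simp: indicator_def\<close>)
  also have "\<dots> = (\<integral>x. \<rho> i x * h x \<partial>M) + (\<integral>x. h x \<partial>M)"
    using i1 h integral_pushforward(1)[OF i] by simp
  also have "(\<integral>x. \<rho> i x * h x \<partial>M) \<le> (\<integral>x. D * h x \<partial>M)"
    by (rule integral_mono) (auto simp: h integrable_\<rho>_mult[OF i h] nn \<rho>_le mult_right_mono)
  finally show ?thesis by (simp add: algebra_simps)
qed

lemma compose_square_integrable:
  assumes "i \<in> I" "square_integrable M f"
  shows "square_integrable M (\<lambda>x. f (t i x))"
  using assms compose_integrable[OF assms(1), of "\<lambda>x. (f x)\<^sup>2"]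
  by (auto simp: square_integrable_def)

lemma grad_square_integrable:
  assumes "i \<in> I" "square_integrable M f"
  shows "square_integrable M (\<lambda>x. f (t i x) - f x)"
  by (intro square_integrable_diff compose_square_integrable assms)

lemma energy_nonneg: "0 \<le> energy f"
  unfolding energy_def by (intro sum_nonneg) simp

text \<open>The terms \<open>\<rho> i (f - f \<circ> u i)\<close> of the Laplacian are the adjoints of composition with \<open>t i\<close>
  applied to \<open>\<nabla>\<^sub>i f\<close>. Changing variables through the density replaces \<open>f - f \<circ> u i\<close> by \<open>\<nabla>\<^sub>i f\<close>, at the cost
  of one remaining factor \<open>\<rho> i \<le> D\<close> in the norm estimate.\<close>

lemma adjoint_grad:
  assumes i: "i \<in> I" and f: "square_integrable M f"
  shows "square_integrable M (\<lambda>x. \<rho> i x * (f x - f (u i x)))"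
    and "(\<integral>x. (\<rho> i x * (f x - f (u i x)))\<^sup>2 \<partial>M) \<le> D * (\<integral>x. (f (t i x) - f x)\<^sup>2 \<partial>M)"
    and "\<And>g. square_integrable M g \<Longrightarrow>
      (\<integral>x. g x * (\<rho> i x * (f x - f (u i x))) \<partial>M) = (\<integral>x. g (t i x) * (f (t i x) - f x) \<partial>M)"
proof -
  note [measurable] = i
  have [measurable]: "f \<in> borel_measurable M" using f by measurable
  have S_grad: "indicator (S i) x * (h (t i x) * (f (t i x) - f (u i (t i x))) ^ Suc n) = h (t i x) * (f (t i x) - f x) ^ Suc n"
    if "x \<in> space M" for x h n
    using that t_outside[OF i] u_t[OF i] by (cases "x \<in> S i") auto
  have S_grad2: "indicator (S i) x * (f (t i x) - f (u i (t i x)))\<^sup>2 = (f (t i x) - f x)\<^sup>2"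
    if "x \<in> space M" for x
    using S_grad[OF that, of "\<lambda>_. 1" 1] by (simp add: numeral_2_eq_2)
  have gi: "integrable M (\<lambda>x. (f (t i x) - f x)\<^sup>2)"
    using grad_square_integrable[OF i f] by (simp add: square_integrable_def)
  have "integrable M (\<lambda>x. \<rho> i x * (f x - f (u i x))\<^sup>2)"
    using gi S_grad2 by (subst integral_pushforward(2)[OF i]) (simp_all cong: Bochner_Integration.integrable_cong)
  then have i1: "integrable M (\<lambda>x. D * (\<rho> i x * (f x - f (u i x))\<^sup>2))" by simp
  have b: "(\<rho> i x * (f x - f (u i x)))\<^sup>2 \<le> D * (\<rho> i x * (f x - f (u i x))\<^sup>2)" for x
  proof -
    have "\<rho> i x * (\<rho> i x * (f x - f (u i x))\<^sup>2) \<le> D * (\<rho> i x * (f x - f (u i x))\<^sup>2)"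
      using \<rho>_nonneg[of i x] \<rho>_le[of i x] by (intro mult_right_mono) auto
    then show ?thesis by (simp add: power2_eq_square mult_ac)
  qed
  show sq: "square_integrable M (\<lambda>x. \<rho> i x * (f x - f (u i x)))"
    unfolding square_integrable_def
  proof
    show "integrable M (\<lambda>x. (\<rho> i x * (f x - f (u i x)))\<^sup>2)"
    proof (rule Bochner_Integration.integrable_bound[OF i1])
      show "AE x in M. norm ((\<rho> i x * (f x - f (u i x)))\<^sup>2) \<le> norm (D * (\<rho> i x * (f x - f (u i x))\<^sup>2))"
        using b by (intro AE_I2) (simp add: order_trans[OF b abs_ge_self])
    qed measurable
  qed measurable
  have "(\<integral>x. (\<rho> i x * (f x - f (u i x)))\<^sup>2 \<partial>M) \<le> (\<integral>x. D * (\<rho> i x * (f x - f (u i x))\<^sup>2) \<partial>M)"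
    using sq unfolding square_integrable_def by (intro integral_mono b i1) simp
  also have "\<dots> = D * (\<integral>x. (f (t i x) - f x)\<^sup>2 \<partial>M)"
    using integral_pushforward(1)[OF i, of "\<lambda>x. (f x - f (u i x))\<^sup>2"] S_grad2
    by (simp cong: Bochner_Integration.integral_cong)
  finally show "(\<integral>x. (\<rho> i x * (f x - f (u i x)))\<^sup>2 \<partial>M) \<le> D * (\<integral>x. (f (t i x) - f x)\<^sup>2 \<partial>M)" .
  fix g assume "square_integrable M g"
  then have [measurable]: "g \<in> borel_measurable M" by measurable
  have "(\<integral>x. g x * (\<rho> i x * (f x - f (u i x))) \<partial>M) = (\<integral>x. \<rho> i x * (g x * (f x - f (u i x))) \<partial>M)"
    by (simp add: mult.left_commute)
  also have "\<dots> = (\<integral>x. indicator (S i) x * (g (t i x) * (f (t i x) - f (u i (t i x)))) \<partial>M)"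
    by (rule integral_pushforward(1)[OF i]) measurable
  also have "\<dots> = (\<integral>x. g (t i x) * (f (t i x) - f x) \<partial>M)"
    using S_grad[of _ g 0] by (intro Bochner_Integration.integral_cong) (simp_all del: mult_cancel_left)
  finally show "(\<integral>x. g x * (\<rho> i x * (f x - f (u i x))) \<partial>M) = (\<integral>x. g (t i x) * (f (t i x) - f x) \<partial>M)" .
qed

lemma laplacian_square_integrable:
  fixes f :: "'a \<Rightarrow> real"
  assumes f: "square_integrable M f"
  shows "square_integrable M (laplacian f)"
  unfolding laplacian_def real_scaleR_def
  by (intro square_integrable_sum square_integrable_diff[OF adjoint_grad(1) grad_square_integrable] finite_I f)

definition gradient_bound :: real where
  "gradient_bound = (2 * D + 2) * real (card I)"

text \<open>With \<open>\<Delta> = \<nabla>\<^sup>* \<nabla>\<close> this is \<open>\<parallel>\<Delta> f\<parallel>\<^sup>2 \<le> \<parallel>\<nabla>\<parallel>\<^sup>2 \<parallel>\<nabla> f\<parallel>\<^sup>2\<close>. It replaces the spectral theorem: together with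
  a lower bound on the energy it shows that a single step \<open>I - s \<Delta>\<close> contracts.\<close>

lemma laplacian_norm_le:
  fixes f :: "'a \<Rightarrow> real"
  assumes f: "square_integrable M f"
  shows "(\<integral>x. (laplacian f x)\<^sup>2 \<partial>M) \<le> gradient_bound * energy f"
proof -
  let ?b = "\<lambda>i x. \<rho> i x * (f x - f (u i x))" and ?g = "\<lambda>i x. f (t i x) - f x"
  have sq: "square_integrable M (?b i)" "square_integrable M (?g i)"
    "square_integrable M (\<lambda>x. ?b i x - ?g i x)" if "i \<in> I" for i
    by (intro square_integrable_diff[OF adjoint_grad(1) grad_square_integrable]
        adjoint_grad(1) grad_square_integrable that f)+
  have "(\<integral>x. (laplacian f x)\<^sup>2 \<partial>M) \<le> (\<integral>x. (\<Sum>i\<in>I. (?b i x - ?g i x)\<^sup>2) * real (card I) \<partial>M)"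
  proof (rule integral_mono)
    show "integrable M (\<lambda>x. (laplacian f x)\<^sup>2)"
      using laplacian_square_integrable[OF f] by (simp add: square_integrable_def)
    show "integrable M (\<lambda>x. (\<Sum>i\<in>I. (?b i x - ?g i x)\<^sup>2) * real (card I))"
      using sq(3) by (auto simp: square_integrable_def)
    show "(laplacian f x)\<^sup>2 \<le> (\<Sum>i\<in>I. (?b i x - ?g i x)\<^sup>2) * real (card I)" for x
      unfolding laplacian_def real_scaleR_def by (rule sum_squared_le_sum_of_squares)
  qed
  also have "\<dots> = (\<Sum>i\<in>I. \<integral>x. (?b i x - ?g i x)\<^sup>2 \<partial>M) * real (card I)"
    using sq(3) by (simp add: square_integrable_def)
  also have "\<dots> \<le> (\<Sum>i\<in>I. (2 * D + 2) * (\<integral>x. (?g i x)\<^sup>2 \<partial>M)) * real (card I)"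
  proof (intro mult_right_mono sum_mono)
    fix i assume i: "i \<in> I"
    show "(\<integral>x. (?b i x - ?g i x)\<^sup>2 \<partial>M) \<le> (2 * D + 2) * (\<integral>x. (?g i x)\<^sup>2 \<partial>M)"
      using square_integral_diff_le[OF sq(1,2)[OF i]] adjoint_grad(2)[OF i f]
      by (simp add: algebra_simps)
  qed simp
  also have "\<dots> = gradient_bound * energy f"
    by (simp add: energy_def gradient_bound_def sum_distrib_left mult_ac)
  finally show ?thesis .
qed

lemma laplacian_form:
  assumes f: "square_integrable M f" and g: "square_integrable M g"
  shows "(\<integral>x. g x * laplacian f x \<partial>M)
    = (\<Sum>i\<in>I. \<integral>x. (g (t i x) - g x) * (f (t i x) - f x) \<partial>M)"
proof -
  let ?b = "\<lambda>i x. \<rho> i x * (f x - f (u i x))" and ?g = "\<lambda>i x. f (t i x) - f x"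
  have i1: "integrable M (\<lambda>x. g x * ?b i x)" "integrable M (\<lambda>x. g x * ?g i x)" 
    "integrable M (\<lambda>x. g (t i x) * ?g i x)" if "i \<in> I" for i
    using square_integrable_mult[OF g adjoint_grad(1)[OF that f]]
      square_integrable_mult[OF g grad_square_integrable[OF that f]]
      square_integrable_mult[OF compose_square_integrable[OF that g] grad_square_integrable[OF that f]]
    by auto
  have "(\<integral>x. g x * laplacian f x \<partial>M) = (\<integral>x. (\<Sum>i\<in>I. g x * ?b i x - g x * ?g i x) \<partial>M)"
    unfolding laplacian_def real_scaleR_def by (simp only: sum_distrib_left right_diff_distrib)
  also have "\<dots> = (\<Sum>i\<in>I. \<integral>x. g x * ?b i x - g x * ?g i x \<partial>M)"
    using i1 by (intro Bochner_Integration.integral_sum) auto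
  also have "\<dots> = (\<Sum>i\<in>I. \<integral>x. (g (t i x) - g x) * ?g i x \<partial>M)"
  proof (rule sum.cong)
    fix i assume i: "i \<in> I"
    have "(\<integral>x. g x * ?b i x - g x * ?g i x \<partial>M) = (\<integral>x. g x * ?b i x \<partial>M) - (\<integral>x. g x * ?g i x \<partial>M)"
      using i1[OF i] by simp
    also have "\<dots> = (\<integral>x. g (t i x) * ?g i x \<partial>M) - (\<integral>x. g x * ?g i x \<partial>M)"
      using adjoint_grad(3)[OF i f g] by simp
    also have "\<dots> = (\<integral>x. (g (t i x) - g x) * ?g i x \<partial>M)"
      using i1[OF i] by (simp add: left_diff_distrib)
    finally show "(\<integral>x. g x * ?b i x - g x * ?g i x \<partial>M) = (\<integral>x. (g (t i x) - g x) * ?g i x \<partial>M)" .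
  qed simp
  finally show ?thesis .
qed

text \<open>With this step size at least half of the first-order decrease of the squared
  norm is left after the second-order term is absorbed. The summand 1 keeps the denominator positive for the empty graph.\<close>

definition heat_step :: "('a \<Rightarrow> 'b::real_vector) \<Rightarrow> 'a \<Rightarrow> 'b" where
  "heat_step f x = f x - (1 / (gradient_bound + 1)) *\<^sub>R laplacian f x"

lemma gradient_bound_nonneg: "0 \<le> gradient_bound"
  using D_pos by (simp add: gradient_bound_def)

lemma heat_step_square_integrable:
  fixes f :: "'a \<Rightarrow> real"
  assumes f: "square_integrable M f"
  shows "square_integrable M (heat_step f)"
  unfolding heat_step_def real_scaleR_def
  by (intro square_integrable_diff square_integrable_scale laplacian_square_integrable f)

lemma heat_step_norm_le:
  fixes f :: "'a \<Rightarrow> real"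
  assumes f: "square_integrable M f"
  shows "(\<integral>x. (heat_step f x)\<^sup>2 \<partial>M) \<le> (\<integral>x. (f x)\<^sup>2 \<partial>M) - energy f / (gradient_bound + 1)"
proof -
  define s where "s = 1 / (gradient_bound + 1)"
  have s: "0 < s" "s * gradient_bound \<le> 1"
    using gradient_bound_nonneg by (auto simp: s_def field_simps)
  note L = laplacian_square_integrable[OF f]
  have i: "integrable M (\<lambda>x. (f x)\<^sup>2)" "integrable M (\<lambda>x. f x * laplacian f x)"
    "integrable M (\<lambda>x. (laplacian f x)\<^sup>2)"
    using f L square_integrable_mult[OF f L] by (auto simp: square_integrable_def)
  have "(\<integral>x. (heat_step f x)\<^sup>2 \<partial>M)
     = (\<integral>x. (f x)\<^sup>2 - 2 * s * (f x * laplacian f x) + s\<^sup>2 * (laplacian f x)\<^sup>2 \<partial>M)"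
    unfolding heat_step_def s_def[symmetric] by (simp add: power2_eq_square algebra_simps)
  also have "\<dots> = (\<integral>x. (f x)\<^sup>2 \<partial>M) - 2 * s * (\<integral>x. f x * laplacian f x \<partial>M)
     + s\<^sup>2 * (\<integral>x. (laplacian f x)\<^sup>2 \<partial>M)"
    using i by simp
  also have "(\<integral>x. f x * laplacian f x \<partial>M) = energy f"
    by (subst laplacian_form[OF f f]) (simp add: energy_def power2_eq_square)
  also have "s\<^sup>2 * (\<integral>x. (laplacian f x)\<^sup>2 \<partial>M) \<le> s\<^sup>2 * (gradient_bound * energy f)"
    by (intro mult_left_mono laplacian_norm_le f) simp
  also have "\<dots> = s * (s * gradient_bound) * energy f" by (simp add: power2_eq_square)
  also have "\<dots> \<le> s * 1 * energy f"
    using s energy_nonneg by (intro mult_right_mono mult_left_mono) auto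
  finally show ?thesis by (simp add: s_def)
qed

text \<open>The constants lie in the kernel of \<open>\<nabla>\<close>, so \<open>\<Delta> f\<close> is orthogonal to them.\<close>

lemma heat_step_integral:
  fixes f :: "'a \<Rightarrow> real"
  assumes f: "square_integrable M f"
  shows "(\<integral>x. heat_step f x \<partial>M) = (\<integral>x. f x \<partial>M)"
proof -
  have "(\<integral>x. laplacian f x \<partial>M) = 0"
    using laplacian_form[OF f square_integrable_const[of 1]] by simp
  then show ?thesis
    unfolding heat_step_def
    using square_integrable_integrable[OF f] 
      square_integrable_integrable[OF laplacian_square_integrable[OF f]] by simp
qed

end

section \<open>Medians, the co-area formula and Cheeger's inequality\<close>
text \<open>The Cauchy--Schwarz inequality against an indicator, read off from \<open>\<parallel>f - s \<chi>\<^sub>A\<parallel>\<^sup>2 \<ge> 0\<close> at the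
  optimal \<open>s\<close>.\<close>

lemma (in finite_measure) integral_square_le:
  fixes f :: "'a \<Rightarrow> real"
  assumes f: "square_integrable M f" and A [measurable]: "A \<in> sets M"
  shows "(\<integral>x. indicator A x * f x \<partial>M)\<^sup>2 \<le> measure M A * (\<integral>x. (f x)\<^sup>2 \<partial>M)"
proof -
  have fi: "integrable M (\<lambda>x. (f x)\<^sup>2)" using f by (simp add: square_integrable_def)
  have Af: "integrable M (\<lambda>x. indicator A x * f x)"
    by (intro square_integrable_integrable square_integrable_indicator f A)
  define a where "a = (\<integral>x. indicator A x * f x \<partial>M)"
  have key: "0 \<le> (\<integral>x. (f x)\<^sup>2 \<partial>M) - 2 * s * a + s\<^sup>2 * measure M A" for s
  proof -
    have e: "(f x - s * indicator A x)\<^sup>2 = (f x)\<^sup>2 - 2 * s * (indicator A x * f x) + s\<^sup>2 * indicator A x" for x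
      by (auto simp: indicator_def power2_eq_square algebra_simps)
    have "0 \<le> (\<integral>x. (f x - s * indicator A x)\<^sup>2 \<partial>M)" by simp
    also have "\<dots> = (\<integral>x. (f x)\<^sup>2 \<partial>M) - 2 * s * a + s\<^sup>2 * measure M A"
      unfolding e a_def using fi Af by (simp add: emeasure_eq_measure)
    finally show ?thesis .
  qed
  show ?thesis
  proof (cases "measure M A = 0")
    case True
    then have "AE x in M. x \<notin> A" 
      by (intro AE_not_in) (simp add: null_sets_def emeasure_eq_measure)
    then have "a = (\<integral>x. 0 \<partial>M)" unfolding a_def by (intro integral_cong_AE) (use Af in auto)
    then show ?thesis using True by (simp add: a_def)
  next
    case False
    then have b: "measure M A > 0" by (simp add: zero_less_measure_iff)
    show ?thesis using key[of "a / measure M A"] b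
      unfolding a_def[symmetric] by (simp add: field_simps power2_eq_square)
  qed
qed

lemma (in finite_measure) exists_median:
  fixes f :: "'a \<Rightarrow> real"
  assumes [measurable]: "f \<in> borel_measurable M" "Y \<in> sets M"
  shows "\<exists>m. measure M {x\<in>Y. m < f x} \<le> measure M Y / 2 \<and> measure M {x\<in>Y. f x < m} \<le> measure M Y / 2"
proof (cases "measure M Y = 0")
  case True
  have "measure M {x\<in>Y. P x} = 0" for P
    using True finite_measure_mono[of "{x\<in>Y. P x}" Y] measure_nonneg[of M "{x\<in>Y. P x}"] by auto
  then show ?thesis using True by auto
next
  case False
  then have pos: "0 < measure M Y" by (simp add: zero_less_measure_iff)
  have Ysub: "Y \<subseteq> space M" using sets.sets_into_space[OF assms(2)] .
  \<comment> \<open>The median is the infimum of the up-closed set of levels exceeded on at most half of \<open>Y\<close>.\<close>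
  define U where "U = {s. measure M {x\<in>Y. s < f x} \<le> measure M Y / 2}"
  have [measurable]: "{x\<in>Y. s < f x} \<in> sets M" "{x\<in>Y. f x \<le> s} \<in> sets M" "{x\<in>Y. f x < s} \<in> sets M" for s
  proof -
    have "{x\<in>Y. s < f x} = {x\<in>space M. x \<in> Y \<and> s < f x}" "{x\<in>Y. f x \<le> s} = {x\<in>space M. x \<in> Y \<and> f x \<le> s}" 
      "{x\<in>Y. f x < s} = {x\<in>space M. x \<in> Y \<and> f x < s}" using Ysub by auto
    then show "{x\<in>Y. s < f x} \<in> sets M" "{x\<in>Y. f x \<le> s} \<in> sets M" "{x\<in>Y. f x < s} \<in> sets M"
      by simp_all
  qed
  have "(\<lambda>n. measure M {x\<in>Y. real n < f x}) \<longlonglongrightarrow> measure M (\<Inter>n. {x\<in>Y. real n < f x})"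
    by (intro finite_Lim_measure_decseq) (auto simp: decseq_def)
  also have "(\<Inter>n. {x\<in>Y. real n < f x}) = {}"
    using reals_Archimedean2[where ?'a = real] by (auto simp: not_less) (metis less_asym)
  finally have "eventually (\<lambda>n. measure M {x\<in>Y. real n < f x} < measure M Y / 2) sequentially"
    using pos by (intro order_tendstoD(2)[of _ 0]) auto
  then obtain n where "measure M {x\<in>Y. real n < f x} < measure M Y / 2"
    by (meson eventually_happens trivial_limit_sequentially)
  then have ne: "U \<noteq> {}" by (auto simp: U_def intro: less_imp_le)
  have "(\<lambda>n. measure M {x\<in>Y. - real n < f x}) \<longlonglongrightarrow> measure M (\<Union>n. {x\<in>Y. - real n < f x})"
    by (intro finite_Lim_measure_incseq) (auto simp: incseq_def)
  also have "(\<Union>n. {x\<in>Y. - real n < f x}) = Y"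
    using reals_Archimedean2[of "- f x" for x] by (auto simp: minus_less_iff)
  finally have "eventually (\<lambda>n. measure M {x\<in>Y. - real n < f x} > measure M Y / 2) sequentially"
    using pos by (intro order_tendstoD(1)[of _ "measure M Y"]) auto
  then obtain k where k: "measure M {x\<in>Y. - real k < f x} > measure M Y / 2"
    by (meson eventually_happens trivial_limit_sequentially)
  have up: "s' \<in> U" if "s \<in> U" "s \<le> s'" for s s'
  proof -
    have "measure M {x\<in>Y. s' < f x} \<le> measure M {x\<in>Y. s < f x}"
      using that by (intro finite_measure_mono) auto
    then show ?thesis using that by (simp add: U_def)
  qed
  have "- real k \<notin> U" using k by (simp add: U_def)
  then have bb: "bdd_below U" using up by (intro bdd_belowI[of _ "- real k"]) (meson linear)
  define m where "m = Inf U"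
  have above: "s \<in> U" if "m < s" for s
    using that cInf_less_iff[OF ne bb] up unfolding m_def by (meson less_imp_le)
  have below: "s \<notin> U" if "s < m" for s
    using that cInf_lower[OF _ bb] unfolding m_def by (meson not_less)
  define e where "e n = 1 / real (Suc n)" for n
  have e_pos: "0 < e n" and e_dec: "n \<le> n' \<Longrightarrow> e n' \<le> e n" for n n'
    by (auto simp: e_def intro!: divide_left_mono)
  have e_small: "\<exists>n. e n < d" if "0 < d" for d
    using nat_approx_posE[OF that] unfolding e_def by blast
  have gen: "(\<exists>n. e n < d) \<longleftrightarrow> 0 < d" "(\<exists>n. e n \<le> d) \<longleftrightarrow> 0 < d" for d
    using e_small[of d] less_trans[OF e_pos] less_le_trans[OF e_pos] less_imp_le by blast+
  have ex: "(\<exists>n. m + e n < r) \<longleftrightarrow> m < r" "(\<exists>n. r \<le> m - e n) \<longleftrightarrow> r < m" for r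
    using gen(1)[of "r - m"] gen(2)[of "m - r"] by (simp_all add: less_diff_eq le_diff_eq add.commute)
  have "(\<lambda>n. measure M {x\<in>Y. m + e n < f x}) \<longlonglongrightarrow> measure M (\<Union>n. {x\<in>Y. m + e n < f x})"
    using e_dec by (intro finite_Lim_measure_incseq) (fastforce intro!: monoI)+
  also have "(\<Union>n. {x\<in>Y. m + e n < f x}) = {x\<in>Y. m < f x}" using ex(1) by auto
  finally have 1: "measure M {x\<in>Y. m < f x} \<le> measure M Y / 2"
    by (rule LIMSEQ_le_const2) (use above e_pos in \<open>auto simp: U_def\<close>)
  have half: "measure M {x\<in>Y. f x \<le> m - e n} \<le> measure M Y / 2" for n
  proof -
    have "{x\<in>Y. f x \<le> m - e n} = Y - {x\<in>Y. m - e n < f x}" by auto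
    then have "measure M {x\<in>Y. f x \<le> m - e n} = measure M Y - measure M {x\<in>Y. m - e n < f x}"
      by (simp add: finite_measure_Diff)
    moreover have "m - e n \<notin> U" using e_pos by (intro below) simp
    ultimately show ?thesis by (simp add: U_def)
  qed
  have "(\<lambda>n. measure M {x\<in>Y. f x \<le> m - e n}) \<longlonglongrightarrow> measure M (\<Union>n. {x\<in>Y. f x \<le> m - e n})"
    using e_dec by (intro finite_Lim_measure_incseq) (fastforce intro!: monoI)+
  also have "(\<Union>n. {x\<in>Y. f x \<le> m - e n}) = {x\<in>Y. f x < m}" using ex(2) by auto
  finally have "measure M {x\<in>Y. f x < m} \<le> measure M Y / 2"
    by (rule LIMSEQ_le_const2) (use half in blast)
  with 1 show ?thesis by blast
qed

text \<open>The length of the interval between \<open>h x\<close> and \<open>k x\<close> is an integral over the levels \<open>s\<close> that separate the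
  two values; the orders of integration are then exchanged.\<close>

lemma (in finite_measure) nn_integral_abs_diff_layer_cake:
  fixes h k :: "'a \<Rightarrow> real"
  assumes [measurable]: "h \<in> borel_measurable M" "k \<in> borel_measurable M" and nn: "\<And>x. 0 \<le> h x" "\<And>x. 0 \<le> k x"
  shows "(\<integral>\<^sup>+x. ennreal \<bar>h x - k x\<bar> \<partial>M)
    = (\<integral>\<^sup>+s. indicator {0..} s * ennreal (measure M {x\<in>space M. (s < h x) \<noteq> (s < k x)}) \<partial>lborel)"
proof -
  interpret P: pair_sigma_finite M lborel
    by (simp add: pair_sigma_finite.intro sigma_finite_measure_axioms sigma_finite_lborel)
  have lc: "ennreal \<bar>a - b\<bar> = (\<integral>\<^sup>+s. indicator {s. 0 \<le> s \<and> (s < a) \<noteq> (s < b)} s \<partial>lborel)"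
    if "0 \<le> a" "0 \<le> b" for a b :: real
  proof -
    have "{s. 0 \<le> s \<and> (s < a) \<noteq> (s < b)} = {min a b..<max a b}" using that by auto
    then show ?thesis by (simp add: max_def min_def)
  qed
  have "(\<integral>\<^sup>+x. ennreal \<bar>h x - k x\<bar> \<partial>M)
      = (\<integral>\<^sup>+x. \<integral>\<^sup>+s. indicator {s. 0 \<le> s \<and> (s < h x) \<noteq> (s < k x)} s \<partial>lborel \<partial>M)"
    using lc nn by simp
  also have "\<dots> = (\<integral>\<^sup>+s. \<integral>\<^sup>+x. indicator {s. 0 \<le> s \<and> (s < h x) \<noteq> (s < k x)} s \<partial>M \<partial>lborel)"
    by (rule P.Fubini'[symmetric]) (simp add: indicator_def, measurable)
  also have "\<dots> = (\<integral>\<^sup>+s. indicator {0..} s * ennreal (measure M {x\<in>space M. (s < h x) \<noteq> (s < k x)}) \<partial>lborel)"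
  proof (intro nn_integral_cong)
    fix s
    let ?A = "{x\<in>space M. (s < h x) \<noteq> (s < k x)}"
    have [measurable]: "?A \<in> sets M" by measurable
    have "(\<integral>\<^sup>+x. indicator {s. 0 \<le> s \<and> (s < h x) \<noteq> (s < k x)} s \<partial>M) = (\<integral>\<^sup>+x. indicator {0..} s * indicator ?A x \<partial>M)"
      by (intro nn_integral_cong) (auto simp: indicator_def)
    then show "(\<integral>\<^sup>+x. indicator {s. 0 \<le> s \<and> (s < h x) \<noteq> (s < k x)} s \<partial>M) = indicator {0..} s * ennreal (measure M ?A)"
      by (simp add: nn_integral_cmult emeasure_eq_measure)
  qed
  finally show ?thesis .
qed

definition edge_boundary :: "'a measure \<Rightarrow> 'i set \<Rightarrow> ('i \<Rightarrow> 'a \<Rightarrow> 'a) \<Rightarrow> 'a set \<Rightarrow> real" where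
  "edge_boundary M I t A = (\<Sum>i\<in>I. measure M {x\<in>space M. (t i x \<in> A) \<noteq> (x \<in> A)})"

context bounded_graph
begin

abbreviation boundary :: "'a set \<Rightarrow> real" where
  "boundary \<equiv> edge_boundary M I t"

text \<open>Integrated over all levels, the boundaries of the superlevel sets of \<open>g\<close> give the total variation of
  \<open>g\<close>, so that an isoperimetric inequality for these sets becomes a functional inequality.\<close>

lemma coarea:
  fixes g :: "'a \<Rightarrow> real"
  assumes g: "integrable M g" and nn: "\<And>x. 0 \<le> g x"
    and c: "0 \<le> c" and exp: "\<And>s. 0 \<le> s \<Longrightarrow> c * measure M {x\<in>space M. s < g x} \<le> boundary {x\<in>space M. s < g x}"
  shows "c * (\<integral>x. g x \<partial>M) \<le> (\<Sum>i\<in>I. \<integral>x. \<bar>g (t i x) - g x\<bar> \<partial>M)"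
proof -
  let ?L = "\<lambda>s. {x\<in>space M. s < g x}"
  let ?E = "\<lambda>i s. {x\<in>space M. (t i x \<in> ?L s) \<noteq> (x \<in> ?L s)}"
  have [measurable]: "g \<in> borel_measurable M" using g by auto
  have L: "(\<integral>\<^sup>+x. ennreal (g x) \<partial>M) = (\<integral>\<^sup>+s. indicator {0..} s * ennreal (measure M (?L s)) \<partial>lborel)"
    using nn_integral_abs_diff_layer_cake[of g "\<lambda>_. 0"] nn
    by (auto simp: indicator_def not_less intro!: nn_integral_cong)
  have R: "(\<integral>\<^sup>+x. ennreal \<bar>g (t i x) - g x\<bar> \<partial>M) = (\<integral>\<^sup>+s. indicator {0..} s * ennreal (measure M (?E i s)) \<partial>lborel)"
    if i: "i \<in> I" for i
  proof -
    note [measurable] = i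
    have "?E i s = {x\<in>space M. (s < g (t i x)) \<noteq> (s < g x)}" for s
      using measurable_space[OF t_measurable[OF i]] by auto
    then show ?thesis using nn by (simp add: nn_integral_abs_diff_layer_cake)
  qed
  have gi: "integrable M (\<lambda>x. \<bar>g (t i x) - g x\<bar>)" if "i \<in> I" for i
    using compose_integrable[OF that g] g by auto
  have "ennreal (c * (\<integral>x. g x \<partial>M)) = ennreal c * (\<integral>\<^sup>+x. ennreal (g x) \<partial>M)"
    using g nn c by (simp add: nn_integral_eq_integral ennreal_mult)
  also have "\<dots> = (\<integral>\<^sup>+s. ennreal c * (indicator {0..} s * ennreal (measure M (?L s))) \<partial>lborel)"
    unfolding L 
    by (rule nn_integral_cmult[symmetric])
      (simp add: emeasure_eq_measure[symmetric], measurable)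
  also have "\<dots> \<le> (\<integral>\<^sup>+s. (\<Sum>i\<in>I. indicator {0..} s * ennreal (measure M (?E i s))) \<partial>lborel)"
  proof (rule nn_integral_mono)
    fix s
    show "ennreal c * (indicator {0..} s * ennreal (measure M (?L s))) \<le> (\<Sum>i\<in>I. indicator {0..} s * ennreal (measure M (?E i s)))"
      using exp[of s] c by (auto simp: indicator_def edge_boundary_def ennreal_mult[symmetric] sum_nonneg intro!: ennreal_leI)
  qed
  also have "\<dots> = (\<Sum>i\<in>I. \<integral>\<^sup>+x. ennreal \<bar>g (t i x) - g x\<bar> \<partial>M)"
  proof (subst nn_integral_sum)
    fix i assume i: "i \<in> I"
    note [measurable] = i
    show "(\<lambda>s. indicator {0..} s * ennreal (measure M (?E i s))) \<in> borel_measurable lborel"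
      unfolding emeasure_eq_measure[symmetric] by measurable
  qed (use R in simp)
  also have "\<dots> = ennreal (\<Sum>i\<in>I. \<integral>x. \<bar>g (t i x) - g x\<bar> \<partial>M)"
    using gi by (simp add: nn_integral_eq_integral)
  finally show ?thesis by (simp add: sum_nonneg)
qed

definition cheeger_gap :: "real \<Rightarrow> real" where
  "cheeger_gap c = c\<^sup>2 / (2 * (real (card I) * (D + 2) + 1))"

text \<open>The co-area inequality is applied to \<open>g\<^sup>2\<close>, and the variation of \<open>g\<^sup>2\<close> factors as
  \<open>|a\<^sup>2 - b\<^sup>2| = |a - b| |a + b|\<close>. Young's inequality with a weight \<open>k\<close> separates the energy from the norm of
  \<open>g\<close>.\<close>

lemma cheeger:
  fixes g :: "'a \<Rightarrow> real"
  assumes g: "square_integrable M g" and nn: "\<And>x. 0 \<le> g x" and c: "0 < c" 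
    and exp: "\<And>s. 0 \<le> s \<Longrightarrow> c * measure M {x\<in>space M. s < g x} \<le> boundary {x\<in>space M. s < g x}"
  shows "cheeger_gap c * (\<integral>x. (g x)\<^sup>2 \<partial>M) \<le> energy g"
proof -
  define G where "G = (\<integral>x. (g x)\<^sup>2 \<partial>M)"
  \<comment> \<open>This weight makes the norm term at most half of the left-hand side.\<close>
  define k where "k = c / (2 * (real (card I) * (D + 2) + 1))"
  have den: "0 < 2 * (real (card I) * (D + 2) + 1)" using D_pos by (auto intro!: add_nonneg_pos)
  then have k: "0 < k" using c by (simp add: k_def)
  have kc: "2 * (k * (real (card I) * (D + 2))) \<le> c"
    unfolding k_def using c den by (simp add: field_simps)
  have gi: "integrable M (\<lambda>x. (g x)\<^sup>2)" using g by (simp add: square_integrable_def)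
  have G0: "0 \<le> G" by (simp add: G_def)
  have "c * G \<le> (\<Sum>i\<in>I. \<integral>x. \<bar>(g (t i x))\<^sup>2 - (g x)\<^sup>2\<bar> \<partial>M)"
    unfolding G_def
  proof (rule coarea[OF gi])
    fix s :: real assume s: "0 \<le> s"
    have "{x\<in>space M. s < (g x)\<^sup>2} = {x\<in>space M. sqrt s < g x}"
      using nn s by (auto simp: real_less_rsqrt) (metis real_sqrt_less_iff real_sqrt_unique, metis real_less_lsqrt not_less nn less_asym linorder_neqE_linordered_idom real_sqrt_unique real_sqrt_less_mono)
    then show "c * measure M {x\<in>space M. s < (g x)\<^sup>2} \<le> boundary {x\<in>space M. s < (g x)\<^sup>2}"
      using exp[of "sqrt s"] s by simp
  qed (use c in auto)
  also have "\<dots> \<le> (\<Sum>i\<in>I. (1 / (2 * k)) * (\<integral>x. (g (t i x) - g x)\<^sup>2 \<partial>M) + k * (D + 2) * G)"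
  proof (rule sum_mono)
    fix i assume i: "i \<in> I"
    have sq: "square_integrable M (\<lambda>x. g (t i x))" "square_integrable M (\<lambda>x. g (t i x) - g x)"
      "square_integrable M (\<lambda>x. - g x)"
      using compose_square_integrable[OF i g] grad_square_integrable[OF i g] square_integrable_scale[OF g, of "-1"] by auto
    have ii: "integrable M (\<lambda>x. (g (t i x) - g x)\<^sup>2)" "integrable M (\<lambda>x. (g (t i x) + g x)\<^sup>2)"
       "integrable M (\<lambda>x. (g (t i x))\<^sup>2)"
      using sq square_integrable_add[OF sq(1) g] by (auto simp: square_integrable_def)
    have "(\<integral>x. \<bar>(g (t i x))\<^sup>2 - (g x)\<^sup>2\<bar> \<partial>M)
      \<le> (\<integral>x. (1 / (2 * k)) * (g (t i x) - g x)\<^sup>2 + (k / 2) * (g (t i x) + g x)\<^sup>2 \<partial>M)"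
    proof (rule integral_mono)
      show "integrable M (\<lambda>x. \<bar>(g (t i x))\<^sup>2 - (g x)\<^sup>2\<bar>)" using ii gi by auto
      show "integrable M (\<lambda>x. (1 / (2 * k)) * (g (t i x) - g x)\<^sup>2 + (k / 2) * (g (t i x) + g x)\<^sup>2)"
        using ii by (intro Bochner_Integration.integrable_add integrable_mult_right) auto
      fix x
      let ?a = "\<bar>g (t i x) - g x\<bar>" and ?b = "\<bar>g (t i x) + g x\<bar>"
      have "\<bar>(g (t i x))\<^sup>2 - (g x)\<^sup>2\<bar> = ?a * ?b"
        by (simp add: abs_mult[symmetric] power2_eq_square algebra_simps)
      also have "?a * ?b \<le> (1 / (2 * k)) * ?a\<^sup>2 + (k / 2) * ?b\<^sup>2"
      proof -
        have "0 \<le> (?a - k * ?b)\<^sup>2 / (2 * k)" using k by simp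
        then show ?thesis using k by (simp add: power2_diff power_mult_distrib field_simps power2_eq_square)
      qed
      finally show "\<bar>(g (t i x))\<^sup>2 - (g x)\<^sup>2\<bar> \<le> (1 / (2 * k)) * (g (t i x) - g x)\<^sup>2 + (k / 2) * (g (t i x) + g x)\<^sup>2"
        by simp
    qed
    also have "\<dots> = (1 / (2 * k)) * (\<integral>x. (g (t i x) - g x)\<^sup>2 \<partial>M) + (k / 2) * (\<integral>x. (g (t i x) + g x)\<^sup>2 \<partial>M)"
      using ii by simp
    also have "(\<integral>x. (g (t i x) + g x)\<^sup>2 \<partial>M) \<le> 2 * (D + 2) * G"
      using square_integral_diff_le[OF sq(1,3)] compose_integral_le[OF i gi] 
      by (simp add: G_def algebra_simps)
    finally show "(\<integral>x. \<bar>(g (t i x))\<^sup>2 - (g x)\<^sup>2\<bar> \<partial>M) \<le> (1 / (2 * k)) * (\<integral>x. (g (t i x) - g x)\<^sup>2 \<partial>M) + k * (D + 2) * G"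
      using k by (simp add: algebra_simps add_divide_distrib)
  qed
  also have "\<dots> = energy g / (2 * k) + (k * (real (card I) * (D + 2))) * G"
    by (simp add: sum.distrib sum_divide_distrib energy_def)
  also have "(k * (real (card I) * (D + 2))) * G \<le> (c / 2) * G"
    using kc G0 by (intro mult_right_mono) auto
  finally have "(c / 2) * G \<le> energy g / (2 * k)" by simp
  then have "(c * k) * G \<le> energy g" using k by (simp add: field_simps)
  then show ?thesis by (simp add: cheeger_gap_def k_def G_def power2_eq_square)
qed

end

section \<open>Spectral gap and convergence to the mean\<close>
text \<open>The set \<open>Y\<close> is invariant and all edges inside its complement are trivial, so \<open>\<chi>\<^sub>Y\<close> is harmonic and
  functions supported in \<open>Y\<close> stay supported there.\<close>

locale expanding_graph = bounded_graph M I S t u \<rho> D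
  for M :: "'a measure" and I :: "'i set" and S :: "'i \<Rightarrow> 'a set" and t u :: "'i \<Rightarrow> 'a \<Rightarrow> 'a"
    and \<rho> :: "'i \<Rightarrow> 'a \<Rightarrow> real" and D :: real +
  fixes Y :: "'a set" and c :: real
  assumes Y_sets [measurable]: "Y \<in> sets M"
    and c_pos: "0 < c"
    and t_Y: "i \<in> I \<Longrightarrow> x \<in> Y \<Longrightarrow> t i x \<in> Y"
    and u_Y: "i \<in> I \<Longrightarrow> x \<in> Y \<Longrightarrow> u i x \<in> Y"
    and t_off: "i \<in> I \<Longrightarrow> x \<notin> Y \<Longrightarrow> t i x = x"
    and u_off: "i \<in> I \<Longrightarrow> x \<notin> Y \<Longrightarrow> u i x = x"
    and expansion: "A \<in> sets M \<Longrightarrow> A \<subseteq> Y \<Longrightarrow> measure M A \<le> measure M Y / 2 \<Longrightarrow> c * measure M A \<le> boundary A"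
begin

lemma Y_subset: "Y \<subseteq> space M"
  using sets.sets_into_space[OF Y_sets] .

lemma cheeger_gap_pos: "0 < cheeger_gap c"
  using c_pos D_pos by (auto simp: cheeger_gap_def intro!: divide_pos_pos add_nonneg_pos)

lemma cheeger_one_sided:
  fixes g :: "'a \<Rightarrow> real"
  assumes g: "square_integrable M g" and nn: "\<And>x. 0 \<le> g x" and off: "\<And>x. x \<notin> Y \<Longrightarrow> g x = 0"
    and half: "measure M {x\<in>Y. 0 < g x} \<le> measure M Y / 2"
  shows "cheeger_gap c * (\<integral>x. (g x)\<^sup>2 \<partial>M) \<le> energy g"
proof (rule cheeger[OF g nn c_pos])
  fix s :: real assume s: "0 \<le> s"
  have [measurable]: "g \<in> borel_measurable M" using g by measurable
  have "{x\<in>space M. s < g x} \<subseteq> Y" using off s by force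
  moreover have "{x\<in>Y. 0 < g x} = {x\<in>space M. x \<in> Y \<and> 0 < g x}" using Y_subset by auto
  then have "{x\<in>Y. 0 < g x} \<in> sets M" by simp
  then have "measure M {x\<in>space M. s < g x} \<le> measure M {x\<in>Y. 0 < g x}"
    using off s by (intro finite_measure_mono) force+
  ultimately show "c * measure M {x\<in>space M. s < g x} \<le> boundary {x\<in>space M. s < g x}"
    using half by (intro expansion) auto
qed

text \<open>Cheeger's inequality controls functions supported on at most half of \<open>Y\<close>. Subtracting a median
  makes both the positive and the negative part such functions, truncation does not increase the energy,
  and the mean is the constant closest to \<open>f\<close> in \<open>L\<^sup>2\<close>.\<close>

lemma spectral_gap:
  fixes f :: "'a \<Rightarrow> real"
  assumes f: "square_integrable M f" and off: "\<And>x. x \<notin> Y \<Longrightarrow> f x = 0" and mean: "(\<integral>x. f x \<partial>M) = 0"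
  shows "cheeger_gap c / 2 * (\<integral>x. (f x)\<^sup>2 \<partial>M) \<le> energy f"
proof -
  have fm [measurable]: "f \<in> borel_measurable M" using f by measurable
  obtain m where m: "measure M {x\<in>Y. m < f x} \<le> measure M Y / 2" "measure M {x\<in>Y. f x < m} \<le> measure M Y / 2"
    using exists_median[OF fm Y_sets] by blast
  define d where "d x = f x - m * indicator Y x" for x
  define g where "g x = max (d x) 0" for x
  define h where "h x = max (- d x) 0" for x
  have Ysq: "square_integrable M (\<lambda>x. m * indicator Y x)"
    using square_integrable_scale[OF square_integrable_indicator[OF square_integrable_const[of 1] Y_sets], of m] by simp
  have d: "square_integrable M d"
    unfolding d_def by (rule square_integrable_diff[OF f Ysq])
  have dm [measurable]: "d \<in> borel_measurable M" using d by measurable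
  have [measurable]: "g \<in> borel_measurable M" "h \<in> borel_measurable M" unfolding g_def h_def by measurable
  have g: "square_integrable M g" and h: "square_integrable M h"
    by (rule square_integrable_bound[OF d], measurable, simp add: g_def h_def)+
  have fi: "integrable M f" "integrable M (\<lambda>x. (f x)\<^sup>2)" 
    using square_integrable_integrable[OF f] f by (auto simp: square_integrable_def)
  have gi: "integrable M (\<lambda>x. (g x)\<^sup>2)" "integrable M (\<lambda>x. (h x)\<^sup>2)" 
    using g h by (auto simp: square_integrable_def)
  have tY: "indicator Y (t i x) = (indicator Y x :: real)" if "i \<in> I" for i x
    using t_Y[OF that, of x] t_off[OF that, of x] by (cases "x \<in> Y") auto
  have en: "energy (\<lambda>x. p (d x)) \<le> energy f" 
    if lip: "\<And>a b. \<bar>p a - p b\<bar> \<le> \<bar>a - b\<bar>" and sq: "square_integrable M (\<lambda>x. p (d x))" for p :: "real \<Rightarrow> real"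
    unfolding energy_def
  proof (intro sum_mono integral_mono)
    fix i assume i: "i \<in> I"
    show "integrable M (\<lambda>x. (p (d (t i x)) - p (d x))\<^sup>2)" "integrable M (\<lambda>x. (f (t i x) - f x)\<^sup>2)"
      using grad_square_integrable[OF i sq] grad_square_integrable[OF i f] by (auto simp: square_integrable_def)
    fix x
    have "\<bar>p (d (t i x)) - p (d x)\<bar> \<le> \<bar>f (t i x) - f x\<bar>"
      using lip[of "d (t i x)" "d x"] by (simp add: d_def tY[OF i])
    then show "(p (d (t i x)) - p (d x))\<^sup>2 \<le> (f (t i x) - f x)\<^sup>2" by (simp add: abs_le_square_iff)
  qed
  have "cheeger_gap c * (\<integral>x. (g x)\<^sup>2 \<partial>M) \<le> energy g"
  proof (rule cheeger_one_sided[OF g])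
    have "{x\<in>Y. 0 < g x} = {x\<in>Y. m < f x}" by (auto simp: g_def d_def less_max_iff_disj)
    then show "measure M {x\<in>Y. 0 < g x} \<le> measure M Y / 2" using m by simp
  qed (auto simp: g_def d_def off)
  moreover have "energy g \<le> energy f"
    unfolding g_def using g by (intro en) (auto simp: g_def[abs_def])
  moreover have "cheeger_gap c * (\<integral>x. (h x)\<^sup>2 \<partial>M) \<le> energy h"
  proof (rule cheeger_one_sided[OF h])
    have "{x\<in>Y. 0 < h x} = {x\<in>Y. f x < m}" by (auto simp: h_def d_def less_max_iff_disj)
    then show "measure M {x\<in>Y. 0 < h x} \<le> measure M Y / 2" using m by simp
  qed (auto simp: h_def d_def off)
  moreover have "energy h \<le> energy f"
    unfolding h_def using h by (intro en[of "\<lambda>x. max (- x) 0"]) (auto simp: h_def[abs_def])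
  ultimately have 1: "cheeger_gap c * ((\<integral>x. (g x)\<^sup>2 \<partial>M) + (\<integral>x. (h x)\<^sup>2 \<partial>M)) \<le> 2 * energy f"
    by (simp add: distrib_left)
  have fY: "f x * indicator Y x = f x" for x using off[of x] by (cases "x \<in> Y") auto
  have "(\<integral>x. (f x)\<^sup>2 \<partial>M) \<le> (\<integral>x. (f x)\<^sup>2 \<partial>M) + m\<^sup>2 * measure M Y" by simp
  also have "\<dots> = (\<integral>x. (f x)\<^sup>2 - 2 * m * f x + m\<^sup>2 * indicator Y x \<partial>M)"
    using fi mean by (simp add: emeasure_eq_measure)
  also have "\<dots> = (\<integral>x. (d x)\<^sup>2 \<partial>M)"
  proof (rule Bochner_Integration.integral_cong)
    show "(f x)\<^sup>2 - 2 * m * f x + m\<^sup>2 * indicator Y x = (d x)\<^sup>2" for x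
      using off[of x] by (cases "x \<in> Y") (auto simp: d_def power2_eq_square algebra_simps)
  qed simp
  also have "\<dots> = (\<integral>x. (g x)\<^sup>2 + (h x)\<^sup>2 \<partial>M)"
    by (intro Bochner_Integration.integral_cong) (auto simp: g_def h_def max_def)
  also have "\<dots> = (\<integral>x. (g x)\<^sup>2 \<partial>M) + (\<integral>x. (h x)\<^sup>2 \<partial>M)" using gi by simp
  finally have "cheeger_gap c * (\<integral>x. (f x)\<^sup>2 \<partial>M) \<le> cheeger_gap c * ((\<integral>x. (g x)\<^sup>2 \<partial>M) + (\<integral>x. (h x)\<^sup>2 \<partial>M))"
    using cheeger_gap_pos by (intro mult_left_mono) auto
  with 1 show ?thesis by simp
qed

definition rate :: real where
  "rate = max 0 (1 - cheeger_gap c / 2 / (gradient_bound + 1))"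

lemma rate_bounds: "0 \<le> rate" "rate < 1"
  using cheeger_gap_pos gradient_bound_nonneg by (auto simp: rate_def)

lemma heat_step_vanishes_off:
  fixes f :: "'a \<Rightarrow> 'b::real_vector"
  assumes "\<And>x. x \<notin> Y \<Longrightarrow> f x = 0" "x \<notin> Y"
  shows "heat_step f x = 0"
  using assms by (simp add: heat_step_def laplacian_def t_off u_off)

lemma heat_step_iterate_contracts:
  fixes f :: "'a \<Rightarrow> real"
  assumes f: "square_integrable M f" and off: "\<And>x. x \<notin> Y \<Longrightarrow> f x = 0" and mean: "(\<integral>x. f x \<partial>M) = 0"
  shows "square_integrable M ((heat_step ^^ n) f) \<and> (\<forall>x. x \<notin> Y \<longrightarrow> (heat_step ^^ n) f x = 0) \<and>
    (\<integral>x. (heat_step ^^ n) f x \<partial>M) = 0 \<and>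
    (\<integral>x. ((heat_step ^^ n) f x)\<^sup>2 \<partial>M) \<le> rate ^ n * (\<integral>x. (f x)\<^sup>2 \<partial>M)"
proof (induction n)
  case 0 show ?case using assms by simp
next
  case (Suc n)
  let ?g = "(heat_step ^^ n) f"
  have g: "square_integrable M ?g" "\<And>x. x \<notin> Y \<Longrightarrow> ?g x = 0" "(\<integral>x. ?g x \<partial>M) = 0"
    "(\<integral>x. (?g x)\<^sup>2 \<partial>M) \<le> rate ^ n * (\<integral>x. (f x)\<^sup>2 \<partial>M)"
    using Suc by auto
  have "(\<integral>x. (heat_step ?g x)\<^sup>2 \<partial>M) \<le> (\<integral>x. (?g x)\<^sup>2 \<partial>M) - energy ?g / (gradient_bound + 1)"
    by (rule heat_step_norm_le[OF g(1)])
  also have "\<dots> \<le> (\<integral>x. (?g x)\<^sup>2 \<partial>M) - (cheeger_gap c / 2 * (\<integral>x. (?g x)\<^sup>2 \<partial>M)) / (gradient_bound + 1)"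
    using spectral_gap[OF g(1-3)] gradient_bound_nonneg
    by (intro diff_mono divide_right_mono) auto
  also have "\<dots> = (1 - cheeger_gap c / 2 / (gradient_bound + 1)) * (\<integral>x. (?g x)\<^sup>2 \<partial>M)"
    by (simp add: algebra_simps)
  also have "\<dots> \<le> rate * (\<integral>x. (?g x)\<^sup>2 \<partial>M)"
    by (intro mult_right_mono) (auto simp: rate_def)
  also have "\<dots> \<le> rate * (rate ^ n * (\<integral>x. (f x)\<^sup>2 \<partial>M))"
    using g(4) rate_bounds by (intro mult_left_mono) auto
  finally show ?case
    using heat_step_square_integrable[OF g(1)] heat_step_vanishes_off[of ?g, OF g(2)] heat_step_integral[OF g(1)] g(3)
    by simp
qed

lemma heat_step_add: "heat_step (\<lambda>x. f x + g x) = (\<lambda>x. heat_step f x + heat_step g x)"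
  by (simp add: fun_eq_iff heat_step_def laplacian_def algebra_simps sum.distrib sum_subtractf)

lemma heat_step_iterate_add: "(heat_step ^^ n) (\<lambda>x. f x + g x) = (\<lambda>x. (heat_step ^^ n) f x + (heat_step ^^ n) g x)"
  by (induction n) (auto simp: heat_step_add)

lemma heat_step_iterate_indicator: 
  "(heat_step ^^ n) (\<lambda>x. a * indicator Y x) = (\<lambda>x. a * indicator Y x :: real)"
proof -
  have "heat_step (\<lambda>x. a * indicator Y x) x = (a * indicator Y x :: real)" for x
  proof -
    have "i \<in> I \<Longrightarrow> indicator Y (t i x) = (indicator Y x :: real)" 
      "i \<in> I \<Longrightarrow> indicator Y (u i x) = (indicator Y x :: real)" for i
      using t_Y[of i x] t_off[of i x] u_Y[of i x] u_off[of i x] by (cases "x \<in> Y"; simp)+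
    then show ?thesis by (simp add: heat_step_def laplacian_def)
  qed
  then show ?thesis by (induction n) auto
qed

text \<open>The factor \<open>\<nu>(Y)\<close> turns the limit, the average of \<open>f\<close> over \<open>Y\<close>, into the integral of \<open>f\<close> over \<open>Y\<close>;
  this integral differs little from the integral over the whole space if \<open>Y\<close> has almost full measure.\<close>

definition approx_mean :: "nat \<Rightarrow> ('a \<Rightarrow> 'b::real_vector) \<Rightarrow> 'a \<Rightarrow> 'b" where
  "approx_mean n f x = measure M Y *\<^sub>R (heat_step ^^ n) (\<lambda>x. indicator Y x *\<^sub>R f x) x"

text \<open>On \<open>Y\<close>, the function splits into its average, which is fixed by the iteration, and a part of mean zero,
  which is contracted. The remaining error comes from the complement of \<open>Y\<close>.\<close>

lemma approx_mean_error:
  fixes f :: "'a \<Rightarrow> real"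
  assumes f: "square_integrable M f" and prob: "measure M (space M) = 1" and pos: "0 < measure M Y"
  shows "square_integrable M (approx_mean n f)"
    and "(\<integral>x. (approx_mean n f x - (\<integral>y. f y \<partial>M))\<^sup>2 \<partial>M)
      \<le> (2 * rate ^ n + 4 * (1 - measure M Y)) * (\<integral>x. (f x)\<^sup>2 \<partial>M)"
proof -
  let ?Z = "space M - Y"
  have le1: "measure M Y \<le> 1" using bounded_measure[of Y] prob by simp
  have Z: "?Z \<in> sets M" "measure M ?Z = 1 - measure M Y"
    using prob finite_measure_compl[OF Y_sets] by auto
  have fm [measurable]: "f \<in> borel_measurable M" using f by measurable
  have fi: "integrable M f" "integrable M (\<lambda>x. (f x)\<^sup>2)"
    using square_integrable_integrable[OF f] f by (auto simp: square_integrable_def)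
  define F where "F = (\<integral>x. (f x)\<^sup>2 \<partial>M)"
  have F0: "0 \<le> F" by (simp add: F_def)
  define a where "a = (\<integral>x. indicator Y x * f x \<partial>M)"
  define m where "m = a / measure M Y"
  define g where "g x = indicator Y x * f x - m * indicator Y x" for x
  note Yf = square_integrable_indicator[OF f Y_sets]
  have Y1: "square_integrable M (\<lambda>x. s * indicator Y x)" for s
    using square_integrable_scale[OF square_integrable_indicator[OF square_integrable_const[of 1] Y_sets], of s] by simp
  have g: "square_integrable M g" unfolding g_def by (rule square_integrable_diff[OF Yf Y1])
  have g_mean: "(\<integral>x. g x \<partial>M) = 0"
    unfolding g_def using square_integrable_integrable[OF Yf] pos
    by (simp add: a_def[symmetric] m_def emeasure_eq_measure)
  have g_off: "x \<notin> Y \<Longrightarrow> g x = 0" for x by (simp add: g_def)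
  have g_norm: "(\<integral>x. (g x)\<^sup>2 \<partial>M) \<le> F"
  proof -
    have e: "(g x)\<^sup>2 = indicator Y x * (f x)\<^sup>2 - 2 * m * (indicator Y x * f x) + m\<^sup>2 * indicator Y x" for x
      by (cases "x \<in> Y") (auto simp: g_def power2_eq_square algebra_simps)
    have i2: "integrable M (\<lambda>x. indicator Y x * (f x)\<^sup>2)"
      using integrable_mult_indicator[OF Y_sets fi(2)] by simp
    have "(\<integral>x. (g x)\<^sup>2 \<partial>M) = (\<integral>x. indicator Y x * (f x)\<^sup>2 \<partial>M) - 2 * m * a + m\<^sup>2 * measure M Y"
      unfolding e a_def using i2 square_integrable_integrable[OF Yf] by (simp add: emeasure_eq_measure)
    also have "\<dots> = (\<integral>x. indicator Y x * (f x)\<^sup>2 \<partial>M) - m\<^sup>2 * measure M Y"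
      using pos by (simp add: m_def power2_eq_square)
    also have "\<dots> \<le> (\<integral>x. indicator Y x * (f x)\<^sup>2 \<partial>M)" by simp
    also have "\<dots> \<le> F" unfolding F_def using i2 fi by (intro integral_mono) (auto simp: indicator_def)
    finally show ?thesis .
  qed
  let ?g = "(heat_step ^^ n) g"
  have it: "square_integrable M ?g" "(\<integral>x. (?g x)\<^sup>2 \<partial>M) \<le> rate ^ n * (\<integral>x. (g x)\<^sup>2 \<partial>M)"
    using heat_step_iterate_contracts[OF g g_off g_mean, of n] by auto
  have split: "(\<lambda>x. indicator Y x *\<^sub>R f x) = (\<lambda>x. g x + m * indicator Y x)" by (simp add: g_def fun_eq_iff)
  have am: "approx_mean n f x = measure M Y * ?g x + a * indicator Y x" for x
    unfolding approx_mean_def split heat_step_iterate_add heat_step_iterate_indicator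
    using pos by (simp add: m_def algebra_simps)
  show S: "square_integrable M (approx_mean n f)"
    unfolding am[abs_def] by (intro square_integrable_add square_integrable_scale it Y1)
  define z where "z = (\<integral>x. indicator ?Z x * f x \<partial>M)"
  define b where "b = (\<integral>x. f x \<partial>M)"
  have b: "b = a + z"
  proof -
    have "b = (\<integral>x. indicator Y x * f x + indicator ?Z x * f x \<partial>M)"
      unfolding b_def by (intro Bochner_Integration.integral_cong) (auto simp: indicator_def)
    then show ?thesis
      using square_integrable_integrable[OF Yf] square_integrable_integrable[OF square_integrable_indicator[OF f Z(1)]]
      by (simp add: a_def z_def)
  qed
  have z2: "z\<^sup>2 \<le> (1 - measure M Y) * F" unfolding z_def F_def Z(2)[symmetric] by (rule integral_square_le[OF f Z(1)])
  have b2: "b\<^sup>2 \<le> F" 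
  proof -
    have "b = (\<integral>x. indicator (space M) x * f x \<partial>M)"
      unfolding b_def by (intro Bochner_Integration.integral_cong) auto
    then show ?thesis using integral_square_le[OF f sets.top] prob by (simp add: F_def)
  qed
  have e1: "(\<integral>x. (measure M Y * ?g x)\<^sup>2 \<partial>M) \<le> rate ^ n * F"
  proof -
    have "(\<integral>x. (measure M Y * ?g x)\<^sup>2 \<partial>M) = (measure M Y)\<^sup>2 * (\<integral>x. (?g x)\<^sup>2 \<partial>M)"
      by (simp add: power_mult_distrib)
    also have "\<dots> \<le> 1 * (\<integral>x. (?g x)\<^sup>2 \<partial>M)" using le1 by (intro mult_right_mono power_le_one) auto
    also have "\<dots> \<le> rate ^ n * (\<integral>x. (g x)\<^sup>2 \<partial>M)" using it(2) by simp
    also have "\<dots> \<le> rate ^ n * F" using rate_bounds g_norm by (intro mult_left_mono) auto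
    finally show ?thesis .
  qed
  have e2: "(\<integral>x. (b - a * indicator Y x)\<^sup>2 \<partial>M) \<le> 2 * (1 - measure M Y) * F"
  proof -
    have "(\<integral>x. (b - a * indicator Y x)\<^sup>2 \<partial>M) = (\<integral>x. z\<^sup>2 * indicator Y x + b\<^sup>2 * indicator ?Z x \<partial>M)"
      by (intro Bochner_Integration.integral_cong) (auto simp: indicator_def b)
    also have "\<dots> = z\<^sup>2 * measure M Y + b\<^sup>2 * (1 - measure M Y)"
      using Z by (simp add: emeasure_eq_measure)
    also have "\<dots> \<le> z\<^sup>2 * 1 + F * (1 - measure M Y)"
      using le1 b2 by (intro add_mono mult_left_mono mult_right_mono) auto
    finally show ?thesis using z2 by (simp add: algebra_simps)
  qed
  have "(\<integral>x. (approx_mean n f x - b)\<^sup>2 \<partial>M) = (\<integral>x. (measure M Y * ?g x - (b - a * indicator Y x))\<^sup>2 \<partial>M)"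
    by (simp add: am algebra_simps)
  also have "\<dots> \<le> 2 * (\<integral>x. (measure M Y * ?g x)\<^sup>2 \<partial>M) + 2 * (\<integral>x. (b - a * indicator Y x)\<^sup>2 \<partial>M)"
    by (intro square_integral_diff_le square_integrable_diff square_integrable_scale it(1) square_integrable_const Y1)
  also have "\<dots> \<le> 2 * (rate ^ n * F) + 2 * (2 * (1 - measure M Y) * F)"
    using e1 e2 by (intro add_mono mult_left_mono) auto
  finally show "(\<integral>x. (approx_mean n f x - (\<integral>y. f y \<partial>M))\<^sup>2 \<partial>M)
      \<le> (2 * rate ^ n + 4 * (1 - measure M Y)) * (\<integral>x. (f x)\<^sup>2 \<partial>M)"
    by (simp add: b_def F_def algebra_simps)
qed

end

section \<open>Expanding domains and bounded densities\<close>
text \<open>A chain is built whose \<open>n\<close>-th member has almost the largest measure (up to \<open>1/n\<close>) among the members of the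
  family above its predecessor; its union is maximal. Closure under increasing sequences thus replaces
  Zorn's lemma.\<close>

lemma (in finite_measure) exists_maximal_measure:
  assumes sets: "\<B> \<subseteq> sets M" and ne: "\<B> \<noteq> {}"
    and closed: "\<And>B. incseq B \<Longrightarrow> range B \<subseteq> \<B> \<Longrightarrow> (\<Union>n. B n) \<in> \<B>"
  shows "\<exists>B\<in>\<B>. \<forall>C\<in>\<B>. B \<subseteq> C \<longrightarrow> measure M C \<le> measure M B"
proof -
  have step: "\<exists>B'. B' \<in> \<B> \<and> B \<subseteq> B' \<and> (\<forall>C\<in>\<B>. B \<subseteq> C \<longrightarrow> measure M C \<le> measure M B' + 1 / real (Suc n))"
    if B: "B \<in> \<B>" for B n
  proof -
    let ?V = "measure M ` {C\<in>\<B>. B \<subseteq> C}"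
    have bdd: "bdd_above ?V" by (rule bdd_aboveI[of _ "measure M (space M)"]) (auto simp: bounded_measure)
    have "Sup ?V - 1 / real (Suc n) < Sup ?V" by simp
    moreover have "?V \<noteq> {}" using B by blast
    ultimately obtain v where "v \<in> ?V" "Sup ?V - 1 / real (Suc n) < v"
      using less_cSup_iff[OF _ bdd] by blast
    then obtain B' where B': "B' \<in> \<B>" "B \<subseteq> B'" "Sup ?V - 1 / real (Suc n) < measure M B'" by blast
    have "measure M C \<le> measure M B' + 1 / real (Suc n)" if "C \<in> \<B>" "B \<subseteq> C" for C
    proof -
      have "measure M C \<in> ?V" using that by blast
      from cSup_upper[OF this bdd] show ?thesis using B'(3) by linarith
    qed
    then show ?thesis using B' by blast
  qed
  define Q where "Q n B B' \<longleftrightarrow> B \<subseteq> B' \<and> (\<forall>C\<in>\<B>. B \<subseteq> C \<longrightarrow> measure M C \<le> measure M B' + 1 / real (Suc n))" for n B B'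
  obtain B where "\<forall>n. B n \<in> \<B> \<and> Q n (B n) (B (Suc n))"
  proof (atomize_elim, rule dependent_nat_choice)
    show "\<exists>x. x \<in> \<B>" using ne by blast
    show "\<exists>y. y \<in> \<B> \<and> Q n x y" if "x \<in> \<B>" for x n using step[OF that, of n] unfolding Q_def .
  qed
  then have B: "\<And>n. B n \<in> \<B>" and Bstep: "\<And>n. Q n (B n) (B (Suc n))" by simp_all
  let ?L = "\<Union>n. B n"
  have inc: "incseq B" using Bstep unfolding Q_def by (intro incseq_SucI) simp
  have L: "?L \<in> \<B>" using B by (intro closed inc) auto
  have "measure M C \<le> measure M ?L" if C: "C \<in> \<B>" "?L \<subseteq> C" for C
  proof (rule field_le_epsilon)
    fix e :: real assume "0 < e"
    then obtain n where n: "1 / real (Suc n) < e" using nat_approx_posE by blast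
    have "measure M C \<le> measure M (B (Suc n)) + 1 / real (Suc n)" using Bstep[of n] C unfolding Q_def by blast
    also have "measure M (B (Suc n)) \<le> measure M ?L"
      using L sets by (intro finite_measure_mono) auto
    finally show "measure M C \<le> measure M ?L + e" using n by linarith
  qed
  then show ?thesis using L by blast
qed

text \<open>Call a set bad if its boundary is at most \<open>\<delta>/2\<close> times its measure. Take \<open>B\<close> maximal among the bad sets of
  measure at most \<open>\<alpha>\<close>, and let \<open>Y\<close> be its complement. If a set \<open>A\<close> in \<open>Y\<close> did not expand in \<open>Y\<close>, then
  \<open>A \<union> B\<close> would be bad, because an edge leaving it leaves \<open>A\<close> inside \<open>Y\<close> or has exactly one end in \<open>B\<close>. Sets of
  intermediate measure have boundary at least \<open>\<delta>\<close> and are not bad, so \<open>A \<union> B\<close> would be a larger bad set of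
  measure below \<open>\<alpha>\<close>.\<close>

lemma (in finite_measure) exists_expanding_domain:
  fixes t :: "'i \<Rightarrow> 'a \<Rightarrow> 'a"
  assumes I: "finite I" and t [measurable]: "\<And>i. i \<in> I \<Longrightarrow> t i \<in> measurable M M"
    and prob: "measure M (space M) = 1"
    and K: "\<And>i A. i \<in> I \<Longrightarrow> A \<in> sets M \<Longrightarrow> measure M (t i -` A \<inter> space M) \<le> K * measure M A"
    and \<alpha>: "0 < \<alpha>" "\<alpha> \<le> 1 / 3" and \<delta>: "0 < \<delta>"
    and exp: "\<And>A. A \<in> sets M \<Longrightarrow> \<alpha> \<le> measure M A \<Longrightarrow> measure M A \<le> 1 - \<alpha> \<Longrightarrow> \<delta> \<le> edge_boundary M I t A"
  shows "\<exists>Y\<in>sets M. 1 - \<alpha> \<le> measure M Y \<and>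
    (\<forall>A\<in>sets M. A \<subseteq> Y \<longrightarrow> measure M A \<le> measure M Y / 2 \<longrightarrow>
       \<delta> / 2 * measure M A \<le> (\<Sum>i\<in>I. measure M {x\<in>Y. t i x \<in> Y \<and> (t i x \<in> A) \<noteq> (x \<in> A)}))"
proof -
  let ?E = "\<lambda>i A. {x\<in>space M. (t i x \<in> A) \<noteq> (x \<in> A)}"
  define \<B> where "\<B> = {B\<in>sets M. edge_boundary M I t B \<le> \<delta> / 2 * measure M B \<and> measure M B \<le> \<alpha>}"
  have le1: "measure M A \<le> 1" for A using bounded_measure[of A] prob by simp
  have ts: "t i x \<in> space M" if "i \<in> I" "x \<in> space M" for i x
    using t[OF that(1)] that(2) by (rule measurable_space)
  have "\<exists>B\<in>\<B>. \<forall>C\<in>\<B>. B \<subseteq> C \<longrightarrow> measure M C \<le> measure M B"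
  proof (rule exists_maximal_measure)
    have "{} \<in> \<B>" using \<alpha> by (simp add: \<B>_def edge_boundary_def)
    then show "\<B> \<noteq> {}" by blast
    show "\<B> \<subseteq> sets M" by (auto simp: \<B>_def)
    fix B :: "nat \<Rightarrow> 'a set" assume inc: "incseq B" and B: "range B \<subseteq> \<B>"
    let ?U = "\<Union>n. B n"
    have [measurable]: "B n \<in> sets M" for n using B by (auto simp: \<B>_def)
    have lim: "(\<lambda>n. measure M (B n)) \<longlonglongrightarrow> measure M ?U"
      by (rule finite_Lim_measure_incseq) (use inc in auto)
    \<comment> \<open>The boundary depends continuously on the set, since the measure of a preimage under \<open>t i\<close> is at most \<open>K\<close> times that of the set.\<close>
    have approx: "edge_boundary M I t ?U \<le> \<delta> / 2 * measure M (B n) + real (card I) * (K + 1) * (measure M ?U - measure M (B n))" for n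
    proof -
      have d: "measure M (?U - B n) = measure M ?U - measure M (B n)"
        by (rule finite_measure_Diff) auto
      have "edge_boundary M I t ?U \<le> (\<Sum>i\<in>I. measure M (?E i (B n)) + (K + 1) * measure M (?U - B n))"
        unfolding edge_boundary_def
      proof (rule sum_mono)
        fix i assume i: "i \<in> I"
        note [measurable] = i
        have "measure M (?E i ?U)
          \<le> measure M ((?E i (B n)) \<union> ((t i -` (?U - B n) \<inter> space M) \<union> (?U - B n)))"
        proof (intro finite_measure_mono)
          show "(?E i (B n)) \<union> ((t i -` (?U - B n) \<inter> space M) \<union> (?U - B n)) \<in> sets M"
            by (intro sets.Un measurable_sets[OF t[OF i]]) measurable
        qed auto
        also have "\<dots> \<le> measure M (?E i (B n)) + (measure M (t i -` (?U - B n) \<inter> space M) + measure M (?U - B n))"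
          by (intro order_trans[OF measure_Un_le] add_left_mono measure_Un_le sets.Un
              measurable_sets[OF t[OF i]]) measurable
        also have "\<dots> \<le> measure M (?E i (B n)) + (K + 1) * measure M (?U - B n)"
          using K[OF i, of "?U - B n"] by (simp add: algebra_simps)
        finally show "measure M (?E i ?U) \<le> 
          measure M (?E i (B n)) + (K + 1) * measure M (?U - B n)" .
      qed
      also have "\<dots> = edge_boundary M I t (B n) + real (card I) * (K + 1) * (measure M ?U - measure M (B n))"
        unfolding d by (simp add: sum.distrib edge_boundary_def)
      also have "edge_boundary M I t (B n) \<le> \<delta> / 2 * measure M (B n)" using B by (auto simp: \<B>_def)
      finally show ?thesis by simp
    qed
    have "(\<lambda>n. \<delta> / 2 * measure M (B n) + real (card I) * (K + 1) * (measure M ?U - measure M (B n)))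
      \<longlonglongrightarrow> \<delta> / 2 * measure M ?U + real (card I) * (K + 1) * (measure M ?U - measure M ?U)"
      by (intro tendsto_intros lim)
    from LIMSEQ_le_const[OF this, of "edge_boundary M I t ?U"] approx
    have "edge_boundary M I t ?U \<le> \<delta> / 2 * measure M ?U" by simp
    moreover have "measure M ?U \<le> \<alpha>"
      using LIMSEQ_le_const2[OF lim, of \<alpha>] B by (auto simp: \<B>_def)
    moreover have "?U \<in> sets M" by measurable
    ultimately show "?U \<in> \<B>" by (simp add: \<B>_def)
  qed
  then obtain B where B: "B \<in> sets M" "edge_boundary M I t B \<le> \<delta> / 2 * measure M B" "measure M B \<le> \<alpha>"
    and max: "\<And>C. C \<in> \<B> \<Longrightarrow> B \<subseteq> C \<Longrightarrow> measure M C \<le> measure M B"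
    by (auto simp: \<B>_def)
  note [measurable] = B(1)
  define Y where "Y = space M - B"
  have Y: "Y \<in> sets M" "measure M Y = 1 - measure M B" using finite_measure_compl[OF B(1)] prob by (auto simp: Y_def)
  let ?F = "\<lambda>i A. {x\<in>Y. t i x \<in> Y \<and> (t i x \<in> A) \<noteq> (x \<in> A)}"
  have "\<delta> / 2 * measure M A \<le> (\<Sum>i\<in>I. measure M (?F i A))" (is "_ \<le> ?bd")
    if A [measurable]: "A \<in> sets M" "A \<subseteq> Y" "measure M A \<le> measure M Y / 2" for A
  proof (rule ccontr)
    assume "\<not> ?thesis"
    then have bad: "?bd < \<delta> / 2 * measure M A" by simp
    have "0 \<le> ?bd" by (simp add: sum_nonneg)
    with bad have "measure M A \<noteq> 0" by auto
    then have pos: "0 < measure M A" by (simp add: zero_less_measure_iff)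
    have AB: "measure M (A \<union> B) = measure M A + measure M B"
      using A(2) by (intro finite_measure_Union) (auto simp: Y_def)
    have "edge_boundary M I t (A \<union> B) \<le> (\<Sum>i\<in>I. measure M (?F i A) 
        + measure M (?E i B))"
      unfolding edge_boundary_def
    proof (rule sum_mono)
      fix i assume i: "i \<in> I"
      note [measurable] = i
      have e: "(?F i A) = {x\<in>space M. x \<notin> B \<and> t i x \<notin> B \<and> (t i x \<in> A) \<noteq> (x \<in> A)}"
        using ts[OF i] by (auto simp: Y_def)
      have m: "(?F i A) \<in> sets M"
        unfolding e by measurable
      have "measure M (?E i (A \<union> B)) \<le> measure M ((?F i A) 
        \<union> (?E i B))"
        using m ts[OF i] by (intro finite_measure_mono) (auto simp: Y_def)
      also have "\<dots> \<le> measure M (?F i A) + measure M (?E i B)"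
        using m by (intro measure_Un_le) auto
      finally show "measure M (?E i (A \<union> B)) \<le> 
        measure M (?F i A) + measure M (?E i B)" .
    qed
    also have "\<dots> = ?bd + edge_boundary M I t B" by (simp add: sum.distrib edge_boundary_def)
    also have "\<dots> < \<delta> / 2 * measure M (A \<union> B)" using bad B(2) by (simp add: AB distrib_left)
    finally have bdAB: "edge_boundary M I t (A \<union> B) < \<delta> / 2 * measure M (A \<union> B)" .
    have "\<delta> / 2 * measure M (A \<union> B) \<le> \<delta> / 2 * 1" using \<delta> le1 by (intro mult_left_mono) auto
    then have "edge_boundary M I t (A \<union> B) < \<delta>" using bdAB \<delta> by linarith
    \<comment> \<open>The union has measure at most \<open>(1 + \<alpha>)/2\<close>, which is where \<open>\<alpha> \<le> 1/3\<close> enters.\<close>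
    moreover have "measure M (A \<union> B) \<le> 1 - \<alpha>" using A(3) B(3) \<alpha> unfolding AB Y(2) by simp
    ultimately have "measure M (A \<union> B) < \<alpha>" using exp[of "A \<union> B"] B(1) A(1) by (meson not_le sets.Un)
    then have "A \<union> B \<in> \<B>" using bdAB by (simp add: \<B>_def)
    from max[OF this] show False using pos by (simp add: AB)
  qed
  then show ?thesis using Y B(3) by (intro bexI[of _ Y]) auto
qed

lemma (in finite_measure) emeasure_pushforward:
  assumes [measurable]: "S \<in> sets M" "t \<in> measurable M M" "A \<in> sets M"
  shows "emeasure (distr (density M (indicator S)) M t) A = ennreal (measure M {x\<in>S. t x \<in> A})"
proof -
  have Ss: "S \<subseteq> space M" using sets.sets_into_space[OF assms(1)] .
  let ?N = "distr (density M (indicator S)) M t"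
  have "emeasure ?N A = emeasure (density M (indicator S)) (t -` A \<inter> space M)"
    by (subst emeasure_distr) auto
  also have "\<dots> = (\<integral>\<^sup>+x. indicator S x * indicator (t -` A \<inter> space M) x \<partial>M)"
    by (subst emeasure_density) auto
  also have "\<dots> = (\<integral>\<^sup>+x. indicator {x\<in>S. t x \<in> A} x \<partial>M)"
    using Ss by (intro nn_integral_cong) (auto simp: indicator_def)
  also have "\<dots> = emeasure M {x\<in>S. t x \<in> A}"
  proof -
    have "{x\<in>S. t x \<in> A} = {x\<in>space M. x \<in> S \<and> t x \<in> A}" using Ss by auto
    then have "{x\<in>S. t x \<in> A} \<in> sets M" by simp
    then show ?thesis by simp
  qed
  finally show ?thesis by (simp add: emeasure_eq_measure)
qed

text \<open>A Radon--Nikodym derivative of a measure that is dominated by \<open>D\<close> times \<open>M\<close> is at most \<open>D\<close> almost everywhere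
  and is truncated at \<open>D\<close> to make the bound hold everywhere.\<close>

lemma (in finite_measure) exists_bounded_density:
  fixes t :: "'a \<Rightarrow> 'a"
  assumes [measurable]: "S \<in> sets M" "t \<in> measurable M M"
    and le: "\<And>A. A \<in> sets M \<Longrightarrow> measure M {x\<in>S. t x \<in> A} \<le> D * measure M A"
    and D: "0 \<le> D"
  shows "\<exists>\<rho>. \<rho> \<in> borel_measurable M \<and> (\<forall>x. 0 \<le> \<rho> x) \<and> (\<forall>x. \<rho> x \<le> D) \<and>
    distr (density M (indicator S)) M t = density M (\<lambda>x. ennreal (\<rho> x))"
proof -
  let ?N = "distr (density M (indicator S)) M t"
  have em: "emeasure ?N A = ennreal (measure M {x\<in>S. t x \<in> A})" if "A \<in> sets M" for A
    by (rule emeasure_pushforward[OF assms(1,2) that])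
  have emle: "emeasure ?N A \<le> ennreal D * emeasure M A" if "A \<in> sets M" for A
    using em[OF that] le[OF that] D by (simp add: emeasure_eq_measure ennreal_mult[symmetric] ennreal_leI)
  have "absolutely_continuous M ?N"
    unfolding absolutely_continuous_def
  proof
    fix A assume "A \<in> null_sets M"
    then have A: "A \<in> sets M" "emeasure M A = 0" by auto
    then have "emeasure ?N A \<le> 0" using emle[OF A(1)] by simp
    with A show "A \<in> null_sets ?N" by (simp add: null_sets_def)
  qed
  then obtain r where r [measurable]: "r \<in> borel_measurable M" and rN: "density M r = ?N"
    using Radon_Nikodym[of ?N] by auto
  have "AE x in M. r x \<le> ennreal D"
  proof -
    let ?Z = "{x\<in>space M. ennreal D < r x}"
    have Z [measurable]: "?Z \<in> sets M" by measurable
    have "(\<integral>\<^sup>+x. r x * indicator ?Z x \<partial>M) \<le> ennreal D * emeasure M ?Z"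
      using emle[OF Z] emeasure_density[OF r Z] by (simp only: rN)
    also have "\<dots> = (\<integral>\<^sup>+x. ennreal D * indicator ?Z x \<partial>M)" by (simp add: nn_integral_cmult)
    finally have le2: "(\<integral>\<^sup>+x. r x * indicator ?Z x \<partial>M) \<le> (\<integral>\<^sup>+x. ennreal D * indicator ?Z x \<partial>M)" .
    have fin: "(\<integral>\<^sup>+x. ennreal D * indicator ?Z x \<partial>M) \<noteq> \<infinity>"
      by (simp add: nn_integral_cmult emeasure_eq_measure ennreal_mult[symmetric] D)
    have "(\<integral>\<^sup>+x. r x * indicator ?Z x - ennreal D * indicator ?Z x \<partial>M)
      = (\<integral>\<^sup>+x. r x * indicator ?Z x \<partial>M) - (\<integral>\<^sup>+x. ennreal D * indicator ?Z x \<partial>M)"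
      using fin by (intro nn_integral_diff) (auto simp: indicator_def intro!: AE_I2 less_imp_le)
    also have "\<dots> = 0" using le2 fin by (simp add: diff_eq_0_iff_ennreal less_top)
    finally have "AE x in M. r x * indicator ?Z x - ennreal D * indicator ?Z x = 0"
      by (subst (asm) nn_integral_0_iff_AE) auto
    then show ?thesis
      using AE_space
    proof eventually_elim
      case (elim x)
      then show ?case using ennreal_minus_eq_0[of "r x" "ennreal D"] by (cases "x \<in> ?Z") (simp_all add: not_less)
    qed
  qed
  then have AEr: "AE x in M. r x = ennreal (enn2real (min (r x) (ennreal D)))"
  proof eventually_elim
    case (elim x)
    then have "r x < top" using ennreal_less_top by (rule le_less_trans)
    then show ?case using elim by (simp add: min_absorb1)
  qed
  show ?thesis
  proof (intro exI conjI allI)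
    show "(\<lambda>x. enn2real (min (r x) (ennreal D))) \<in> borel_measurable M" by measurable
    show "enn2real (min (r x) (ennreal D)) \<le> D" for x
      using D by (intro enn2real_leI) simp_all
    show "?N = density M (\<lambda>x. ennreal (enn2real (min (r x) (ennreal D))))"
      unfolding rN[symmetric] by (intro density_cong AEr) measurable
  qed simp
qed

section \<open>Bisections acting on the unit space\<close>
definition source_act :: "'g groupoid \<Rightarrow> 'g set \<Rightarrow> 'g set \<Rightarrow> 'g set" where
  "source_act G K A = {src G a | a. a \<in> K \<and> rng G a \<in> A}"

lemma range_act_mono: "K \<subseteq> K' \<Longrightarrow> A \<subseteq> A' \<Longrightarrow> range_act G K A \<subseteq> range_act G K' A'"
  by (auto simp: range_act_def)

lemma range_act_Union: "range_act G (\<Union>F) A = (\<Union>B\<in>F. range_act G B A)"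
  by (auto simp: range_act_def)

definition restrict_arrows :: "'g groupoid \<Rightarrow> 'g set \<Rightarrow> 'g set \<Rightarrow> 'g set \<Rightarrow> 'g set" where
  "restrict_arrows G X Z B = {a\<in>B. src G a \<in> X \<and> rng G a \<in> Z}"

lemma range_act_restrict: "range_act G (restrict_arrows G X Z B) A = Z \<inter> range_act G B (A \<inter> X)"
  and source_act_restrict: "source_act G (restrict_arrows G X Z B) A = X \<inter> source_act G B (A \<inter> Z)"
  by (auto simp: range_act_def source_act_def restrict_arrows_def)

text \<open>Extending by the identity makes the bisection a measurable self-map of the unit space that contributes
  no difference \<open>f (t x) - f x\<close> outside its domain.\<close>

definition forward_map :: "'g groupoid \<Rightarrow> 'g set \<Rightarrow> 'g \<Rightarrow> 'g" where
  "forward_map G B x = (if x \<in> src G ` B then rng G (the_inv_into B (src G) x) else x)"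

definition backward_map :: "'g groupoid \<Rightarrow> 'g set \<Rightarrow> 'g \<Rightarrow> 'g" where
  "backward_map G B y = (if y \<in> rng G ` B then src G (the_inv_into B (rng G) y) else y)"

lemma forward_map_src: "inj_on (src G) B \<Longrightarrow> a \<in> B \<Longrightarrow> forward_map G B (src G a) = rng G a"
  by (auto simp: forward_map_def the_inv_into_f_f)

lemma backward_map_rng: "inj_on (rng G) B \<Longrightarrow> a \<in> B \<Longrightarrow> backward_map G B (rng G a) = src G a"
  by (auto simp: backward_map_def the_inv_into_f_f)

lemma forward_map_outside: "x \<notin> src G ` B \<Longrightarrow> forward_map G B x = x"
  and backward_map_outside: "y \<notin> rng G ` B \<Longrightarrow> backward_map G B y = y"
  by (simp_all add: forward_map_def backward_map_def)

lemma set_length_finite_iff: "set_length l B < \<infinity> \<longleftrightarrow> (\<exists>L. \<forall>a\<in>B. l a \<le> L)"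
proof
  assume "set_length l B < \<infinity>"
  then obtain r where r: "0 \<le> r" "set_length l B = ennreal r"
    by (cases "set_length l B") auto
  have "l a \<le> r" if "a \<in> B" for a
  proof -
    have "ennreal (l a) \<le> ennreal r" 
      unfolding r(2)[symmetric] set_length_def using that by (rule SUP_upper)
    then show ?thesis using r by simp
  qed
  then show "\<exists>L. \<forall>a\<in>B. l a \<le> L" by blast
next
  assume "\<exists>L. \<forall>a\<in>B. l a \<le> L"
  then obtain L where "\<And>a. a \<in> B \<Longrightarrow> l a \<le> L" by blast
  then have "set_length l B \<le> ennreal L"
    unfolding set_length_def by (intro SUP_least ennreal_leI) auto
  also have "\<dots> < \<infinity>" by simp
  finally show "set_length l B < \<infinity>" .
qed

locale length_groupoid = groupoid G for G :: "'g groupoid" +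
  fixes l :: "'g \<Rightarrow> real"
  assumes length_fun: "length_function G l"
begin

lemma ginv_ginv:
  assumes a: "a \<in> arrows G"
  shows "ginv G (ginv G a) = a"
proof -
  let ?b = "ginv G a" and ?c = "ginv G (ginv G a)"
  note b = inv_closed[OF a] and c = inv_closed[OF inv_closed[OF a]]
  have "?c = gmult G ?c (src G ?c)" using mult_src[OF c] by simp
  also have "src G ?c = gmult G ?b a"
    by (simp add: inv_mult a src_inv b rng_inv)
  also have "gmult G ?c (gmult G ?b a) = gmult G (gmult G ?c ?b) a"
    by (rule mult_assoc[symmetric]) (simp_all add: a b c src_inv rng_inv)
  also have "gmult G ?c ?b = rng G a" by (simp add: inv_mult b src_inv a)
  finally show ?thesis using rng_mult_left[OF a] by simp
qed

lemma ginv_image_image: "K \<subseteq> arrows G \<Longrightarrow> ginv G ` ginv G ` K = K"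
  using ginv_ginv by (force simp: image_image subset_eq)

lemma range_act_ginv: "K \<subseteq> arrows G \<Longrightarrow> range_act G (ginv G ` K) A = source_act G K A"
  and source_act_ginv: "K \<subseteq> arrows G \<Longrightarrow> source_act G (ginv G ` K) A = range_act G K A"
  unfolding range_act_def source_act_def by (safe; force simp: rng_inv src_inv subset_eq)+

text \<open>The inverse images needed for measurability and the direct images needed for null sets are all of the
  form \<open>r(B \<cdot> A)\<close> or its mirror image \<open>r(B\<^sup>-\<^sup>1 \<cdot> A)\<close>. In these terms admissibility becomes a closure property of
  two families of sets (\<open>admissible_iff\<close>), from which stability under inverses, products and restrictions
  is immediate.\<close>

definition admissible_via_acts :: "'g measure \<Rightarrow> 'g set \<Rightarrow> bool" where
  "admissible_via_acts M B \<longleftrightarrow> bisection G B \<and> (\<exists>L. \<forall>a\<in>B. l a \<le> L) \<and>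
    (\<forall>A\<in>sets M. range_act G B A \<in> sets M \<and> source_act G B A \<in> sets M) \<and>
    (\<forall>A\<in>null_sets M. range_act G B A \<in> null_sets M \<and> source_act G B A \<in> null_sets M)"

lemma admissible_iff:
  assumes sp: "space M = units G"
  shows "admissible_bisection G l M B \<longleftrightarrow> admissible_via_acts M B"
proof (cases "bisection G B")
  case False then show ?thesis by (simp add: admissible_bisection_def admissible_via_acts_def)
next
  case True
  then have inj: "inj_on (src G) B" "inj_on (rng G) B" and Bsub: "B \<subseteq> arrows G" by (auto simp: bisection_def)
  let ?S = "src G ` B" and ?R = "rng G ` B" and ?t = "bisection_map G B" 
  have ts: "?t (src G a) = rng G a" if "a \<in> B" for a
    using that inj by (simp add: bisection_map_def the_inv_into_f_f)
  have bij: "bij_betw ?t ?S ?R"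
  proof (rule bij_betw_imageI)
    show "inj_on ?t ?S" using ts inj(2) by (auto simp: inj_on_def)
    show "?t ` ?S = ?R" using ts by (auto simp: image_image)
  qed
  let ?u = "the_inv_into ?S ?t"
  have us: "?u (rng G a) = src G a" if "a \<in> B" for a
    using bij that ts[OF that] the_inv_into_f_f[of ?t ?S "src G a"] by (auto simp: bij_betw_def)
  have Su: "?S \<subseteq> space M" "?R \<subseteq> space M" 
    using Bsub src_in_units rng_in_units sp by auto
  have ra: "range_act G B A = ?t ` (A \<inter> ?S)" "range_act G B A = ?u -` (A \<inter> ?S) \<inter> ?R" for A
    unfolding range_act_def using ts us by (force, force)
  have sa: "source_act G B A = ?u ` (A \<inter> ?R)" "source_act G B A = ?t -` (A \<inter> ?R) \<inter> ?S" for A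
    unfolding source_act_def using ts us by (force, force)
  have raS: "range_act G B (space M) = ?R" "source_act G B (space M) = ?S"
    using Bsub src_in_units rng_in_units sp unfolding range_act_def source_act_def by force+
  have tr: "?t \<in> ?S \<rightarrow> ?R" "?u \<in> ?R \<rightarrow> ?S" using ts us by auto
  have sets_restrict: "A \<in> sets (restrict_space M Q) \<longleftrightarrow> A \<in> sets M \<and> A \<subseteq> Q" if "Q \<in> sets M" for A Q
    using that by (auto simp: sets_restrict_space_iff)
  have spr: "space (restrict_space M ?S) = ?S" "space (restrict_space M ?R) = ?R"
    using Su by (auto simp: space_restrict_space)
  have main: "(?S \<in> sets M \<and> ?R \<in> sets M \<and> measure_class_iso M ?S ?R ?t) \<longleftrightarrow>
    (\<forall>A\<in>sets M. range_act G B A \<in> sets M \<and> source_act G B A \<in> sets M) \<and>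
    (\<forall>A\<in>null_sets M. range_act G B A \<in> null_sets M \<and> source_act G B A \<in> null_sets M)" (is "?L \<longleftrightarrow> ?Rt")
  proof
    assume L: ?L
    then have SR: "?S \<in> sets M" "?R \<in> sets M" and t: "?t \<in> measurable (restrict_space M ?S) (restrict_space M ?R)"
      and u: "?u \<in> measurable (restrict_space M ?R) (restrict_space M ?S)"
      and nt: "\<And>A. A \<in> null_sets M \<Longrightarrow> A \<subseteq> ?S \<Longrightarrow> ?t ` A \<in> null_sets M"
      and nu: "\<And>A. A \<in> null_sets M \<Longrightarrow> A \<subseteq> ?R \<Longrightarrow> ?u ` A \<in> null_sets M"
      by (auto simp: measure_class_iso_def)
    note sets_r = sets_restrict[OF SR(1)] sets_restrict[OF SR(2)]
    show ?Rt
    proof (intro conjI ballI)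
      fix A assume A: "A \<in> sets M"
      have "?u -` (A \<inter> ?S) \<inter> ?R \<in> sets (restrict_space M ?R)"
        using measurable_sets[OF u, of "A \<inter> ?S"] A SR by (simp add: sets_r spr)
      then show "range_act G B A \<in> sets M" unfolding ra(2) by (simp add: sets_r)
      have "?t -` (A \<inter> ?R) \<inter> ?S \<in> sets (restrict_space M ?S)"
        using measurable_sets[OF t, of "A \<inter> ?R"] A SR by (simp add: sets_r spr)
      then show "source_act G B A \<in> sets M" unfolding sa(2) by (simp add: sets_r)
    next
      fix A assume A: "A \<in> null_sets M"
      show "range_act G B A \<in> null_sets M" unfolding ra(1) using A SR by (intro nt null_set_Int2) auto
      show "source_act G B A \<in> null_sets M" unfolding sa(1) using A SR by (intro nu null_set_Int2) auto
    qed
  next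
    assume R: ?Rt
    then have SR: "?S \<in> sets M" "?R \<in> sets M" using raS by (metis sets.top)+
    note sets_r = sets_restrict[OF SR(1)] sets_restrict[OF SR(2)]
    have "?t \<in> measurable (restrict_space M ?S) (restrict_space M ?R)"
    proof (rule measurableI)
      fix A assume "A \<in> sets (restrict_space M ?R)"
      then have A: "A \<in> sets M" "A \<inter> ?R = A" by (auto simp: sets_r)
      then show "?t -` A \<inter> space (restrict_space M ?S) \<in> sets (restrict_space M ?S)"
        using R sa(2)[of A] by (auto simp: spr sets_r)
    qed (use tr spr in auto)
    moreover have "?u \<in> measurable (restrict_space M ?R) (restrict_space M ?S)"
    proof (rule measurableI)
      fix A assume "A \<in> sets (restrict_space M ?S)"
      then have A: "A \<in> sets M" "A \<inter> ?S = A" by (auto simp: sets_r)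
      then show "?u -` A \<inter> space (restrict_space M ?R) \<in> sets (restrict_space M ?R)"
        using R ra(2)[of A] by (auto simp: spr sets_r)
    qed (use tr spr in auto)
    moreover have "?t ` A \<in> null_sets M" if "A \<in> null_sets M" "A \<subseteq> ?S" for A
    proof -
      have "range_act G B A \<in> null_sets M" using R that(1) by blast
      then show ?thesis using ra(1)[of A] that(2) by (simp add: Int_absorb2)
    qed
    moreover have "?u ` A \<in> null_sets M" if "A \<in> null_sets M" "A \<subseteq> ?R" for A
    proof -
      have "source_act G B A \<in> null_sets M" using R that(1) by blast
      then show ?thesis using sa(1)[of A] that(2) by (simp add: Int_absorb2)
    qed
    ultimately show ?L using SR bij by (auto simp: measure_class_iso_def)
  qed
  show ?thesis
    unfolding admissible_bisection_def admissible_via_acts_def set_length_finite_iff using main True by blast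
qed

lemma admissible_ginv:
  assumes "admissible_via_acts M B"
  shows "admissible_via_acts M (ginv G ` B)"
proof -
  have B: "B \<subseteq> arrows G" "inj_on (src G) B" "inj_on (rng G) B" 
    using assms by (auto simp: admissible_via_acts_def bisection_def)
  obtain L where L: "\<And>a. a \<in> B \<Longrightarrow> l a \<le> L" using assms by (auto simp: admissible_via_acts_def)
  have "bisection G (ginv G ` B)"
    unfolding bisection_def
    using B by (auto simp: inj_on_def inv_closed src_inv rng_inv subset_eq) 
  moreover have "\<forall>a\<in>ginv G ` B. l a \<le> L" 
    using L B length_fun by (auto simp: length_function_def subset_eq)
  ultimately show ?thesis
    using assms by (auto simp: admissible_via_acts_def range_act_ginv source_act_ginv B)
qed

lemma admissible_units: "space M = units G \<Longrightarrow> admissible_via_acts M (units G)"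
proof -
  assume sp: "space M = units G"
  have "range_act G (units G) A = A" "source_act G (units G) A = A" if "A \<in> sets M" for A
    using sets.sets_into_space[OF that] sp by (auto simp: range_act_def source_act_def rng_unit src_unit subset_eq) 
      (metis rng_unit src_unit)+
  moreover have "bisection G (units G)" using units_subset by (auto simp: bisection_def inj_on_def src_unit rng_unit)
  moreover have "\<forall>a\<in>units G. l a \<le> 0" using length_fun by (auto simp: length_function_def)
  ultimately show ?thesis by (auto simp: admissible_via_acts_def null_sets_def)
qed

definition product_set :: "'g set \<Rightarrow> 'g set \<Rightarrow> 'g set" where
  "product_set K K' = {gmult G a b | a b. a \<in> K \<and> b \<in> K' \<and> src G a = rng G b}"

lemma range_act_product:
  assumes "K \<subseteq> arrows G" "K' \<subseteq> arrows G"
  shows "range_act G (product_set K K') A = range_act G K (range_act G K' A)"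
proof
  show "range_act G (product_set K K') A \<subseteq> range_act G K (range_act G K' A)"
    using assms by (fastforce simp: range_act_def product_set_def src_mult rng_mult)
  show "range_act G K (range_act G K' A) \<subseteq> range_act G (product_set K K') A"
  proof
    fix x assume "x \<in> range_act G K (range_act G K' A)"
    then obtain a b where ab: "a \<in> K" "b \<in> K'" "src G a = rng G b" "x = rng G a" "src G b \<in> A"
      by (auto simp: range_act_def)
    then have "gmult G a b \<in> product_set K K'" "src G (gmult G a b) \<in> A" "x = rng G (gmult G a b)"
      using assms by (auto simp: product_set_def src_mult rng_mult subset_eq)
    then show "x \<in> range_act G (product_set K K') A" by (auto simp: range_act_def)
  qed
qed

lemma source_act_product:
  assumes "K \<subseteq> arrows G" "K' \<subseteq> arrows G"
  shows "source_act G (product_set K K') A = source_act G K' (source_act G K A)"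
proof
  show "source_act G (product_set K K') A \<subseteq> source_act G K' (source_act G K A)"
  proof
    fix x assume "x \<in> source_act G (product_set K K') A"
    then obtain a b where ab: "a \<in> K" "b \<in> K'" "src G a = rng G b" "x = src G (gmult G a b)" "rng G (gmult G a b) \<in> A"
      by (auto simp: source_act_def product_set_def)
    then have "x = src G b" "rng G a \<in> A" using assms by (auto simp: src_mult rng_mult subset_eq)
    then have "rng G b \<in> source_act G K A" using ab(1,3) unfolding source_act_def by (metis (mono_tags, lifting) mem_Collect_eq)
    then show "x \<in> source_act G K' (source_act G K A)" using ab(2) \<open>x = src G b\<close> unfolding source_act_def by blast
  qed
  show "source_act G K' (source_act G K A) \<subseteq> source_act G (product_set K K') A"
  proof
    fix x assume "x \<in> source_act G K' (source_act G K A)"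
    then obtain a b where ab: "a \<in> K" "b \<in> K'" "src G a = rng G b" "x = src G b" "rng G a \<in> A"
      by (auto simp: source_act_def)
    then have "gmult G a b \<in> product_set K K'" "rng G (gmult G a b) \<in> A" "x = src G (gmult G a b)"
      using assms by (auto simp: product_set_def src_mult rng_mult subset_eq)
    then show "x \<in> source_act G (product_set K K') A" by (auto simp: source_act_def)
  qed
qed

lemma admissible_product:
  assumes B: "admissible_via_acts M B" and B': "admissible_via_acts M B'"
  shows "admissible_via_acts M (product_set B B')"
proof -
  have sub: "B \<subseteq> arrows G" "B' \<subseteq> arrows G" and 
    inj: "inj_on (src G) B" "inj_on (rng G) B" "inj_on (src G) B'" "inj_on (rng G) B'"
    using assms by (auto simp: admissible_via_acts_def bisection_def)
  have bis: "bisection G (product_set B B')"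
    unfolding bisection_def
  proof (intro conjI)
    show "product_set B B' \<subseteq> arrows G" using sub by (auto simp: product_set_def mult_closed subset_eq)
    show "inj_on (src G) (product_set B B')"
    proof (rule inj_onI)
      fix x y assume "x \<in> product_set B B'" "y \<in> product_set B B'" and e: "src G x = src G y"
      then obtain a b a' b' where x: "x = gmult G a b" "a \<in> B" "b \<in> B'" "src G a = rng G b"
        and y: "y = gmult G a' b'" "a' \<in> B" "b' \<in> B'" "src G a' = rng G b'"
        by (auto simp: product_set_def)
      have "src G b = src G b'" using x y e sub by (simp add: src_mult subset_eq)
      then have "b = b'" using inj(3) x y by (auto dest: inj_onD)
      moreover from this have "a = a'" using inj(1) x y by (metis inj_onD)
      ultimately show "x = y" using x y by simp
    qed
    show "inj_on (rng G) (product_set B B')"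
    proof (rule inj_onI)
      fix x y assume "x \<in> product_set B B'" "y \<in> product_set B B'" and e: "rng G x = rng G y"
      then obtain a b a' b' where x: "x = gmult G a b" "a \<in> B" "b \<in> B'" "src G a = rng G b"
        and y: "y = gmult G a' b'" "a' \<in> B" "b' \<in> B'" "src G a' = rng G b'"
        by (auto simp: product_set_def)
      have "rng G a = rng G a'" using x y e sub by (simp add: rng_mult subset_eq)
      then have "a = a'" using inj(2) x y by (auto dest: inj_onD)
      moreover from this have "b = b'" using inj(4) x y by (metis inj_onD)
      ultimately show "x = y" using x y by simp
    qed
  qed
  obtain L L' where L: "\<And>a. a \<in> B \<Longrightarrow> l a \<le> L" "\<And>a. a \<in> B' \<Longrightarrow> l a \<le> L'"
    using assms by (auto simp: admissible_via_acts_def)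
  have "\<forall>c\<in>product_set B B'. l c \<le> L + L'"
  proof
    fix c assume "c \<in> product_set B B'"
    then obtain a b where "c = gmult G a b" "a \<in> B" "b \<in> B'" "src G a = rng G b" by (auto simp: product_set_def)
    then show "l c \<le> L + L'" using L[of a] L(2)[of b] length_fun sub 
      by (fastforce simp: length_function_def subset_eq)
  qed
  then show ?thesis
    using assms bis by (auto simp: admissible_via_acts_def range_act_product source_act_product sub)
qed

text \<open>Two measures enter at once because the same restriction serves to change the measure: it suffices that
  they have the same null sets inside \<open>X\<close> and inside \<open>Z\<close>.\<close>

lemma admissible_restrict:
  assumes B: "admissible_via_acts M B" and s: "sets M' = sets M" 
    and X: "X \<in> sets M" "\<And>A. A \<in> sets M \<Longrightarrow> A \<subseteq> X \<Longrightarrow> emeasure M A = 0 \<longleftrightarrow> emeasure M' A = 0"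
    and Z: "Z \<in> sets M" "\<And>A. A \<in> sets M \<Longrightarrow> A \<subseteq> Z \<Longrightarrow> emeasure M A = 0 \<longleftrightarrow> emeasure M' A = 0"
  shows "admissible_via_acts M' (restrict_arrows G X Z B)"
proof -
  have bis: "bisection G (restrict_arrows G X Z B)"
    using B by (auto simp: admissible_via_acts_def bisection_def restrict_arrows_def inj_on_def)
  have len: "\<exists>L. \<forall>a\<in>restrict_arrows G X Z B. l a \<le> L" 
    using B by (auto simp: admissible_via_acts_def restrict_arrows_def)
  have m: "range_act G B A \<in> sets M" "source_act G B A \<in> sets M" if "A \<in> sets M" for A
    using B that by (auto simp: admissible_via_acts_def)
  have n: "range_act G B A \<in> null_sets M" "source_act G B A \<in> null_sets M" if "A \<in> null_sets M" for A
    using B that by (auto simp: admissible_via_acts_def)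
  have XM: "A \<inter> X \<in> null_sets M" "A \<inter> Z \<in> null_sets M" if "A \<in> null_sets M'" for A
  proof -
    have A: "A \<in> sets M" "emeasure M' A = 0" using that s by auto
    have "emeasure M' (A \<inter> X) = 0" "emeasure M' (A \<inter> Z) = 0"
      using that A X(1) Z(1) s by (auto intro!: null_setsD1 null_set_Int2)
    then show "A \<inter> X \<in> null_sets M" "A \<inter> Z \<in> null_sets M" using A X Z by (auto simp: null_sets_def)
  qed
  have MX: "X \<inter> A \<in> null_sets M'" "Z \<inter> A \<in> null_sets M'" if "A \<in> null_sets M" for A
  proof -
    have "emeasure M (X \<inter> A) = 0" "emeasure M (Z \<inter> A) = 0"
      using that X(1) Z(1) by (auto intro!: null_setsD1 null_set_Int1)
    then show "X \<inter> A \<in> null_sets M'" "Z \<inter> A \<in> null_sets M'"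
      using that X(1) Z(1) X(2)[of "X \<inter> A"] Z(2)[of "Z \<inter> A"] s by (auto simp: null_sets_def)
  qed
  show ?thesis
    unfolding admissible_via_acts_def range_act_restrict source_act_restrict
    using bis len m MX[OF n(1)[OF XM(1)]] MX[OF n(2)[OF XM(2)]] X(1) Z(1) by (auto simp: s)
qed

definition controlled :: "'g measure \<Rightarrow> 'g set \<Rightarrow> bool" where
  "controlled M K \<longleftrightarrow> (\<exists>F. finite F \<and> (\<forall>B\<in>F. admissible_via_acts M B) \<and> K = \<Union>F)"

lemma decomposable_iff_controlled: "space M = units G \<Longrightarrow> decomposable G l M K \<longleftrightarrow> controlled M K"
  by (simp add: decomposable_def controlled_def admissible_iff)

lemma controlled_subset: "controlled M K \<Longrightarrow> K \<subseteq> arrows G"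
  by (auto simp: controlled_def admissible_via_acts_def bisection_def)

lemma controlled_admissible: "admissible_via_acts M B \<Longrightarrow> controlled M B"
  unfolding controlled_def by (intro exI[of _ "{B}"]) auto

lemma controlled_Un: "controlled M K \<Longrightarrow> controlled M K' \<Longrightarrow> controlled M (K \<union> K')"
  unfolding controlled_def by (metis Un_iff Union_Un_distrib finite_UnI)

lemma controlled_UN: "finite I \<Longrightarrow> (\<And>i. i \<in> I \<Longrightarrow> controlled M (K i)) \<Longrightarrow> controlled M (\<Union>i\<in>I. K i)"
proof (induction I rule: finite_induct)
  case empty
  show ?case unfolding controlled_def by (intro exI[of _ "{}"]) auto
qed (auto intro: controlled_Un)

lemma controlled_product: 
  assumes "controlled M K" "controlled M K'"
  shows "controlled M (product_set K K')"
proof -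
  obtain F F' where F: "finite F" "\<And>B. B \<in> F \<Longrightarrow> admissible_via_acts M B" "K = \<Union>F"
    and F': "finite F'" "\<And>B. B \<in> F' \<Longrightarrow> admissible_via_acts M B" "K' = \<Union>F'"
    using assms unfolding controlled_def by blast
  have "product_set K K' = (\<Union>B\<in>F. \<Union>B'\<in>F'. product_set B B')"
    unfolding F F' product_set_def by blast
  then show ?thesis using F F' by (simp only:) (intro controlled_UN controlled_admissible admissible_product; simp)
qed

lemma controlled_restrict:
  assumes K: "controlled M K" and s: "sets M' = sets M" "X \<in> sets M" 
    and X: "\<And>A. A \<in> sets M \<Longrightarrow> A \<subseteq> X \<Longrightarrow> emeasure M A = 0 \<longleftrightarrow> emeasure M' A = 0"
  shows "controlled M' (restrict_arrows G X X K)"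
proof -
  obtain F where F: "finite F" "\<And>B. B \<in> F \<Longrightarrow> admissible_via_acts M B" "K = \<Union>F"
    using K unfolding controlled_def by blast
  have "restrict_arrows G X X K = (\<Union>B\<in>F. restrict_arrows G X X B)" by (auto simp: F restrict_arrows_def)
  then show ?thesis using F 
    by (simp only:) (intro controlled_UN controlled_admissible admissible_restrict[where M = M] s X; simp)
qed

lemma controlled_range_act:
  assumes K: "controlled M K" and A: "A \<in> sets M"
  shows "range_act G K A \<in> sets M" 
proof -
  obtain F where F: "finite F" "\<And>B. B \<in> F \<Longrightarrow> admissible_via_acts M B" "K = \<Union>F"
    using K unfolding controlled_def by blast
  show ?thesis unfolding F(3) range_act_Union
    using F A by (intro sets.finite_UN) (auto simp: admissible_via_acts_def)
qed

definition symmetric_hull :: "'g set \<Rightarrow> 'g set" where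
  "symmetric_hull K = K \<union> ginv G ` K \<union> units G"

lemma ginv_unit: "x \<in> units G \<Longrightarrow> ginv G x = x"
proof -
  assume x: "x \<in> units G"
  then have a: "x \<in> arrows G" using units_subset by auto
  have "ginv G x = gmult G (ginv G x) (src G (ginv G x))" using mult_src[OF inv_closed[OF a]] by simp
  also have "src G (ginv G x) = x" using a x by (simp add: src_inv rng_unit)
  finally show ?thesis using inv_mult[OF a] src_unit[OF x] by simp
qed

lemma N_decomposable_controlled: "space M = units G \<Longrightarrow> N_decomposable G l M N K \<Longrightarrow> controlled M K"
  by (simp add: N_decomposable_def decomposable_iff_controlled)

text \<open>Once a decomposition is closed under inverses and contains the unit space, enumerating it without
  repetition supplies the bijection \<open>\<sigma>\<close>: inversion is an involution of the family. Its length is automatically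
  finite. Thus symmetry, unitality and the parameters \<open>N\<close> and \<open>L\<close> can be added at the very end.\<close>

lemma symmetric_hull_N_decomposable:
  assumes sp: "space M = units G" and K: "controlled M K"
  shows "\<exists>N (L::real). 0 < N \<and> 0 < L \<and> N_decomposable G l M N (symmetric_hull K) \<and> set_length l (symmetric_hull K) \<le> ennreal L"
proof -
  obtain F0 where F0: "finite F0" "\<And>B. B \<in> F0 \<Longrightarrow> admissible_via_acts M B" "K = \<Union>F0"
    using K unfolding controlled_def by blast
  define F where "F = F0 \<union> (`) (ginv G) ` F0 \<union> {units G}"
  have F: "finite F" "\<And>B. B \<in> F \<Longrightarrow> admissible_via_acts M B"
    using F0 admissible_units[OF sp] by (auto simp: F_def intro: admissible_ginv)
  have uF: "symmetric_hull K = \<Union>F" unfolding F0(3) F_def symmetric_hull_def by auto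
  have sub: "K \<subseteq> arrows G" "\<Union>F \<subseteq> arrows G"
  proof -
    have a: "B \<subseteq> arrows G" if "B \<in> F" for B using F(2)[OF that] by (simp add: admissible_via_acts_def bisection_def)
    then show "\<Union>F \<subseteq> arrows G" by blast
    then show "K \<subseteq> arrows G" unfolding F0(3) F_def by blast
  qed
  have iu: "ginv G ` units G = units G" using ginv_unit by force
  have inv: "ginv G ` B \<in> F" "ginv G ` ginv G ` B = B" if "B \<in> F" for B
  proof -
    have "B \<subseteq> arrows G" using that sub by blast
    then show "ginv G ` ginv G ` B = B" by (rule ginv_image_image)
    show "ginv G ` B \<in> F"
    proof -
      consider "B \<in> F0" | C where "C \<in> F0" "B = ginv G ` C" | "B = units G" using \<open>B \<in> F\<close> unfolding F_def by blast
      then show ?thesis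
      proof cases
        case 2
        then have "C \<subseteq> arrows G" using sub(1) F0(3) by blast
        then show ?thesis using 2 ginv_image_image[of C] by (simp add: F_def)
      qed (auto simp: F_def iu)
    qed
  qed
  obtain h where h: "bij_betw h {1..card F} F" using ex_bij_betw_nat_finite_1[OF F(1)] by blast
  define \<sigma> where "\<sigma> i = inv_into {1..card F} h (ginv G ` h i)" for i
  have hF: "i \<in> {1..card F} \<Longrightarrow> h i \<in> F" for i using h by (auto simp: bij_betw_def)
  have \<sigma>: "\<sigma> i \<in> {1..card F}" "h (\<sigma> i) = ginv G ` h i" if "i \<in> {1..card F}" for i
  proof -
    have "ginv G ` h i \<in> h ` {1..card F}" using inv(1)[OF hF[OF that]] h by (auto simp: bij_betw_def)
    then show "\<sigma> i \<in> {1..card F}" "h (\<sigma> i) = ginv G ` h i" unfolding \<sigma>_def 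
      by (rule inv_into_into, rule f_inv_into_f)
  qed
  have \<sigma>\<sigma>: "\<sigma> (\<sigma> i) = i" if i: "i \<in> {1..card F}" for i
  proof -
    have "h (\<sigma> (\<sigma> i)) = h i" using \<sigma>[OF i] \<sigma>(2)[OF \<sigma>(1)[OF i]] inv(2)[OF hF[OF i]] by simp
    then show ?thesis using h i \<sigma>(1)[OF \<sigma>(1)[OF i]] by (auto simp: bij_betw_def dest: inj_onD)
  qed
  have bij: "bij_betw \<sigma> {1..card F} {1..card F}"
    by (rule bij_betw_byWitness[of _ \<sigma>]) (use \<sigma> \<sigma>\<sigma> in auto)
  have UF: "\<Union>F = (\<Union>i\<in>{1..card F}. h i)" using h by (auto simp: bij_betw_def)
  have unit: "\<exists>i\<in>{1..card F}. h i = units G"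
  proof -
    have "units G \<in> h ` {1..card F}" using h by (auto simp: bij_betw_def F_def)
    then show ?thesis by force
  qed
  have "unital_subset G (\<Union>F)" using sub by (auto simp: unital_subset_def F_def)
  moreover have "symmetric_subset G (\<Union>F)"
    unfolding symmetric_subset_def
  proof
    have "ginv G ` \<Union>F \<subseteq> \<Union>F" using inv(1) by blast
    moreover have "\<Union>F \<subseteq> ginv G ` \<Union>F" using inv by blast
    ultimately show "ginv G ` \<Union>F = \<Union>F" by blast
  qed (use sub in auto)
  moreover have "decomposable G l M (\<Union>F)" 
    unfolding decomposable_iff_controlled[OF sp] controlled_def using F by blast
  ultimately have "N_decomposable G l M (card F) (\<Union>F)"
    unfolding N_decomposable_def admissible_iff[OF sp]
    using F(2)[OF hF] UF unit bij \<sigma>(2) by (intro conjI exI[of _ h] exI[of _ \<sigma>]) auto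
  moreover have "0 < card F" using F(1) by (auto simp: card_gt_0_iff F_def)
  moreover have "\<exists>L::real. 0 < L \<and> set_length l (\<Union>F) \<le> ennreal L"
  proof -
    obtain Lf where Lf: "\<And>B a. B \<in> F \<Longrightarrow> a \<in> B \<Longrightarrow> l a \<le> Lf B"
      using F(2) unfolding admissible_via_acts_def by metis
    have "l a \<le> (\<Sum>B\<in>F. \<bar>Lf B\<bar>) + 1" if "a \<in> \<Union>F" for a
    proof -
      obtain B where B: "B \<in> F" "a \<in> B" using \<open>a \<in> \<Union>F\<close> by blast
      have "l a \<le> \<bar>Lf B\<bar>" using Lf[OF B] by simp
      also have "\<dots> \<le> (\<Sum>B\<in>F. \<bar>Lf B\<bar>)" using B F(1) by (intro member_le_sum) auto
      finally show ?thesis by simp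
    qed
    then have "set_length l (\<Union>F) \<le> ennreal ((\<Sum>B\<in>F. \<bar>Lf B\<bar>) + 1)"
      unfolding set_length_def by (intro SUP_least ennreal_leI)
    moreover have "0 < (\<Sum>B\<in>F. \<bar>Lf B\<bar>) + 1" by (intro add_nonneg_pos sum_nonneg) auto
    ultimately show ?thesis by blast
  qed
  ultimately show ?thesis unfolding uF by blast
qed

end

section \<open>Bisections of bounded distortion\<close>
text \<open>This bounds the Radon--Nikodym derivatives of the bisection and of its inverse by \<open>D\<close>. The formulation through
  sets passes to sub-bisections without any discussion of densities.\<close>

definition bounded_distortion :: "'g groupoid \<Rightarrow> 'g measure \<Rightarrow> real \<Rightarrow> 'g set \<Rightarrow> bool" where
  "bounded_distortion G M D B \<longleftrightarrow> (\<forall>A\<in>sets M.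
     measure M (range_act G B A) \<le> D * measure M A \<and> measure M (source_act G B A) \<le> D * measure M A)"

lemma bounded_distortion_mono:
  "bounded_distortion G M D B \<Longrightarrow> D \<le> D' \<Longrightarrow> bounded_distortion G M D' B"
  unfolding bounded_distortion_def by (meson measure_nonneg mult_right_mono order_trans)

text \<open>Pointwise finite propagation: \<open>T f x\<close> is determined by the values of \<open>f\<close> at the points that \<open>W\<close> reaches
  from \<open>x\<close>. For linear \<open>T\<close> it suffices to state this for vanishing values.\<close>

definition local_operator :: "'g groupoid \<Rightarrow> 'g set \<Rightarrow> 'g operator \<Rightarrow> bool" where
  "local_operator G W T \<longleftrightarrow>
     (\<forall>f. \<forall>x\<in>units G. (\<forall>a\<in>W. src G a = x \<longrightarrow> f (rng G a) = 0) \<longrightarrow> T f x = 0)"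

locale measured_groupoid = length_groupoid G l + finite_measure M
  for G :: "'g groupoid" and l :: "'g \<Rightarrow> real" and M :: "'g measure" +
  assumes space_M: "space M = units G"
begin

lemma source_act_eq:
  assumes "inj_on (src G) B"
  shows "source_act G B A = {x \<in> src G ` B. forward_map G B x \<in> A}"
  using assms by (auto simp: source_act_def forward_map_src)

lemma range_act_eq:
  assumes "inj_on (rng G) B"
  shows "range_act G B A = {y \<in> rng G ` B. backward_map G B y \<in> A}"
  using assms by (auto simp: range_act_def backward_map_rng)

lemma admissible_facts:
  assumes "admissible_via_acts M B"
  shows "B \<subseteq> arrows G" "inj_on (src G) B" "inj_on (rng G) B"
    "src G ` B \<in> sets M" "rng G ` B \<in> sets M"
    "\<And>A. A \<in> sets M \<Longrightarrow> range_act G B A \<in> sets M" "\<And>A. A \<in> sets M \<Longrightarrow> source_act G B A \<in> sets M"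
    "\<And>A. A \<in> null_sets M \<Longrightarrow> range_act G B A \<in> null_sets M" "\<And>A. A \<in> null_sets M \<Longrightarrow> source_act G B A \<in> null_sets M"
    "range_act G B (space M) = rng G ` B" "source_act G B (space M) = src G ` B"
proof -
  show sub: "B \<subseteq> arrows G" "inj_on (src G) B" "inj_on (rng G) B"
    and m: "\<And>A. A \<in> sets M \<Longrightarrow> range_act G B A \<in> sets M" "\<And>A. A \<in> sets M \<Longrightarrow> source_act G B A \<in> sets M"
    and "\<And>A. A \<in> null_sets M \<Longrightarrow> range_act G B A \<in> null_sets M" "\<And>A. A \<in> null_sets M \<Longrightarrow> source_act G B A \<in> null_sets M"
    using assms by (auto simp: admissible_via_acts_def bisection_def)
  show e: "range_act G B (space M) = rng G ` B" "source_act G B (space M) = src G ` B"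
    using sub(1) src_in_units rng_in_units space_M unfolding range_act_def source_act_def by force+
  show "src G ` B \<in> sets M" "rng G ` B \<in> sets M" using m[OF sets.top] e by simp_all
qed

lemma forward_map_measurable:
  assumes "admissible_via_acts M B"
  shows "forward_map G B \<in> measurable M M"
proof (rule measurableI)
  note f = admissible_facts[OF assms]
  show "forward_map G B x \<in> space M" if "x \<in> space M" for x
    using that f(1) rng_in_units space_M by (cases "x \<in> src G ` B") (auto simp: forward_map_src[OF f(2)] forward_map_outside)
  fix A assume A: "A \<in> sets M"
  have "forward_map G B -` A \<inter> space M = source_act G B A \<union> (A - src G ` B)"
    using sets.sets_into_space[OF A] sets.sets_into_space[OF f(4)]
    by (auto simp: source_act_eq[OF f(2)] forward_map_outside) (metis forward_map_outside)
  then show "forward_map G B -` A \<inter> space M \<in> sets M" using f A by auto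
qed

lemma backward_map_measurable:
  assumes "admissible_via_acts M B"
  shows "backward_map G B \<in> measurable M M"
proof (rule measurableI)
  note f = admissible_facts[OF assms]
  show "backward_map G B x \<in> space M" if "x \<in> space M" for x
    using that f(1) src_in_units space_M by (cases "x \<in> rng G ` B") (auto simp: backward_map_rng[OF f(3)] backward_map_outside)
  fix A assume A: "A \<in> sets M"
  have "backward_map G B -` A \<inter> space M = range_act G B A \<union> (A - rng G ` B)"
    using sets.sets_into_space[OF A] sets.sets_into_space[OF f(5)]
    by (auto simp: range_act_eq[OF f(3)] backward_map_outside) (metis backward_map_outside)
  then show "backward_map G B -` A \<inter> space M \<in> sets M" using f A by auto
qed

lemma source_range_subset: "inj_on (rng G) B \<Longrightarrow> A' \<subseteq> range_act G B A \<Longrightarrow> source_act G B A' \<subseteq> A"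
  by (force simp: source_act_def range_act_def dest: inj_onD)

lemma range_source: "A \<subseteq> rng G ` B \<Longrightarrow> A \<subseteq> range_act G B (source_act G B A)"
  by (force simp: source_act_def range_act_def)

text \<open>With \<open>r\<close> the density of the pushforward along \<open>B\<close>, keep the arrows whose range lies in
  \<open>Z n = {1/n \<le> r \<le> n}\<close>. As \<open>r\<close> is integrable it is finite almost everywhere, and it is positive almost
  everywhere on the range of \<open>B\<close> because \<open>B\<close> preserves the measure class; so \<open>Z n\<close> exhausts the range.\<close>

lemma truncate_bisection:
  assumes B: "admissible_via_acts M B" and \<eta>: "0 < \<eta>"
  shows "\<exists>D Z. 0 < D \<and> Z \<in> sets M \<and> measure M (rng G ` B - Z) \<le> \<eta> \<and>
    bounded_distortion G M D (restrict_arrows G (space M) Z B)"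
proof -
  note f = admissible_facts[OF B]
  note t = forward_map_measurable[OF B]
  let ?N = "distr (density M (indicator (src G ` B))) M (forward_map G B)"
  have em: "emeasure ?N A = ennreal (measure M (source_act G B A))" if "A \<in> sets M" for A
    using emeasure_pushforward[OF f(4) t that] by (simp add: source_act_eq[OF f(2)])
  have "absolutely_continuous M ?N"
    unfolding absolutely_continuous_def
  proof
    fix A assume A: "A \<in> null_sets M"
    then have "source_act G B A \<in> null_sets M" by (rule f(9))
    then have "emeasure ?N A = 0" using em[of A] A by (simp add: emeasure_eq_measure[symmetric] null_setsD2 null_setsD1)
    then show "A \<in> null_sets ?N" using A by (simp add: null_sets_def)
  qed
  then obtain r where r [measurable]: "r \<in> borel_measurable M" and rN: "density M r = ?N"
    using Radon_Nikodym[of ?N] by auto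
  have Nr: "ennreal (measure M (source_act G B A)) = (\<integral>\<^sup>+x. r x * indicator A x \<partial>M)" if "A \<in> sets M" for A
    using em[OF that] emeasure_density[OF r that] by (simp only: rN)
  let ?R = "rng G ` B"
  define Z where "Z n = {y\<in>space M. r y \<le> of_nat n \<and> 1 \<le> of_nat n * r y}" for n :: nat
  have Z [measurable]: "Z n \<in> sets M" for n unfolding Z_def by measurable
  have lim: "(\<lambda>n. measure M (?R - Z n)) \<longlonglongrightarrow> measure M (\<Inter>n. ?R - Z n)"
  proof (rule finite_Lim_measure_decseq)
    show "range (\<lambda>n. ?R - Z n) \<subseteq> sets M" using f(5) by auto
    have "Z n \<subseteq> Z m" if "n \<le> m" for n m
    proof
      fix y assume y: "y \<in> Z n"
      have nm: "of_nat n \<le> (of_nat m :: ennreal)" using that by simp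
      have "1 \<le> of_nat n * r y" using y by (simp add: Z_def)
      also have "\<dots> \<le> of_nat m * r y" using nm by (intro mult_right_mono) auto
      finally show "y \<in> Z m" using y nm by (auto simp: Z_def intro: order_trans)
    qed
    then show "decseq (\<lambda>n. ?R - Z n)" unfolding decseq_def by blast
  qed
  have "measure M (\<Inter>n. ?R - Z n) = 0"
  proof -
    have "(\<integral>\<^sup>+x. r x \<partial>M) = (\<integral>\<^sup>+x. r x * indicator (space M) x \<partial>M)" by (intro nn_integral_cong) auto
    then have "(\<integral>\<^sup>+x. r x \<partial>M) \<noteq> \<infinity>" using Nr[OF sets.top] by (metis ennreal_neq_top infinity_ennreal_def)
    then have 1: "{y\<in>space M. r y = \<infinity>} \<in> null_sets M"
      using nn_integral_PInf_AE[OF r] by (simp add: AE_iff_null)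
    let ?W = "?R \<inter> {y\<in>space M. r y = 0}"
    have W: "?W \<in> sets M" using f(5) by simp
    have "ennreal (measure M (source_act G B ?W)) = (\<integral>\<^sup>+x. r x * indicator ?W x \<partial>M)" by (rule Nr[OF W])
    also have "\<dots> = (\<integral>\<^sup>+x. 0 \<partial>M)" by (intro nn_integral_cong) (auto simp: indicator_def)
    finally have "source_act G B ?W \<in> null_sets M" using f(7)[OF W] by (simp add: null_sets_def emeasure_eq_measure)
    then have "range_act G B (source_act G B ?W) \<in> null_sets M" by (rule f(8))
    then have 2: "?W \<in> null_sets M" using W by (rule null_sets_subset) (intro range_source, simp)
    have "(\<Inter>n. ?R - Z n) \<subseteq> {y\<in>space M. r y = \<infinity>} \<union> ?W"
    proof
      fix y assume y: "y \<in> (\<Inter>n. ?R - Z n)"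
      then have yR: "y \<in> ?R" "y \<in> space M" using sets.sets_into_space[OF f(5)] by auto
      have n: "y \<notin> Z n" for n using y by auto
      show "y \<in> {y\<in>space M. r y = \<infinity>} \<union> ?W"
      proof (rule ccontr)
        assume "\<not> ?thesis"
        then have "r y \<noteq> \<infinity>" "r y \<noteq> 0" using yR by auto
        then obtain s where s: "r y = ennreal s" "0 < s" by (cases "r y") (auto simp: less_le)
        obtain n where n': "max s (1 / s) \<le> real n" using real_arch_simple by blast
        then have "s \<le> real n" "1 \<le> real n * s" using s by (auto simp: field_simps)
        then have "y \<in> Z n" using s yR
          by (simp add: Z_def ennreal_of_nat_eq_real_of_nat ennreal_mult[symmetric] ennreal_leI)
        then show False using n by blast
      qed
    qed
    moreover have "{y\<in>space M. r y = \<infinity>} \<union> ?W \<in> null_sets M" using 1 2 by (rule null_sets.Un)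
    moreover have "(\<Inter>n. ?R - Z n) \<in> sets M" using f(5) by (intro sets.countable_INT) auto
    ultimately have "(\<Inter>n. ?R - Z n) \<in> null_sets M"
      by (meson null_sets_subset)
    then show ?thesis by (simp add: measure_eq_0_null_sets)
  qed
  then have "eventually (\<lambda>n. measure M (?R - Z n) < \<eta>) sequentially"
    using order_tendstoD(2)[OF lim, of \<eta>] \<eta> by simp
  then have "eventually (\<lambda>n. measure M (?R - Z n) < \<eta> \<and> 0 < n) sequentially"
    using eventually_gt_at_top[of 0] by eventually_elim simp
  from eventually_happens'[OF sequentially_bot this]
  obtain n where n: "measure M (?R - Z n) < \<eta>" "0 < n" by blast
  have "bounded_distortion G M (real n) (restrict_arrows G (space M) (Z n) B)"
    unfolding bounded_distortion_def range_act_restrict source_act_restrict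
  proof (intro ballI conjI)
    fix A assume A [measurable]: "A \<in> sets M"
    have sA: "source_act G B (A \<inter> Z n) \<in> sets M" using A by (intro f(7)) auto
    have "ennreal (measure M (source_act G B (A \<inter> Z n))) = (\<integral>\<^sup>+x. r x * indicator (A \<inter> Z n) x \<partial>M)"
      using A by (intro Nr) auto
    also have "\<dots> \<le> (\<integral>\<^sup>+x. of_nat n * indicator A x \<partial>M)"
      by (intro nn_integral_mono) (auto simp: indicator_def Z_def)
    also have "\<dots> = ennreal (real n * measure M A)"
      by (simp add: nn_integral_cmult emeasure_eq_measure ennreal_mult ennreal_of_nat_eq_real_of_nat)
    finally have "measure M (source_act G B (A \<inter> Z n)) \<le> real n * measure M A" by simp
    moreover have "measure M (space M \<inter> source_act G B (A \<inter> Z n)) \<le> measure M (source_act G B (A \<inter> Z n))"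
      using sA by (intro finite_measure_mono) auto
    ultimately show "measure M (space M \<inter> source_act G B (A \<inter> Z n)) \<le> real n * measure M A" by linarith
    let ?V = "Z n \<inter> range_act G B (A \<inter> space M)"
    have V [measurable]: "?V \<in> sets M" using A f(6) by auto
    have "ennreal (measure M ?V) = (\<integral>\<^sup>+x. indicator ?V x \<partial>M)"
      by (simp only: nn_integral_indicator[OF V] emeasure_eq_measure)
    also have "\<dots> \<le> (\<integral>\<^sup>+x. of_nat n * (r x * indicator ?V x) \<partial>M)"
      by (intro nn_integral_mono) (auto simp: indicator_def Z_def)
    also have "\<dots> = of_nat n * (\<integral>\<^sup>+x. r x * indicator ?V x \<partial>M)"
      by (rule nn_integral_cmult) measurable
    also have "\<dots> = of_nat n * ennreal (measure M (source_act G B ?V))" by (simp only: Nr[OF V])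
    also have "\<dots> \<le> of_nat n * ennreal (measure M A)"
      using source_range_subset[OF f(3), of ?V "A \<inter> space M"] A
      by (intro mult_left_mono ennreal_leI finite_measure_mono) auto
    finally show "measure M ?V \<le> real n * measure M A"
      by (simp add: ennreal_of_nat_eq_real_of_nat ennreal_mult[symmetric])
  qed
  then show ?thesis using n Z by (intro exI[of _ "real n"] exI[of _ "Z n"]) auto
qed

lemma bounded_distortion_restrict:
  assumes B: "admissible_via_acts M B" and d: "bounded_distortion G M D B" and X: "X \<in> sets M" and D: "0 \<le> D"
  shows "bounded_distortion G M D (restrict_arrows G X X B)"
  unfolding bounded_distortion_def range_act_restrict source_act_restrict
proof (intro ballI conjI)
  note f = admissible_facts[OF B]
  fix A assume A: "A \<in> sets M"
  have AX: "A \<inter> X \<in> sets M" using A X by auto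
  have le: "D * measure M (A \<inter> X) \<le> D * measure M A" using A D by (intro mult_left_mono finite_measure_mono) auto
  have "measure M (X \<inter> range_act G B (A \<inter> X)) \<le> measure M (range_act G B (A \<inter> X))"
    using f(6)[OF AX] by (intro finite_measure_mono) auto
  also have "\<dots> \<le> D * measure M (A \<inter> X)" using d AX by (simp add: bounded_distortion_def)
  finally show "measure M (X \<inter> range_act G B (A \<inter> X)) \<le> D * measure M A" using le by simp
  have "measure M (X \<inter> source_act G B (A \<inter> X)) \<le> measure M (source_act G B (A \<inter> X))"
    using f(7)[OF AX] by (intro finite_measure_mono) auto
  also have "\<dots> \<le> D * measure M (A \<inter> X)" using d AX by (simp add: bounded_distortion_def)
  finally show "measure M (X \<inter> source_act G B (A \<inter> X)) \<le> D * measure M A" using le by simp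
qed

lemma exists_bounded_graph:
  assumes I: "finite I" and b: "\<And>i. i \<in> I \<Longrightarrow> admissible_via_acts M (b i)"
    and d: "\<And>i. i \<in> I \<Longrightarrow> bounded_distortion G M D (b i)" and D: "0 < D"
  shows "\<exists>\<rho>. bounded_graph M I (\<lambda>i. src G ` b i) (\<lambda>i. forward_map G (b i)) (\<lambda>i. backward_map G (b i)) \<rho> D"
proof -
  have "\<exists>\<rho>. (i \<in> I \<longrightarrow> \<rho> \<in> borel_measurable M \<and> 
      distr (density M (indicator (src G ` b i))) M (forward_map G (b i)) = density M (\<lambda>x. ennreal (\<rho> x))) \<and>
      (\<forall>x. 0 \<le> \<rho> x) \<and> (\<forall>x. \<rho> x \<le> D)" for i
  proof (cases "i \<in> I")
    case True
    note f = admissible_facts[OF b[OF True]]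
    have "measure M {x \<in> src G ` b i. forward_map G (b i) x \<in> A} \<le> D * measure M A" if "A \<in> sets M" for A
      using d[OF True] that by (simp add: bounded_distortion_def source_act_eq[OF f(2)])
    from exists_bounded_density[OF f(4) forward_map_measurable[OF b[OF True]] this] D show ?thesis by auto
  next
    case False
    then show ?thesis using D by (intro exI[of _ "\<lambda>_. 0"]) auto
  qed
  then obtain \<rho> where \<rho>: "\<And>i. (i \<in> I \<longrightarrow> \<rho> i \<in> borel_measurable M \<and> 
      distr (density M (indicator (src G ` b i))) M (forward_map G (b i)) = density M (\<lambda>x. ennreal (\<rho> i x))) \<and>
      (\<forall>x. 0 \<le> \<rho> i x) \<and> (\<forall>x. \<rho> i x \<le> D)" by metis
  have "bounded_graph M I (\<lambda>i. src G ` b i) (\<lambda>i. forward_map G (b i)) (\<lambda>i. backward_map G (b i)) \<rho> D"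
  proof unfold_locales
    fix i x assume i: "i \<in> I" and x: "x \<in> src G ` b i"
    note f = admissible_facts[OF b[OF i]]
    show "backward_map G (b i) (forward_map G (b i) x) = x"
      using x by (auto simp: forward_map_src[OF f(2)] backward_map_rng[OF f(3)])
  qed (use I D \<rho> admissible_facts b in \<open>auto simp: forward_map_outside intro: forward_map_measurable backward_map_measurable\<close>)
  then show ?thesis by blast
qed

end

section \<open>Complex functions and local operators\<close>
text \<open>On a finite measure space, \<open>L\<^sup>2 \<subseteq> L\<^sup>1\<close>, as \<open>|z| \<le> 1 + |z|\<^sup>2\<close>.\<close>

lemma integrable_of_L2:
  assumes "finite_measure M" "f \<in> L2 M"
  shows "integrable M f"
proof (rule Bochner_Integration.integrable_bound)
  interpret finite_measure M by fact
  show "integrable M (\<lambda>x. 1 + (cmod (f x))\<^sup>2)" using assms(2) by (simp add: L2_def)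
  show "f \<in> borel_measurable M" using assms(2) by (simp add: L2_def)
  have "r \<le> 1 + r\<^sup>2" for r :: real
  proof -
    have "0 \<le> (r - 1)\<^sup>2 + r\<^sup>2 + 1" by simp
    then show ?thesis by (simp add: power2_eq_square algebra_simps)
  qed
  then show "AE x in M. norm (f x) \<le> norm (1 + (cmod (f x))\<^sup>2)"
    by (intro AE_I2) (simp add: order_trans[OF _ abs_ge_self])
qed

lemma L2_iff_square_integrable:
  "f \<in> L2 M \<longleftrightarrow> square_integrable M (\<lambda>x. Re (f x)) \<and> square_integrable M (\<lambda>x. Im (f x))"
proof
  assume f: "f \<in> L2 M"
  then have [measurable]: "f \<in> borel_measurable M" by (simp add: L2_def)
  have sq: "square_integrable M (\<lambda>x. cmod (f x))" using f by (simp add: L2_def square_integrable_def)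
  show "square_integrable M (\<lambda>x. Re (f x)) \<and> square_integrable M (\<lambda>x. Im (f x))"
    by (intro conjI square_integrable_bound[OF sq]) (auto simp: abs_Re_le_cmod abs_Im_le_cmod)
next
  assume "square_integrable M (\<lambda>x. Re (f x)) \<and> square_integrable M (\<lambda>x. Im (f x))"
  then show "f \<in> L2 M"
    by (simp add: L2_def square_integrable_def cmod_power2 borel_measurable_complex_iff)
qed

lemma integral_cmod_power2:
  assumes "f \<in> L2 M"
  shows "(\<integral>x. (cmod (f x))\<^sup>2 \<partial>M) = (\<integral>x. (Re (f x))\<^sup>2 \<partial>M) + (\<integral>x. (Im (f x))\<^sup>2 \<partial>M)"
  using assms unfolding L2_iff_square_integrable by (simp add: cmod_power2 square_integrable_def)

context bounded_graph
begin

lemma heat_step_Re: "Re (heat_step f x) = heat_step (\<lambda>y. Re (f y)) x"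
  and heat_step_Im: "Im (heat_step f x) = heat_step (\<lambda>y. Im (f y)) x"
  by (simp_all add: heat_step_def laplacian_def)

lemma heat_step_iterate_Re: "Re ((heat_step ^^ n) f x) = (heat_step ^^ n) (\<lambda>y. Re (f y)) x"
  and heat_step_iterate_Im: "Im ((heat_step ^^ n) f x) = (heat_step ^^ n) (\<lambda>y. Im (f y)) x"
proof -
  have "(\<lambda>x. Re ((heat_step ^^ n) f x)) = (heat_step ^^ n) (\<lambda>y. Re (f y))"
    by (induction n) (simp_all add: heat_step_Re)
  then show "Re ((heat_step ^^ n) f x) = (heat_step ^^ n) (\<lambda>y. Re (f y)) x" by (rule fun_cong)
  have "(\<lambda>x. Im ((heat_step ^^ n) f x)) = (heat_step ^^ n) (\<lambda>y. Im (f y))"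
    by (induction n) (simp_all add: heat_step_Im)
  then show "Im ((heat_step ^^ n) f x) = (heat_step ^^ n) (\<lambda>y. Im (f y)) x" by (rule fun_cong)
qed

lemma heat_step_mult: "heat_step (\<lambda>x. a * f x) = (\<lambda>x. a * heat_step f x)" for a :: complex
  by (simp add: fun_eq_iff heat_step_def laplacian_def right_diff_distrib sum_distrib_left scaleR_diff_right)

lemma heat_step_iterate_mult: "(heat_step ^^ n) (\<lambda>x. a * f x) = (\<lambda>x. a * (heat_step ^^ n) f x)" for a :: complex
  by (induction n) (auto simp: heat_step_mult)

lemma heat_step_eq_0:
  assumes "f x = 0" "\<And>i. i \<in> I \<Longrightarrow> f (t i x) = 0" "\<And>i. i \<in> I \<Longrightarrow> f (u i x) = 0"
  shows "heat_step f x = 0"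
  using assms by (simp add: heat_step_def laplacian_def)

end

context expanding_graph
begin

lemma approx_mean_add: "approx_mean n (\<lambda>x. f x + g x) = (\<lambda>x. approx_mean n f x + approx_mean n g x)"
  unfolding approx_mean_def scaleR_add_right heat_step_iterate_add ..

lemma approx_mean_mult: "approx_mean n (\<lambda>x. a * f x) = (\<lambda>x. a * approx_mean n f x)" for a :: complex
  using heat_step_iterate_mult[of n a "\<lambda>x. indicator Y x *\<^sub>R f x"]
  by (simp add: approx_mean_def fun_eq_iff)

lemma approx_mean_Re: "Re (approx_mean n f x) = approx_mean n (\<lambda>y. Re (f y)) x"
  and approx_mean_Im: "Im (approx_mean n f x) = approx_mean n (\<lambda>y. Im (f y)) x"
  by (simp_all add: approx_mean_def heat_step_iterate_Re heat_step_iterate_Im)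

lemma approx_mean_L2:
  assumes f: "f \<in> L2 M" and prob: "measure M (space M) = 1" and pos: "0 < measure M Y"
  shows "approx_mean n f \<in> L2 M"
    and "(\<integral>x. (cmod (approx_mean n f x - (\<integral>y. f y \<partial>M)))\<^sup>2 \<partial>M)
      \<le> (2 * rate ^ n + 4 * (1 - measure M Y)) * (\<integral>x. (cmod (f x))\<^sup>2 \<partial>M)"
proof -
  have sq: "square_integrable M (\<lambda>x. Re (f x))" "square_integrable M (\<lambda>x. Im (f x))"
    using f by (simp_all add: L2_iff_square_integrable)
  note e = approx_mean_error[OF sq(1) prob pos, of n] approx_mean_error[OF sq(2) prob pos, of n]
  show L: "approx_mean n f \<in> L2 M"
    unfolding L2_iff_square_integrable approx_mean_Re approx_mean_Im using e by simp
  have c: "Re (\<integral>y. f y \<partial>M) = (\<integral>y. Re (f y) \<partial>M)" "Im (\<integral>y. f y \<partial>M) = (\<integral>y. Im (f y) \<partial>M)"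
    using integrable_of_L2[OF finite_measure_axioms f] by simp_all
  have d: "(\<lambda>x. approx_mean n f x - (\<integral>y. f y \<partial>M)) \<in> L2 M"
    unfolding L2_iff_square_integrable using e
    by (simp add: approx_mean_Re approx_mean_Im square_integrable_diff square_integrable_const)
  show "(\<integral>x. (cmod (approx_mean n f x - (\<integral>y. f y \<partial>M)))\<^sup>2 \<partial>M)
      \<le> (2 * rate ^ n + 4 * (1 - measure M Y)) * (\<integral>x. (cmod (f x))\<^sup>2 \<partial>M)"
    unfolding integral_cmod_power2[OF d] integral_cmod_power2[OF f] distrib_left
    using e(2,4) by (simp only: minus_complex.sel approx_mean_Re approx_mean_Im c add_mono)
qed

end

text \<open>The value of \<open>T (T' f)\<close> at \<open>x\<close> depends on \<open>f\<close> at the ends of paths that follow an arrow of \<open>W\<close> and then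
  one of \<open>W'\<close>; since arrows compose from right to left, the factors of the product are reversed.\<close>

lemma (in length_groupoid) local_operator_compose:
  assumes T: "local_operator G W T" and T': "local_operator G W' T'" and W: "W \<subseteq> arrows G" "W' \<subseteq> arrows G"
  shows "local_operator G (product_set W' W) (\<lambda>f. T (T' f))"
  unfolding local_operator_def
proof (intro allI ballI impI)
  fix f :: "'g \<Rightarrow> complex" and x
  assume x: "x \<in> units G" and v: "\<forall>c\<in>product_set W' W. src G c = x \<longrightarrow> f (rng G c) = 0"
  have "T' f (rng G a) = 0" if a: "a \<in> W" "src G a = x" for a
  proof -
    have "f (rng G b) = 0" if b: "b \<in> W'" "src G b = rng G a" for b
    proof -
      have "gmult G b a \<in> product_set W' W" using a b by (auto simp: product_set_def)
      moreover have "src G (gmult G b a) = x" "rng G (gmult G b a) = rng G b"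
        using a b W by (auto simp: src_mult rng_mult subset_eq)
      ultimately show ?thesis using v by force
    qed
    moreover have "rng G a \<in> units G" using a W rng_in_units by blast
    ultimately show ?thesis using T' unfolding local_operator_def by blast
  qed
  then show "T (T' f) x = 0" using T x unfolding local_operator_def by blast
qed

lemma (in length_groupoid) local_operator_iterate:
  assumes T: "local_operator G W T" and W: "controlled M W" and sp: "space M = units G"
  shows "\<exists>W'. controlled M W' \<and> local_operator G W' (T ^^ n)"
proof (induction n)
  case 0
  have "local_operator G (units G) (\<lambda>f. f)" unfolding local_operator_def by (auto simp: src_unit rng_unit)
  then show ?case using controlled_admissible[OF admissible_units[OF sp]] by (auto simp: id_def)
next
  case (Suc n)
  then obtain W' where W': "controlled M W'" "local_operator G W' (T ^^ n)" by blast
  have "local_operator G (product_set W' W) (\<lambda>f. T ((T ^^ n) f))"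
    by (intro local_operator_compose T W' controlled_subset[OF W] controlled_subset[OF W'(1)])
  then show ?case using controlled_product[OF W'(1) W] by (auto simp: o_def)
qed

context measured_groupoid
begin

lemma distortion_preimage:
  assumes B: "admissible_via_acts M B" and d: "bounded_distortion G M D B" and A: "A \<in> sets M"
  shows "measure M (forward_map G B -` A \<inter> space M) \<le> (D + 1) * measure M A"
proof -
  note f = admissible_facts[OF B]
  have "forward_map G B -` A \<inter> space M \<subseteq> source_act G B A \<union> A"
    by (auto simp: source_act_eq[OF f(2)]) (metis forward_map_outside)
  then have "measure M (forward_map G B -` A \<inter> space M) \<le> measure M (source_act G B A \<union> A)"
    using f(7)[OF A] A by (intro finite_measure_mono) auto
  also have "\<dots> \<le> measure M (source_act G B A) + measure M A"
    using f(7)[OF A] A by (intro measure_Un_le)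
  also have "\<dots> \<le> D * measure M A + measure M A" using d A by (simp add: bounded_distortion_def)
  finally show ?thesis by (simp add: algebra_simps)
qed

text \<open>Each point of \<open>r(B \<cdot> A) - A\<close> is the end of an edge from \<open>A\<close> to its complement; the lower bound on the
  Radon--Nikodym derivative compares the set of end points with the set of starting points.\<close>

lemma distortion_boundary:
  assumes B: "admissible_via_acts M B" and d: "bounded_distortion G M D B" and A: "A \<in> sets M" and D: "0 \<le> D"
  shows "measure M (range_act G B A - A) \<le> D * measure M {x\<in>space M. (forward_map G B x \<in> A) \<noteq> (x \<in> A)}"
proof -
  note f = admissible_facts[OF B]
  note [measurable] = forward_map_measurable[OF B] A
  let ?V = "range_act G B A - A"
  have V: "?V \<in> sets M" using f(6)[OF A] A by auto
  have sV: "source_act G B ?V \<in> sets M" by (rule f(7)[OF V])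
  have "?V \<subseteq> rng G ` B" by (auto simp: range_act_def)
  then have "measure M ?V \<le> measure M (range_act G B (source_act G B ?V))"
    using f(6)[OF sV] by (intro finite_measure_mono range_source)
  also have "\<dots> \<le> D * measure M (source_act G B ?V)" using d sV by (simp add: bounded_distortion_def)
  also have "source_act G B ?V \<subseteq> {x\<in>space M. (forward_map G B x \<in> A) \<noteq> (x \<in> A)}"
  proof
    fix x assume x: "x \<in> source_act G B ?V"
    have "x \<in> A" using x source_range_subset[OF f(3), of ?V A] by blast
    moreover have "forward_map G B x \<notin> A" using x by (auto simp: source_act_eq[OF f(2)])
    moreover have "x \<in> space M" using sets.sets_into_space[OF sV] x by blast
    ultimately show "x \<in> {x\<in>space M. (forward_map G B x \<in> A) \<noteq> (x \<in> A)}" by simp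
  qed
  then have "D * measure M (source_act G B ?V) \<le> D * measure M {x\<in>space M. (forward_map G B x \<in> A) \<noteq> (x \<in> A)}"
    using D by (intro mult_left_mono finite_measure_mono) auto
  finally show ?thesis .
qed

text \<open>Truncation loses at most \<open>\<eta>\<close> of the range of each bisection, in total at most half of the expansion
  \<open>C \<alpha>\<close> that is guaranteed for sets of measure at least \<open>\<alpha>\<close>. Sets of measure above \<open>1/2\<close> are handled through
  their complements, which have the same edge boundary.\<close>

lemma expanding_imp_distortion_bounded_family:
  assumes exp: "asymptotically_expanding G l M" and prob: "measure M (space M) = 1"
    and \<alpha>: "0 < \<alpha>" "\<alpha> \<le> 1 / 2"
  shows "\<exists>I (b :: 'g set \<Rightarrow> 'g set) D \<delta>. finite I \<and> (\<forall>i\<in>I. admissible_via_acts M (b i) \<and> bounded_distortion G M D (b i)) \<and>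
    0 < D \<and> 0 < \<delta> \<and>
    (\<forall>A\<in>sets M. \<alpha> \<le> measure M A \<longrightarrow> measure M A \<le> 1 - \<alpha> \<longrightarrow> \<delta> \<le> edge_boundary M I (\<lambda>i. forward_map G (b i)) A)"
proof -
  obtain C N K where C: "0 < C" and K: "N_decomposable G l M N K"
    and KA: "\<And>A. A \<in> sets M \<Longrightarrow> \<alpha> \<le> measure M A \<Longrightarrow> measure M A \<le> 1 / 2 \<Longrightarrow> C * measure M A < measure M (range_act G K A - A)"
  proof -
    have "\<exists>(C::real) (N::nat) (L::real) K. C > 0 \<and> N > 0 \<and> L > 0 \<and> N_decomposable G l M N K \<and>
           set_length l K \<le> ennreal L \<and>
           (\<forall>A\<in>sets M. \<alpha> \<le> measure M A \<and> measure M A \<le> 1/2 \<longrightarrow>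
              measure M (range_act G K A - A) > C * measure M A)"
      using exp \<alpha> unfolding asymptotically_expanding_def by blast
    then show thesis using that by blast
  qed
  obtain I where I: "finite I" "\<And>B. B \<in> I \<Longrightarrow> admissible_via_acts M B" "K = \<Union>I"
    using N_decomposable_controlled[OF space_M K] unfolding controlled_def by blast
  define \<eta> where "\<eta> = C * \<alpha> / (2 * (real (card I) + 1))"
  have \<eta>: "0 < \<eta>" using C \<alpha> by (simp add: \<eta>_def add_nonneg_pos)
  have \<eta>2: "real (card I) * \<eta> \<le> C * \<alpha> / 2" using C \<alpha> by (simp add: \<eta>_def field_simps)
  obtain D0 Z where Z: "\<And>B. B \<in> I \<Longrightarrow> 0 < D0 B \<and> Z B \<in> sets M \<and> measure M (rng G ` B - Z B) \<le> \<eta> \<and>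
      bounded_distortion G M (D0 B) (restrict_arrows G (space M) (Z B) B)"
    using truncate_bisection[OF I(2) \<eta>] by metis
  define b where "b B = restrict_arrows G (space M) (Z B) B" for B
  define D where "D = (\<Sum>B\<in>I. D0 B) + 1"
  have D: "0 < D" unfolding D_def by (intro add_nonneg_pos sum_nonneg) (simp_all add: Z less_imp_le)
  have b: "admissible_via_acts M (b B)" "bounded_distortion G M D (b B)" if "B \<in> I" for B
  proof -
    show "admissible_via_acts M (b B)" unfolding b_def
      by (rule admissible_restrict[OF I(2)[OF that]]) (simp_all add: Z[OF that])
    have "0 \<le> D0 B'" if "B' \<in> I" for B' using Z[OF that] by simp
    then have "D0 B \<le> (\<Sum>B\<in>I. D0 B)" using that I(1) by (intro member_le_sum) auto
    then have le: "D0 B \<le> D" by (simp add: D_def)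
    have "bounded_distortion G M (D0 B) (b B)" using Z[OF that] by (simp add: b_def)
    then show "bounded_distortion G M D (b B)" using le by (rule bounded_distortion_mono)
  qed
  define \<delta> where "\<delta> = C * \<alpha> / (2 * D)"
  have \<delta>: "0 < \<delta>" using C \<alpha> D by (simp add: \<delta>_def)
  let ?E = "\<lambda>B A. {x\<in>space M. (forward_map G (b B) x \<in> A) \<noteq> (x \<in> A)}"
  let ?bd = "edge_boundary M I (\<lambda>i. forward_map G (b i))"
  have small: "\<delta> \<le> ?bd A" if A: "A \<in> sets M" "\<alpha> \<le> measure M A" "measure M A \<le> 1 / 2" for A
  proof -
    have r: "range_act G B A' \<in> sets M" "range_act G (b B) A' \<in> sets M" "rng G ` B - Z B \<in> sets M"
      if "B \<in> I" "A' \<in> sets M" for B A'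
      using admissible_facts[OF I(2)[OF that(1)]] admissible_facts[OF b(1)[OF that(1)]] Z[OF that(1)] that(2) by auto
    have "C * \<alpha> \<le> C * measure M A" using A C by (intro mult_left_mono) auto
    also have "\<dots> \<le> measure M (range_act G K A - A)" using KA[OF A] by simp
    also have "\<dots> \<le> measure M (\<Union>B\<in>I. (range_act G (b B) A - A) \<union> (rng G ` B - Z B))"
    proof (rule finite_measure_mono)
      show "range_act G K A - A \<subseteq> (\<Union>B\<in>I. (range_act G (b B) A - A) \<union> (rng G ` B - Z B))"
      proof
        fix y assume "y \<in> range_act G K A - A"
        then obtain B where B: "B \<in> I" "y \<in> range_act G B A" "y \<notin> A" unfolding I(3) range_act_Union by blast
        have "range_act G (b B) A = Z B \<inter> range_act G B A"
          using sets.sets_into_space[OF A(1)] by (simp add: b_def range_act_restrict Int_absorb2)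
        moreover have "y \<in> rng G ` B" using B(2) by (auto simp: range_act_def)
        ultimately show "y \<in> (\<Union>B\<in>I. (range_act G (b B) A - A) \<union> (rng G ` B - Z B))" using B by blast
      qed
      show "(\<Union>B\<in>I. (range_act G (b B) A - A) \<union> (rng G ` B - Z B)) \<in> sets M"
        by (intro sets.finite_UN sets.Un sets.Diff[OF r(2)] r(3)[OF _ A(1)] A(1) I(1))
    qed
    also have "\<dots> \<le> (\<Sum>B\<in>I. measure M ((range_act G (b B) A - A) \<union> (rng G ` B - Z B)))"
      by (intro measure_UNION_le sets.Un sets.Diff[OF r(2)] r(3)[OF _ A(1)] A(1) I(1))
    also have "\<dots> \<le> (\<Sum>B\<in>I. D * measure M (?E B A) + \<eta>)"
    proof (rule sum_mono)
      fix B assume B: "B \<in> I"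
      have "measure M ((range_act G (b B) A - A) \<union> (rng G ` B - Z B)) \<le> measure M (range_act G (b B) A - A) + measure M (rng G ` B - Z B)"
        using r[OF B A(1)] A(1) by (intro measure_Un_le) auto
      also have "\<dots> \<le> D * measure M (?E B A) + \<eta>"
        using distortion_boundary[OF b[OF B] A(1)] D Z[OF B] by (intro add_mono) auto
      finally show "measure M ((range_act G (b B) A - A) \<union> (rng G ` B - Z B)) \<le> 
        D * measure M (?E B A) + \<eta>" .
    qed
    also have "\<dots> = D * ?bd A + real (card I) * \<eta>"
      by (simp add: sum.distrib edge_boundary_def sum_distrib_left)
    finally have "C * \<alpha> / 2 \<le> D * ?bd A" using \<eta>2 by simp
    then show ?thesis using D by (simp add: \<delta>_def field_simps)
  qed
  have "\<delta> \<le> ?bd A" if A: "A \<in> sets M" "\<alpha> \<le> measure M A" "measure M A \<le> 1 - \<alpha>" for A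
  proof (cases "measure M A \<le> 1 / 2")
    case True then show ?thesis using small A by blast
  next
    case False
    have m: "measure M (space M - A) = 1 - measure M A" using prob finite_measure_compl[OF A(1)] by simp
    have "?bd (space M - A) = ?bd A"
      unfolding edge_boundary_def
    proof (rule sum.cong)
      fix B assume B: "B \<in> I"
      have "forward_map G (b B) x \<in> space M" if "x \<in> space M" for x
        using forward_map_measurable[OF b(1)[OF B]] that by (rule measurable_space)
      then have "(?E B (space M - A))
        = (?E B A)" by auto
      then show "measure M (?E B (space M - A))
        = measure M (?E B A)" by simp
    qed simp
    moreover have "\<delta> \<le> ?bd (space M - A)" using False A m by (intro small) auto
    ultimately show ?thesis by simp
  qed
  then show ?thesis using I(1) b D \<delta> by (intro exI[of _ I] exI[of _ b] exI[of _ D] exI[of _ \<delta>]) auto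
qed

end

section \<open>Local approximation of the mean\<close>
context measured_groupoid
begin

text \<open>The bisections of bounded distortion, restricted to an expanding domain \<open>Y\<close>, form an expanding graph.
  An iterated heat step is local with respect to a product of copies of the set of edges, their inverses
  and the units.\<close>

theorem expanding_imp_local_approximation:
  assumes exp: "asymptotically_expanding G l M" and prob: "measure M (space M) = 1" and \<epsilon>: "0 < \<epsilon>"
  shows "\<exists>W (T :: 'g operator). controlled M W \<and> local_operator G W T \<and>
    (\<forall>f g. T (\<lambda>x. f x + g x) = (\<lambda>x. T f x + T g x)) \<and> (\<forall>a f. T (\<lambda>x. a * f x) = (\<lambda>x. a * T f x)) \<and>
    (\<forall>f\<in>L2 M. T f \<in> L2 M \<and>
      (\<integral>x. (cmod (T f x - (\<integral>y. f y \<partial>M)))\<^sup>2 \<partial>M) \<le> \<epsilon> * (\<integral>x. (cmod (f x))\<^sup>2 \<partial>M))"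
proof -
  \<comment> \<open>The error is \<open>2 q\<^sup>n + 4 (1 - \<nu>(Y))\<close>, where \<open>q\<close> is the contraction rate and \<open>1 - \<nu>(Y) \<le> \<alpha>\<close>; each part is kept below \<open>\<epsilon>/2\<close>.\<close>
  define \<alpha> where "\<alpha> = min (1 / 3) (\<epsilon> / 8)"
  have \<alpha>: "0 < \<alpha>" "\<alpha> \<le> 1 / 3" "\<alpha> \<le> 1 / 2" "8 * \<alpha> \<le> \<epsilon>" using \<epsilon> by (auto simp: \<alpha>_def)
  obtain I :: "'g set set" and b D \<delta> where I: "finite I" and D: "0 < D" and \<delta>: "0 < \<delta>"
    and b: "\<And>i. i \<in> I \<Longrightarrow> admissible_via_acts M (b i)" "\<And>i. i \<in> I \<Longrightarrow> bounded_distortion G M D (b i)"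
    and exp': "\<And>A. A \<in> sets M \<Longrightarrow> \<alpha> \<le> measure M A \<Longrightarrow> measure M A \<le> 1 - \<alpha> \<Longrightarrow> 
      \<delta> \<le> edge_boundary M I (\<lambda>i. forward_map G (b i)) A"
    using expanding_imp_distortion_bounded_family[OF exp prob \<alpha>(1,3)] by blast
  obtain Y where Y: "Y \<in> sets M" "1 - \<alpha> \<le> measure M Y"
    and Yexp: "\<And>A. A \<in> sets M \<Longrightarrow> A \<subseteq> Y \<Longrightarrow> measure M A \<le> measure M Y / 2 \<Longrightarrow>
       \<delta> / 2 * measure M A \<le> (\<Sum>i\<in>I. measure M {x\<in>Y. forward_map G (b i) x \<in> Y \<and> (forward_map G (b i) x \<in> A) \<noteq> (x \<in> A)})"
    using exists_expanding_domain[OF I forward_map_measurable[OF b(1)] prob distortion_preimage[OF b] \<alpha>(1,2) \<delta> exp'] by blast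
  define c where "c i = restrict_arrows G Y Y (b i)" for i
  have c: "admissible_via_acts M (c i)" "bounded_distortion G M D (c i)" if "i \<in> I" for i
  proof -
    show "admissible_via_acts M (c i)" unfolding c_def
      by (rule admissible_restrict[OF b(1)[OF that]]) (simp_all add: Y)
    show "bounded_distortion G M D (c i)" unfolding c_def
      using D by (intro bounded_distortion_restrict b that Y) simp
  qed
  let ?t = "\<lambda>i. forward_map G (c i)" and ?u = "\<lambda>i. backward_map G (c i)"
  obtain \<rho> where "bounded_graph M I (\<lambda>i. src G ` c i) ?t ?u \<rho> D"
    using exists_bounded_graph[of I c D] I c D by blast
  then interpret bg: bounded_graph M I "\<lambda>i. src G ` c i" ?t ?u \<rho> D .
  have cY: "src G a \<in> Y" "rng G a \<in> Y" if "a \<in> c i" for a i using that by (auto simp: c_def restrict_arrows_def)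
  interpret eg: expanding_graph M I "\<lambda>i. src G ` c i" ?t ?u \<rho> D Y "\<delta> / 2"
  proof unfold_locales
    show "Y \<in> sets M" "0 < \<delta> / 2" using Y \<delta> by auto
    fix i x assume i: "i \<in> I"
    note f = admissible_facts[OF c(1)[OF i]]
    show "?t i x \<in> Y" if "x \<in> Y"
    proof (cases "x \<in> src G ` c i")
      case True then show ?thesis by (auto simp: forward_map_src[OF f(2)] cY)
    qed (use that in \<open>simp add: forward_map_outside\<close>)
    show "?u i x \<in> Y" if "x \<in> Y"
    proof (cases "x \<in> rng G ` c i")
      case True then show ?thesis by (auto simp: backward_map_rng[OF f(3)] cY)
    qed (use that in \<open>simp add: backward_map_outside\<close>)
    show "?t i x = x" "?u i x = x" if "x \<notin> Y" 
      using that cY by (auto intro!: forward_map_outside backward_map_outside)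
  next
    fix A assume A: "A \<in> sets M" "A \<subseteq> Y" "measure M A \<le> measure M Y / 2"
    have "\<delta> / 2 * measure M A \<le> (\<Sum>i\<in>I. measure M {x\<in>Y. forward_map G (b i) x \<in> Y \<and> (forward_map G (b i) x \<in> A) \<noteq> (x \<in> A)})"
      by (rule Yexp[OF A])
    also have "\<dots> \<le> edge_boundary M I ?t A"
      unfolding edge_boundary_def
    proof (intro sum_mono finite_measure_mono)
      fix i assume i: "i \<in> I"
      note f = admissible_facts[OF c(1)[OF i]] and fb = admissible_facts[OF b(1)[OF i]]
      note [measurable] = forward_map_measurable[OF c(1)[OF i]] A(1)
      show "{x\<in>space M. (?t i x \<in> A) \<noteq> (x \<in> A)} \<in> sets M" by measurable
      show "{x\<in>Y. forward_map G (b i) x \<in> Y \<and> (forward_map G (b i) x \<in> A) \<noteq> (x \<in> A)} \<subseteq> {x\<in>space M. (?t i x \<in> A) \<noteq> (x \<in> A)}"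
      proof
        fix x assume x: "x \<in> {x\<in>Y. forward_map G (b i) x \<in> Y \<and> (forward_map G (b i) x \<in> A) \<noteq> (x \<in> A)}"
        then have "x \<in> src G ` b i" using forward_map_outside by force
        then obtain a where a: "a \<in> b i" "x = src G a" by blast
        have "forward_map G (b i) x = rng G a" using a forward_map_src[OF fb(2)] by simp
        then have "a \<in> c i" using a x by (simp add: c_def restrict_arrows_def)
        then have "?t i x = forward_map G (b i) x" using a forward_map_src[OF f(2)] forward_map_src[OF fb(2)] by simp
        then show "x \<in> {x\<in>space M. (?t i x \<in> A) \<noteq> (x \<in> A)}" using x sets.sets_into_space[OF Y(1)] by auto
      qed
    qed
    finally show "\<delta> / 2 * measure M A \<le> edge_boundary M I ?t A" .
  qed
  obtain n where n: "eg.rate ^ n < \<epsilon> / 4" using real_arch_pow_inv[of "\<epsilon> / 4" eg.rate] \<epsilon> eg.rate_bounds by auto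
  have pos: "0 < measure M Y" using Y \<alpha> by simp
  define W where "W = units G \<union> (\<Union>i\<in>I. c i \<union> ginv G ` c i)"
  have W: "controlled M W" unfolding W_def
    by (intro controlled_Un controlled_UN I controlled_admissible admissible_units space_M c admissible_ginv)
  have heat_step_local: "local_operator G W (bg.heat_step :: 'g operator)"
    unfolding local_operator_def
  proof (intro allI ballI impI)
    fix f :: "'g \<Rightarrow> complex" and x assume x: "x \<in> units G" and v: "\<forall>a\<in>W. src G a = x \<longrightarrow> f (rng G a) = 0"
    have "x \<in> W" using x by (simp add: W_def)
    then have fx: "f x = 0" using bspec[OF v, of x] src_unit[OF x] rng_unit[OF x] by simp
    show "bg.heat_step f x = 0"
    proof (rule bg.heat_step_eq_0)
      fix i assume i: "i \<in> I"
      note f = admissible_facts[OF c(1)[OF i]]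
      show "f (?t i x) = 0"
      proof (cases "x \<in> src G ` c i")
        case True
        then obtain a where a: "a \<in> c i" "x = src G a" by blast
        moreover have "a \<in> W" using a i by (auto simp: W_def)
        ultimately show ?thesis using v by (simp add: forward_map_src[OF f(2)])
      qed (simp add: forward_map_outside fx)
      show "f (?u i x) = 0"
      proof (cases "x \<in> rng G ` c i")
        case True
        then obtain a where a: "a \<in> c i" "x = rng G a" by blast
        then have "ginv G a \<in> W" "a \<in> arrows G" using i f(1) by (auto simp: W_def)
        then show ?thesis using v a by (auto simp: backward_map_rng[OF f(3)] src_inv rng_inv)
      qed (simp add: backward_map_outside fx)
    qed (rule fx)
  qed
  obtain W' where W': "controlled M W'" "local_operator G W' ((bg.heat_step :: 'g operator) ^^ n)"
    using local_operator_iterate[OF heat_step_local W space_M] by blast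
  have "local_operator G W' (eg.approx_mean n :: 'g operator)"
    using W'(2) unfolding local_operator_def eg.approx_mean_def by fastforce
  moreover have "(\<integral>x. (cmod (eg.approx_mean n f x - (\<integral>y. f y \<partial>M)))\<^sup>2 \<partial>M) \<le> \<epsilon> * (\<integral>x. (cmod (f x))\<^sup>2 \<partial>M)"
    if "f \<in> L2 M" for f :: "'g \<Rightarrow> complex"
  proof -
    have "(\<integral>x. (cmod (eg.approx_mean n f x - (\<integral>y. f y \<partial>M)))\<^sup>2 \<partial>M)
      \<le> (2 * eg.rate ^ n + 4 * (1 - measure M Y)) * (\<integral>x. (cmod (f x))\<^sup>2 \<partial>M)"
      by (rule eg.approx_mean_L2[OF that prob pos])
    also have "\<dots> \<le> \<epsilon> * (\<integral>x. (cmod (f x))\<^sup>2 \<partial>M)"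
      using n Y(2) \<alpha>(4) by (intro mult_right_mono) auto
    finally show ?thesis .
  qed
  ultimately show ?thesis
    using W'(1) eg.approx_mean_L2(1)[OF _ prob pos] eg.approx_mean_add eg.approx_mean_mult
    by (intro exI[of _ W'] exI[of _ "eg.approx_mean n"]) blast
qed

end

section \<open>The space of square-integrable functions and operator norms\<close>

lemma L2_measurable: "f \<in> L2 M \<Longrightarrow> f \<in> borel_measurable M"
  and L2_integrable: "f \<in> L2 M \<Longrightarrow> integrable M (\<lambda>x. (cmod (f x))\<^sup>2)"
  by (simp_all add: L2_def)

lemma L2_add: "f \<in> L2 M \<Longrightarrow> g \<in> L2 M \<Longrightarrow> (\<lambda>x. f x + g x) \<in> L2 M"
  by (simp add: L2_iff_square_integrable square_integrable_add)

lemma L2_bound: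
  assumes "g \<in> L2 M" "f \<in> borel_measurable M" "\<And>x. cmod (f x) \<le> C * cmod (g x)"
  shows "f \<in> L2 M"
proof -
  have "square_integrable M (\<lambda>x. C * cmod (g x))"
    using assms(1) by (intro square_integrable_scale) (auto simp: L2_def square_integrable_def)
  from square_integrable_bound[OF this, of "\<lambda>x. cmod (f x)"] assms(2,3)
  show ?thesis by (simp add: L2_def square_integrable_def order_trans[OF _ abs_ge_self])
qed

lemma L2_mult: "f \<in> L2 M \<Longrightarrow> (\<lambda>x. a * f x) \<in> L2 M"
  by (rule L2_bound[where C = "cmod a"]) (auto simp: norm_mult dest: L2_measurable)

lemma L2_diff: "f \<in> L2 M \<Longrightarrow> g \<in> L2 M \<Longrightarrow> (\<lambda>x. f x - g x) \<in> L2 M"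
  using L2_add[OF _ L2_mult[of g M "-1"]] by simp

lemma L2_char_mult: "f \<in> L2 M \<Longrightarrow> A \<in> sets M \<Longrightarrow> char_mult A f \<in> L2 M"
  unfolding char_mult_def by (rule L2_bound[where C = 1]) (auto simp: indicator_def dest: L2_measurable)

lemma L2_norm_nonneg: "0 \<le> L2_norm M f"
  by (simp add: L2_norm_def)

lemma L2_norm_power2: "(L2_norm M f)\<^sup>2 = (\<integral>x. (cmod (f x))\<^sup>2 \<partial>M)"
  by (simp add: L2_norm_def)

lemma L2_norm_mono:
  assumes "f \<in> L2 M" "g \<in> L2 M" "AE x in M. cmod (f x) \<le> cmod (g x)"
  shows "L2_norm M f \<le> L2_norm M g"
proof -
  have "(\<integral>x. (cmod (f x))\<^sup>2 \<partial>M) \<le> (\<integral>x. (cmod (g x))\<^sup>2 \<partial>M)"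
    using assms by (intro integral_mono_AE) (auto simp: L2_def power_mono)
  then show ?thesis by (simp add: L2_norm_def)
qed

lemma L2_norm_cong:
  assumes "f \<in> L2 M" "g \<in> L2 M" "L2_eq M f g"
  shows "L2_norm M f = L2_norm M g"
  using assms by (intro antisym L2_norm_mono) (auto simp: L2_eq_def)

lemma L2_norm_char_mult: "f \<in> L2 M \<Longrightarrow> A \<in> sets M \<Longrightarrow> L2_norm M (char_mult A f) \<le> L2_norm M f"
  by (rule L2_norm_mono[OF L2_char_mult]) (auto simp: char_mult_def indicator_def)

lemma L2_norm_diff_le:
  assumes "f \<in> L2 M" "g \<in> L2 M"
  shows "(L2_norm M (\<lambda>x. f x - g x))\<^sup>2 \<le> 2 * (L2_norm M f)\<^sup>2 + 2 * (L2_norm M g)\<^sup>2"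
  using square_integral_diff_le[of M "\<lambda>x. Re (f x)" "\<lambda>x. Re (g x)"] square_integral_diff_le[of M "\<lambda>x. Im (f x)" "\<lambda>x. Im (g x)"]
    assms L2_diff[OF assms]
  by (simp add: L2_norm_power2 integral_cmod_power2) (simp add: L2_iff_square_integrable)

lemma L2_eq_0_iff: 
  assumes "f \<in> L2 M"
  shows "L2_norm M f = 0 \<longleftrightarrow> L2_eq M f (\<lambda>x. 0)"
  unfolding L2_norm_def L2_eq_def using assms 
  by (simp add: integral_nonneg_eq_0_iff_AE L2_def)

lemma operator_norm_le:
  assumes "\<And>f. f \<in> L2 M \<Longrightarrow> L2_norm M f \<le> 1 \<Longrightarrow> L2_norm M (T f) \<le> b"
  shows "operator_norm M T \<le> b"
  unfolding operator_norm_def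
proof (rule cSup_least)
  have "(\<lambda>x. 0) \<in> L2 M" "L2_norm M (\<lambda>x. 0) \<le> 1" by (simp_all add: L2_def L2_norm_def)
  then show "{L2_norm M (T f) |f. f \<in> L2 M \<and> L2_norm M f \<le> 1} \<noteq> {}" by blast
qed (use assms in blast)

text \<open>Boundedness of \<open>T\<close> guarantees that the supremum in the definition is taken over a set that is bounded
  above.\<close>

lemma operator_norm_ge:
  assumes C: "\<And>f. f \<in> L2 M \<Longrightarrow> L2_norm M (T f) \<le> C * L2_norm M f" and f: "f \<in> L2 M" "L2_norm M f \<le> 1"
  shows "L2_norm M (T f) \<le> operator_norm M T"
  unfolding operator_norm_def
proof (rule cSup_upper)
  show "L2_norm M (T f) \<in> {L2_norm M (T f) |f. f \<in> L2 M \<and> L2_norm M f \<le> 1}" using f by blast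
  show "bdd_above {L2_norm M (T f) |f. f \<in> L2 M \<and> L2_norm M f \<le> 1}"
  proof (rule bdd_aboveI)
    fix r assume "r \<in> {L2_norm M (T f) |f. f \<in> L2 M \<and> L2_norm M f \<le> 1}"
    then obtain g where g: "g \<in> L2 M" "L2_norm M g \<le> 1" "r = L2_norm M (T g)" by blast
    have "r \<le> C * L2_norm M g" using C g by simp
    also have "\<dots> \<le> \<bar>C\<bar> * L2_norm M g" by (intro mult_right_mono L2_norm_nonneg) simp
    also have "\<dots> \<le> \<bar>C\<bar> * 1" using g by (intro mult_left_mono) auto
    finally show "r \<le> \<bar>C\<bar>" by simp
  qed
qed

lemma bounded_operator_bound:
  assumes "bounded_operator M T"
  obtains C where "0 \<le> C" "\<And>f. f \<in> L2 M \<Longrightarrow> L2_norm M (T f) \<le> C * L2_norm M f"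
proof -
  obtain C where C: "\<forall>f\<in>L2 M. L2_norm M (T f) \<le> C * L2_norm M f"
    using assms by (auto simp: bounded_operator_def)
  show thesis
  proof (rule that)
    show "L2_norm M (T f) \<le> \<bar>C\<bar> * L2_norm M f" if "f \<in> L2 M" for f
      using bspec[OF C that] mult_right_mono[OF abs_ge_self L2_norm_nonneg, of C M f] by linarith
  qed simp
qed

lemma L2_norm_diff:
  assumes fg: "f \<in> L2 M" "g \<in> L2 M" and a: "L2_norm M f \<le> a" and b: "L2_norm M g \<le> b"
  shows "L2_norm M (\<lambda>x. f x - g x) \<le> 2 * (a + b)"
proof (rule power2_le_imp_le)
  have ab: "0 \<le> a" "0 \<le> b" using a b L2_norm_nonneg order_trans by blast+
  have "(L2_norm M (\<lambda>x. f x - g x))\<^sup>2 \<le> 2 * (L2_norm M f)\<^sup>2 + 2 * (L2_norm M g)\<^sup>2"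
    by (rule L2_norm_diff_le[OF fg])
  also have "\<dots> \<le> 2 * a\<^sup>2 + 2 * b\<^sup>2"
    using a b by (intro add_mono mult_left_mono power_mono) (auto simp: L2_norm_nonneg)
  also have "\<dots> \<le> (2 * (a + b))\<^sup>2" using ab by (simp add: power2_sum power_mult_distrib)
  finally show "(L2_norm M (\<lambda>x. f x - g x))\<^sup>2 \<le> (2 * (a + b))\<^sup>2" .
  show "0 \<le> 2 * (a + b)" using ab by simp
qed

lemma bounded_operator_diff_bound:
  assumes "bounded_operator M T" "bounded_operator M S"
  shows "\<exists>C. \<forall>f\<in>L2 M. operator_diff T S f \<in> L2 M \<and> L2_norm M (operator_diff T S f) \<le> C * L2_norm M f"
proof -
  obtain C1 where C1: "\<And>f. f \<in> L2 M \<Longrightarrow> L2_norm M (T f) \<le> C1 * L2_norm M f"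
    using bounded_operator_bound[OF assms(1)] by blast
  obtain C2 where C2: "\<And>f. f \<in> L2 M \<Longrightarrow> L2_norm M (S f) \<le> C2 * L2_norm M f"
    using bounded_operator_bound[OF assms(2)] by blast
  have TS: "T f \<in> L2 M" "S f \<in> L2 M" if "f \<in> L2 M" for f using assms that by (auto simp: bounded_operator_def)
  have "L2_norm M (operator_diff T S f) \<le> (2 * (C1 + C2)) * L2_norm M f" if f: "f \<in> L2 M" for f
    using L2_norm_diff[OF TS[OF f] C1[OF f] C2[OF f]] by (simp add: operator_diff_def algebra_simps)
  then show ?thesis using L2_diff[OF TS] unfolding operator_diff_def by blast
qed

text \<open>If \<open>\<chi>\<^sub>A S \<chi>\<^sub>B = 0\<close> then \<open>\<chi>\<^sub>A T \<chi>\<^sub>B = \<chi>\<^sub>A (T - S) \<chi>\<^sub>B\<close>, whose norm is at most \<open>\<parallel>T - S\<parallel>\<close>.\<close>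

lemma Roe_imp_quasi_local:
  assumes T: "T \<in> dynamical_Roe_algebra G l M"
  shows "T \<in> dynamically_quasi_local G l M"
proof -
  have bT: "bounded_operator M T" using T by (simp add: dynamical_Roe_algebra_def)
  have "\<exists>K (N::nat) (L::real). N > 0 \<and> L > 0 \<and> N_decomposable G l M N K \<and>
            set_length l K \<le> ennreal L \<and>
            (\<forall>A\<in>sets M. \<forall>B\<in>sets M. emeasure M (range_act G K A \<inter> B) = 0 \<longrightarrow>
               operator_norm M (char_mult A \<circ> T \<circ> char_mult B) < \<epsilon>)" if \<epsilon>: "0 < \<epsilon>" for \<epsilon>
  proof -
    obtain S where S: "finite_dynamical_propagation G l M S" and TS: "operator_norm M (operator_diff T S) < \<epsilon>"
      using T \<epsilon> unfolding dynamical_Roe_algebra_def by blast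
    have bS: "bounded_operator M S" using S by (simp add: finite_dynamical_propagation_def)
    obtain K N L where K: "0 < (N::nat)" "0 < (L::real)" "N_decomposable G l M N K" "set_length l K \<le> ennreal L"
      and z: "\<And>A B. A \<in> sets M \<Longrightarrow> B \<in> sets M \<Longrightarrow> emeasure M (range_act G K A \<inter> B) = 0 \<Longrightarrow>
        zero_operator M (char_mult A \<circ> S \<circ> char_mult B)"
      using S unfolding finite_dynamical_propagation_def by blast
    obtain C where C: "\<And>f. f \<in> L2 M \<Longrightarrow> operator_diff T S f \<in> L2 M" 
      "\<And>f. f \<in> L2 M \<Longrightarrow> L2_norm M (operator_diff T S f) \<le> C * L2_norm M f"
      using bounded_operator_diff_bound[OF bT bS] by blast
    have "operator_norm M (char_mult A \<circ> T \<circ> char_mult B) \<le> operator_norm M (operator_diff T S)"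
      if A: "A \<in> sets M" and B: "B \<in> sets M" and n: "emeasure M (range_act G K A \<inter> B) = 0" for A B
    proof (rule operator_norm_le)
      fix f assume f: "f \<in> L2 M" "L2_norm M f \<le> 1"
      let ?g = "char_mult B f"
      have g: "?g \<in> L2 M" by (rule L2_char_mult[OF f(1) B])
      have g1: "L2_norm M ?g \<le> 1" using L2_norm_char_mult[OF f(1) B] f(2) by simp
      have Tg: "T ?g \<in> L2 M" using bT g by (simp add: bounded_operator_def)
      have "AE x in M. char_mult A (S ?g) x = 0"
        using z[OF A B n] f(1) by (simp add: zero_operator_def L2_eq_def)
      then have "AE x in M. cmod (char_mult A (T ?g) x) \<le> cmod (operator_diff T S ?g x)"
        by eventually_elim (auto simp: char_mult_def operator_diff_def indicator_def)
      then have "L2_norm M (char_mult A (T ?g)) \<le> L2_norm M (operator_diff T S ?g)"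
        by (intro L2_norm_mono L2_char_mult Tg A C g)
      also have "\<dots> \<le> operator_norm M (operator_diff T S)"
        by (rule operator_norm_ge[OF C(2) g g1])
      finally show "L2_norm M ((char_mult A \<circ> T \<circ> char_mult B) f) \<le> operator_norm M (operator_diff T S)" by simp
    qed
    then show ?thesis using K TS by (meson le_less_trans)
  qed
  then show ?thesis using bT by (simp add: dynamically_quasi_local_def)
qed

section \<open>Rank-one projections\<close>
lemma borel_measurable_cnj: "f \<in> borel_measurable M \<Longrightarrow> (\<lambda>x. cnj (f x)) \<in> borel_measurable M"
  by (intro borel_measurable_continuous_on[OF _ , of cnj] continuous_intros) 

text \<open>Any vector in the range is a multiple of \<open>\<xi>\<close>; self-adjointness and \<open>P \<xi> = \<xi>\<close> identify the factor as
  \<open>\<langle>P f, \<xi>\<rangle> = \<langle>f, \<xi>\<rangle>\<close>.\<close>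

lemma rank_one_projection_formula:
  assumes P: "rank_one_projection M P" and \<xi>: "\<xi> \<in> L2 M" "L2_norm M \<xi> = 1"
    and f0: "f0 \<in> L2 M" "L2_eq M (P f0) \<xi>" and f: "f \<in> L2 M"
  shows "AE x in M. P f x = L2_inner M f \<xi> * \<xi> x"
proof -
  have PL: "P g \<in> L2 M" if "g \<in> L2 M" for g using P that by (auto simp: rank_one_projection_def bounded_operator_def)
  obtain e where e: "\<And>g. g \<in> L2 M \<Longrightarrow> \<exists>c. L2_eq M (P g) (\<lambda>x. c * e x)"
    using P unfolding rank_one_projection_def by blast
  obtain c0 where c0: "L2_eq M (P f0) (\<lambda>x. c0 * e x)" using e[OF f0(1)] by blast
  obtain c where c: "L2_eq M (P f) (\<lambda>x. c * e x)" using e[OF f] by blast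
  have \<xi>e: "AE x in M. \<xi> x = c0 * e x" using c0 f0(2) unfolding L2_eq_def by eventually_elim simp
  have c0n: "c0 \<noteq> 0"
  proof
    assume "c0 = 0"
    then have "L2_eq M \<xi> (\<lambda>x. 0)" using \<xi>e by (simp add: L2_eq_def)
    then show False using L2_eq_0_iff[OF \<xi>(1)] \<xi>(2) by simp
  qed
  define k where "k = c / c0"
  have Pf: "AE x in M. P f x = k * \<xi> x"
    using c \<xi>e unfolding L2_eq_def by eventually_elim (simp add: k_def c0n)
  have P\<xi>: "AE x in M. P \<xi> x = \<xi> x"
  proof -
    have "L2_eq M (P (P f0)) (P \<xi>)" using P \<xi>(1) f0 PL[OF f0(1)] 
      unfolding rank_one_projection_def bounded_operator_def by blast
    moreover have "L2_eq M (P (P f0)) (P f0)" using P f0 unfolding rank_one_projection_def by blast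
    ultimately show ?thesis using f0(2) unfolding L2_eq_def by eventually_elim simp
  qed
  have "L2_inner M (P f) \<xi> = L2_inner M f (P \<xi>)" using P f \<xi>(1) unfolding rank_one_projection_def by blast
  moreover have "L2_inner M f (P \<xi>) = L2_inner M f \<xi>"
    unfolding L2_inner_def using P\<xi> f \<xi>(1) PL[OF \<xi>(1)]
    by (intro integral_cong_AE) (auto dest: L2_measurable intro!: borel_measurable_cnj borel_measurable_times)
  moreover have "L2_inner M (P f) \<xi> = k"
  proof -
    have "L2_inner M (P f) \<xi> = (\<integral>x. k * complex_of_real ((cmod (\<xi> x))\<^sup>2) \<partial>M)"
      unfolding L2_inner_def
    proof (rule integral_cong_AE)
      show "AE x in M. P f x * cnj (\<xi> x) = k * complex_of_real ((cmod (\<xi> x))\<^sup>2)"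
        using Pf by eventually_elim (simp add: complex_norm_square[symmetric] mult.assoc del: of_real_power)
    qed (use PL[OF f] \<xi>(1) in \<open>auto dest: L2_measurable intro!: borel_measurable_cnj borel_measurable_times\<close>)
    also have "\<dots> = k * complex_of_real (\<integral>x. (cmod (\<xi> x))\<^sup>2 \<partial>M)"
      by (simp del: of_real_power)
    also have "(\<integral>x. (cmod (\<xi> x))\<^sup>2 \<partial>M) = 1" using \<xi>(2) L2_norm_power2[of M \<xi>] by simp
    finally show ?thesis by simp
  qed
  ultimately have "k = L2_inner M f \<xi>" by simp
  with Pf show ?thesis by simp
qed

locale rank_one_on_groupoid = length_groupoid G l
  for G :: "'g groupoid" and l :: "'g \<Rightarrow> real" +
  fixes \<mu> :: "'g measure" and P :: "'g operator" and \<xi> :: "'g \<Rightarrow> complex"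
  assumes space_\<mu>: "space \<mu> = units G"
    and bounded_P: "bounded_operator \<mu> P"
    and \<xi>_L2: "\<xi> \<in> L2 \<mu>" and \<xi>_norm: "L2_norm \<mu> \<xi> = 1"
    and P_formula: "f \<in> L2 \<mu> \<Longrightarrow> AE x in \<mu>. P f x = L2_inner \<mu> f \<xi> * \<xi> x"
begin

definition \<nu> :: "'g measure" where
  "\<nu> = density \<mu> (\<lambda>x. ennreal ((cmod (\<xi> x))\<^sup>2))"

definition X :: "'g set" where
  "X = {x\<in>space \<mu>. \<xi> x \<noteq> 0}"

lemma \<xi>_measurable [measurable]: "\<xi> \<in> borel_measurable \<mu>"
  using \<xi>_L2 by (rule L2_measurable)

lemma sets_\<nu> [simp, measurable_cong]: "sets \<nu> = sets \<mu>" and space_\<nu> [simp]: "space \<nu> = space \<mu>"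
  by (simp_all add: \<nu>_def)

lemma X_sets [measurable]: "X \<in> sets \<mu>"
  unfolding X_def by measurable

lemma emeasure_\<nu>: "A \<in> sets \<mu> \<Longrightarrow> emeasure \<nu> A = (\<integral>\<^sup>+x. ennreal ((cmod (\<xi> x))\<^sup>2 * indicator A x) \<partial>\<mu>)"
  unfolding \<nu>_def by (subst emeasure_density) (auto intro!: nn_integral_cong simp: indicator_def)

lemma measure_\<nu>: "A \<in> sets \<mu> \<Longrightarrow> measure \<nu> A = (\<integral>x. (cmod (\<xi> x))\<^sup>2 * indicator A x \<partial>\<mu>)"
  unfolding measure_def emeasure_\<nu>
  by (subst nn_integral_eq_integral)
    (auto intro!: integrable_real_mult_indicator L2_integrable \<xi>_L2)

lemma prob_\<nu>: "measure \<nu> (space \<mu>) = 1" "emeasure \<nu> (space \<mu>) = 1"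
proof -
  have "(\<integral>x. (cmod (\<xi> x))\<^sup>2 * indicator (space \<mu>) x \<partial>\<mu>) = (\<integral>x. (cmod (\<xi> x))\<^sup>2 \<partial>\<mu>)"
    by (intro Bochner_Integration.integral_cong) auto
  then show m: "measure \<nu> (space \<mu>) = 1"
    using \<xi>_norm L2_norm_power2[of \<mu> \<xi>] by (simp add: measure_\<nu>)
  then show "emeasure \<nu> (space \<mu>) = 1" by (metis enn2real_eq_posreal_iff ennreal_1 measure_def zero_less_one)
qed

text \<open>The density \<open>|\<xi>|\<^sup>2\<close> is positive on \<open>X\<close>. Outside \<open>X\<close> the measure \<open>\<nu>\<close> vanishes whereas \<open>\<mu>\<close> need not, which
  is why sets of arrows are always cut down to \<open>X\<close> before the measure is changed.\<close>

lemma null_iff: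
  assumes "A \<in> sets \<mu>" "A \<subseteq> X"
  shows "emeasure \<mu> A = 0 \<longleftrightarrow> emeasure \<nu> A = 0"
proof -
  have "A \<in> null_sets \<nu> \<longleftrightarrow> (AE x in \<mu>. x \<in> A \<longrightarrow> ennreal ((cmod (\<xi> x))\<^sup>2) = 0)"
    unfolding \<nu>_def using assms(1) by (subst null_sets_density_iff) auto
  also have "\<dots> \<longleftrightarrow> (AE x in \<mu>. x \<notin> A)"
    using assms(2) by (intro AE_cong) (auto simp: X_def)
  also have "\<dots> \<longleftrightarrow> A \<in> null_sets \<mu>" using AE_iff_null_sets[OF assms(1)] by simp
  finally show ?thesis using assms(1) by (simp add: null_sets_def)
qed

lemma measure_\<nu>_X: "A \<in> sets \<mu> \<Longrightarrow> measure \<nu> (A \<inter> X) = measure \<nu> A"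
  by (auto simp: measure_\<nu> X_def indicator_def intro!: Bochner_Integration.integral_cong)

sublocale nu: finite_measure \<nu>
  by (rule finite_measureI) (simp add: prob_\<nu>)

sublocale nu: measured_groupoid G l \<nu>
  by unfold_locales (simp add: space_\<mu>)

lemma controlled_\<mu>_to_\<nu>: "controlled \<mu> K \<Longrightarrow> controlled \<nu> (restrict_arrows G X X K)"
  by (rule controlled_restrict[of \<mu>]) (auto simp: null_iff)

lemma controlled_\<nu>_to_\<mu>: "controlled \<nu> K \<Longrightarrow> controlled \<mu> (restrict_arrows G X X K)"
  by (rule controlled_restrict[of \<nu>]) (auto simp: null_iff)

lemma range_act_subset_hull: "range_act G K A \<subseteq> range_act G (symmetric_hull K) A"
  by (rule range_act_mono) (auto simp: symmetric_hull_def)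

lemma norm_char_\<xi>: 
  assumes "A \<in> sets \<mu>"
  shows "(L2_norm \<mu> (\<lambda>x. a * (indicator A x * \<xi> x)))\<^sup>2 = (cmod a)\<^sup>2 * measure \<nu> A"
proof -
  have "(\<integral>x. (cmod (a * (indicator A x * \<xi> x)))\<^sup>2 \<partial>\<mu>) = (\<integral>x. (cmod a)\<^sup>2 * ((cmod (\<xi> x))\<^sup>2 * indicator A x) \<partial>\<mu>)"
    by (intro Bochner_Integration.integral_cong) (auto simp: norm_mult power_mult_distrib indicator_def)
  then show ?thesis by (simp add: L2_norm_power2 measure_\<nu>[OF assms])
qed

lemma inner_char_\<xi>:
  assumes "B \<in> sets \<mu>"
  shows "L2_inner \<mu> (char_mult B \<xi>) \<xi> = complex_of_real (measure \<nu> B)"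
proof -
  have "L2_inner \<mu> (char_mult B \<xi>) \<xi> = (\<integral>x. complex_of_real ((cmod (\<xi> x))\<^sup>2 * indicator B x) \<partial>\<mu>)"
    unfolding L2_inner_def char_mult_def
    by (intro Bochner_Integration.integral_cong)
      (auto simp: indicator_def complex_norm_square[symmetric] simp del: of_real_power)
  then show ?thesis by (simp add: measure_\<nu>[OF assms] del: of_real_mult)
qed

text \<open>Applying \<open>\<chi>\<^sub>A P \<chi>\<^sub>B\<close> to \<open>\<xi>\<close> gives \<open>\<nu>(B) \<chi>\<^sub>A \<xi>\<close>, of norm \<open>\<nu>(B) \<surd>\<nu>(A)\<close>. If \<open>B\<close> is what \<open>K\<close> does not reach from
  \<open>A\<close> and the norm is below \<open>\<surd>\<alpha> / 4\<close>, then \<open>\<nu>(B) < 1/4\<close>: more than three quarters of the space is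
  reached from \<open>A\<close>, and at most half of it is \<open>A\<close>.\<close>

theorem quasi_local_imp_expanding:
  assumes P: "P \<in> dynamically_quasi_local G l \<mu>"
  shows "asymptotically_expanding G l \<nu>"
  unfolding asymptotically_expanding_def
proof (intro allI impI)
  fix \<alpha> :: real assume "0 < \<alpha> \<and> \<alpha> \<le> 1 / 2"
  then have \<alpha>: "0 < \<alpha>" "\<alpha> \<le> 1 / 2" by auto
  define \<epsilon> where "\<epsilon> = sqrt \<alpha> / 4"
  have \<epsilon>: "0 < \<epsilon>" using \<alpha> by (simp add: \<epsilon>_def)
  obtain K N where K: "N_decomposable G l \<mu> N K" 
    and small: "\<And>A B. A \<in> sets \<mu> \<Longrightarrow> B \<in> sets \<mu> \<Longrightarrow> emeasure \<mu> (range_act G K A \<inter> B) = 0 \<Longrightarrow>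
      operator_norm \<mu> (char_mult A \<circ> P \<circ> char_mult B) < \<epsilon>"
  proof -
    have "\<exists>K (N::nat) (L::real). N > 0 \<and> L > 0 \<and> N_decomposable G l \<mu> N K \<and>
            set_length l K \<le> ennreal L \<and>
            (\<forall>A\<in>sets \<mu>. \<forall>B\<in>sets \<mu>. emeasure \<mu> (range_act G K A \<inter> B) = 0 \<longrightarrow>
               operator_norm \<mu> (char_mult A \<circ> P \<circ> char_mult B) < \<epsilon>)"
      using P \<epsilon> unfolding dynamically_quasi_local_def by blast
    then show thesis using that by blast
  qed
  have cK: "controlled \<mu> K" by (rule N_decomposable_controlled[OF space_\<mu> K])
  define W where "W = restrict_arrows G X X K"
  have cW: "controlled \<nu> W" unfolding W_def by (rule controlled_\<mu>_to_\<nu>[OF cK])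
  obtain N' L' where hull: "0 < (N'::nat)" "0 < (L'::real)" "N_decomposable G l \<nu> N' (symmetric_hull W)" 
      "set_length l (symmetric_hull W) \<le> ennreal L'"
    using symmetric_hull_N_decomposable[OF nu.space_M cW] by blast
  have cH: "controlled \<nu> (symmetric_hull W)" by (rule N_decomposable_controlled[OF nu.space_M hull(3)])
  have "1 / 4 * measure \<nu> A < measure \<nu> (range_act G (symmetric_hull W) A - A)"
    if A: "A \<in> sets \<nu>" "\<alpha> \<le> measure \<nu> A" "measure \<nu> A \<le> 1 / 2" for A
  proof -
    have As: "A \<in> sets \<mu>" using A by simp
    define A' where "A' = A \<inter> X"
    define B where "B = X - range_act G K A'"
    have A': "A' \<in> sets \<mu>" "measure \<nu> A' = measure \<nu> A" using As by (auto simp: A'_def measure_\<nu>_X)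
    have B: "B \<in> sets \<mu>" using controlled_range_act[OF cK A'(1)] by (simp add: B_def)
    let ?T = "char_mult A' \<circ> P \<circ> char_mult B"
    have op: "operator_norm \<mu> ?T < \<epsilon>"
      by (rule small[OF A'(1) B]) (auto simp: B_def Int_Diff)
    obtain C where C: "0 \<le> C" "\<And>f. f \<in> L2 \<mu> \<Longrightarrow> L2_norm \<mu> (P f) \<le> C * L2_norm \<mu> f"
      using bounded_operator_bound[OF bounded_P] by blast
    have PL: "P f \<in> L2 \<mu>" if "f \<in> L2 \<mu>" for f using bounded_P that by (simp add: bounded_operator_def)
    have "L2_norm \<mu> (?T f) \<le> C * L2_norm \<mu> f" if f: "f \<in> L2 \<mu>" for f
    proof -
      note Bf = L2_char_mult[OF f B]
      have "L2_norm \<mu> (?T f) \<le> L2_norm \<mu> (P (char_mult B f))" using L2_norm_char_mult[OF PL[OF Bf] A'(1)] by simp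
      also have "\<dots> \<le> C * L2_norm \<mu> (char_mult B f)" by (rule C(2)[OF Bf])
      also have "\<dots> \<le> C * L2_norm \<mu> f" by (intro mult_left_mono L2_norm_char_mult f B C)
      finally show ?thesis .
    qed
    from operator_norm_ge[of \<mu> ?T, OF this \<xi>_L2] \<xi>_norm op have T\<xi>: "L2_norm \<mu> (?T \<xi>) < \<epsilon>" by linarith
    have B\<xi>: "char_mult B \<xi> \<in> L2 \<mu>" by (rule L2_char_mult[OF \<xi>_L2 B])
    let ?b = "complex_of_real (measure \<nu> B)"
    have "L2_norm \<mu> (?T \<xi>) = L2_norm \<mu> (\<lambda>x. ?b * (indicator A' x * \<xi> x))"
    proof (rule L2_norm_cong)
      show "?T \<xi> \<in> L2 \<mu>" using L2_char_mult[OF PL[OF B\<xi>] A'(1)] by simp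
      show "(\<lambda>x. ?b * (indicator A' x * \<xi> x)) \<in> L2 \<mu>"
        using L2_mult[OF L2_char_mult[OF \<xi>_L2 A'(1)]] by (simp add: char_mult_def)
      show "L2_eq \<mu> (?T \<xi>) (\<lambda>x. ?b * (indicator A' x * \<xi> x))"
        unfolding L2_eq_def using P_formula[OF B\<xi>]
        by eventually_elim (simp add: inner_char_\<xi>[OF B], simp add: char_mult_def)
    qed
    then have e: "(L2_norm \<mu> (?T \<xi>))\<^sup>2 = (measure \<nu> B)\<^sup>2 * measure \<nu> A"
      using norm_char_\<xi>[OF A'(1), of ?b] A'(2) by simp
    have "(measure \<nu> B * sqrt \<alpha>)\<^sup>2 \<le> (L2_norm \<mu> (?T \<xi>))\<^sup>2"
      unfolding e using A \<alpha> by (simp add: power_mult_distrib mult_left_mono)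
    then have "measure \<nu> B * sqrt \<alpha> \<le> L2_norm \<mu> (?T \<xi>)" by (rule power2_le_imp_le) (rule L2_norm_nonneg)
    then have "measure \<nu> B * sqrt \<alpha> < 1 / 4 * sqrt \<alpha>" using T\<xi> by (simp add: \<epsilon>_def)
    then have b: "measure \<nu> B < 1 / 4" using \<alpha> by (simp add: mult_less_cancel_right)
    let ?R = "range_act G (symmetric_hull W) A"
    have R: "?R \<in> sets \<nu>" by (rule controlled_range_act[OF cH A(1)])
    have "X \<subseteq> B \<union> ?R"
    proof
      fix x assume x: "x \<in> X"
      show "x \<in> B \<union> ?R"
      proof (cases "x \<in> range_act G K A'")
        case True
        then have "x \<in> range_act G W A" unfolding W_def range_act_restrict A'_def using x by simp
        then show ?thesis using range_act_subset_hull by blast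
      qed (use x in \<open>simp add: B_def\<close>)
    qed
    then have "measure \<nu> X \<le> measure \<nu> (B \<union> ?R)" using B R by (intro nu.finite_measure_mono) auto
    also have "\<dots> \<le> measure \<nu> B + measure \<nu> ?R" using B R by (intro measure_Un_le) auto
    finally have "1 \<le> measure \<nu> B + measure \<nu> ?R"
      using measure_\<nu>_X[OF sets.top] prob_\<nu>(1) by (simp add: X_def Int_absorb1 Collect_conj_eq Int_absorb2 subset_eq) 
    moreover have "measure \<nu> ?R \<le> measure \<nu> (?R - A) + measure \<nu> A"
    proof -
      have "measure \<nu> ?R \<le> measure \<nu> ((?R - A) \<union> A)" using R A(1) by (intro nu.finite_measure_mono) auto
      also have "\<dots> \<le> measure \<nu> (?R - A) + measure \<nu> A" using R A(1) by (intro measure_Un_le) auto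
      finally show ?thesis .
    qed
    ultimately show ?thesis using b A(3) by linarith
  qed
  then show "\<exists>(C::real) (N::nat) (L::real) K. C > 0 \<and> N > 0 \<and> L > 0 \<and> N_decomposable G l \<nu> N K \<and>
           set_length l K \<le> ennreal L \<and>
           (\<forall>A\<in>sets \<nu>. \<alpha> \<le> measure \<nu> A \<and> measure \<nu> A \<le> 1/2 \<longrightarrow>
              measure \<nu> (range_act G K A - A) > C * measure \<nu> A)"
    using hull by (intro exI[of _ "1/4"] exI[of _ N'] exI[of _ L'] exI[of _ "symmetric_hull W"]) auto
qed

text \<open>Division by \<open>\<xi>\<close> maps \<open>L\<^sup>2(\<mu>)\<close> to \<open>L\<^sup>2(\<nu>)\<close> and is isometric on functions supported in \<open>X\<close>. Since \<open>z / 0 = 0\<close>, it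
  discards the part of \<open>f\<close> outside \<open>X\<close>.\<close>

lemma L2_divide_\<xi>:
  assumes f: "f \<in> L2 \<mu>"
  shows "(\<lambda>x. f x / \<xi> x) \<in> L2 \<nu>" "(\<integral>x. (cmod (f x / \<xi> x))\<^sup>2 \<partial>\<nu>) \<le> (L2_norm \<mu> f)\<^sup>2"
    "(\<integral>x. f x / \<xi> x \<partial>\<nu>) = L2_inner \<mu> f \<xi>"
proof -
  note [measurable] = L2_measurable[OF f]
  have le: "(cmod (\<xi> x))\<^sup>2 * (cmod (f x / \<xi> x))\<^sup>2 \<le> (cmod (f x))\<^sup>2" for x
    by (simp add: norm_divide power_divide)
  have i: "integrable \<mu> (\<lambda>x. (cmod (\<xi> x))\<^sup>2 * (cmod (f x / \<xi> x))\<^sup>2)"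
    by (rule Bochner_Integration.integrable_bound[OF L2_integrable[OF f]])
      (measurable, use le in \<open>auto intro!: AE_I2 simp del: times_divide_eq_right\<close>)
  then have "integrable \<nu> (\<lambda>x. (cmod (f x / \<xi> x))\<^sup>2)"
    unfolding \<nu>_def by (subst integrable_density) auto
  then show "(\<lambda>x. f x / \<xi> x) \<in> L2 \<nu>" by (simp add: L2_def)
  have "(\<integral>x. (cmod (f x / \<xi> x))\<^sup>2 \<partial>\<nu>) = (\<integral>x. (cmod (\<xi> x))\<^sup>2 * (cmod (f x / \<xi> x))\<^sup>2 \<partial>\<mu>)"
    unfolding \<nu>_def by (subst integral_density) auto
  also have "\<dots> \<le> (L2_norm \<mu> f)\<^sup>2" unfolding L2_norm_power2
    by (rule integral_mono[OF i L2_integrable[OF f] le])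
  finally show "(\<integral>x. (cmod (f x / \<xi> x))\<^sup>2 \<partial>\<nu>) \<le> (L2_norm \<mu> f)\<^sup>2" .
  have "(\<integral>x. f x / \<xi> x \<partial>\<nu>) = (\<integral>x. (cmod (\<xi> x))\<^sup>2 *\<^sub>R (f x / \<xi> x) \<partial>\<mu>)"
    unfolding \<nu>_def by (subst integral_density) auto
  also have "\<dots> = L2_inner \<mu> f \<xi>"
    unfolding L2_inner_def
    by (intro Bochner_Integration.integral_cong) (auto simp: scaleR_conv_of_real complex_norm_square simp del: of_real_power)
  finally show "(\<integral>x. f x / \<xi> x \<partial>\<nu>) = L2_inner \<mu> f \<xi>" .
qed

lemma L2_mult_\<xi>:
  assumes g: "g \<in> L2 \<nu>"
  shows "(\<lambda>x. \<xi> x * g x) \<in> L2 \<mu>" "(L2_norm \<mu> (\<lambda>x. \<xi> x * g x))\<^sup>2 = (\<integral>x. (cmod (g x))\<^sup>2 \<partial>\<nu>)"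
proof -
  have [measurable]: "g \<in> borel_measurable \<mu>" using L2_measurable[OF g] by simp
  have "integrable \<mu> (\<lambda>x. (cmod (\<xi> x))\<^sup>2 * (cmod (g x))\<^sup>2)"
    using L2_integrable[OF g] unfolding \<nu>_def by (subst (asm) integrable_density) auto
  then show "(\<lambda>x. \<xi> x * g x) \<in> L2 \<mu>" by (simp add: L2_def norm_mult power_mult_distrib)
  have "(\<integral>x. (cmod (g x))\<^sup>2 \<partial>\<nu>) = (\<integral>x. (cmod (\<xi> x))\<^sup>2 * (cmod (g x))\<^sup>2 \<partial>\<mu>)"
    unfolding \<nu>_def by (subst integral_density) auto
  then show "(L2_norm \<mu> (\<lambda>x. \<xi> x * g x))\<^sup>2 = (\<integral>x. (cmod (g x))\<^sup>2 \<partial>\<nu>)"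
    by (simp add: L2_norm_power2 norm_mult power_mult_distrib)
qed

text \<open>If \<open>T\<close> approximates the mean on \<open>L\<^sup>2(\<nu>)\<close>, then \<open>S f = \<xi> T (f / \<xi>)\<close> approximates \<open>P\<close>. The values of \<open>S f\<close> vanish
  outside \<open>X\<close>, and \<open>f / \<xi>\<close> does too, so only arrows with both ends in \<open>X\<close> contribute to its propagation.\<close>

theorem expanding_imp_Roe:
  assumes exp: "asymptotically_expanding G l \<nu>"
  shows "P \<in> dynamical_Roe_algebra G l \<mu>"
proof -
  have "\<exists>S. finite_dynamical_propagation G l \<mu> S \<and> operator_norm \<mu> (operator_diff P S) < \<epsilon>" if \<epsilon>: "0 < \<epsilon>" for \<epsilon>
  proof -
    define d where "d = (\<epsilon> / 2)\<^sup>2"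
    have d: "0 < d" using \<epsilon> by (simp add: d_def)
    obtain W and T :: "'g operator" where W: "controlled \<nu> W" and loc: "local_operator G W T"
      and add: "\<And>f g. T (\<lambda>x. f x + g x) = (\<lambda>x. T f x + T g x)" and mult: "\<And>a f. T (\<lambda>x. a * f x) = (\<lambda>x. a * T f x)"
      and T: "\<And>f. f \<in> L2 \<nu> \<Longrightarrow> T f \<in> L2 \<nu>"
      and err: "\<And>f. f \<in> L2 \<nu> \<Longrightarrow> (\<integral>x. (cmod (T f x - (\<integral>y. f y \<partial>\<nu>)))\<^sup>2 \<partial>\<nu>) \<le> d * (\<integral>x. (cmod (f x))\<^sup>2 \<partial>\<nu>)"
      using nu.expanding_imp_local_approximation[OF exp _ d] prob_\<nu>(1) by auto
    define S :: "'g operator" where "S f x = \<xi> x * T (\<lambda>y. f y / \<xi> y) x" for f x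
    have SL: "S f \<in> L2 \<mu>" if "f \<in> L2 \<mu>" for f
      unfolding S_def by (rule L2_mult_\<xi>(1)[OF T[OF L2_divide_\<xi>(1)[OF that]]])
    have PL: "P f \<in> L2 \<mu>" if "f \<in> L2 \<mu>" for f using bounded_P that by (simp add: bounded_operator_def)
    have Sadd: "S (\<lambda>x. f x + g x) = (\<lambda>x. S f x + S g x)" for f g
      using add[of "\<lambda>y. f y / \<xi> y" "\<lambda>y. g y / \<xi> y"] by (simp add: S_def[abs_def] add_divide_distrib distrib_left)
    have Smult: "S (\<lambda>x. a * f x) = (\<lambda>x. a * S f x)" for a f
      using mult[of a "\<lambda>y. f y / \<xi> y"] by (simp add: S_def[abs_def] mult.left_commute)
    have diff: "L2_norm \<mu> (operator_diff P S f) \<le> \<epsilon> / 2 * L2_norm \<mu> f" if f: "f \<in> L2 \<mu>" for f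
    proof (rule power2_le_imp_le)
      let ?h = "\<lambda>y. f y / \<xi> y"
      let ?m = "\<integral>y. ?h y \<partial>\<nu>"
      note h = L2_divide_\<xi>[OF f]
      have c: "(\<lambda>x. ?m) \<in> L2 \<nu>" by (simp add: L2_def)
      have mT: "(\<lambda>x. ?m - T ?h x) \<in> L2 \<nu>" by (rule L2_diff[OF c T[OF h(1)]])
      have "AE x in \<mu>. operator_diff P S f x = \<xi> x * (?m - T ?h x)"
        using P_formula[OF f] by eventually_elim (simp add: operator_diff_def S_def h(3) algebra_simps)
      then have "L2_norm \<mu> (operator_diff P S f) = L2_norm \<mu> (\<lambda>x. \<xi> x * (?m - T ?h x))"
        by (intro L2_norm_cong L2_mult_\<xi>(1)[OF mT]) (simp_all add: L2_eq_def operator_diff_def L2_diff PL SL f)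
      then have "(L2_norm \<mu> (operator_diff P S f))\<^sup>2 = (\<integral>x. (cmod (T ?h x - ?m))\<^sup>2 \<partial>\<nu>)"
        using L2_mult_\<xi>(2)[OF mT] by (simp add: norm_minus_commute)
      also have "\<dots> \<le> d * (\<integral>x. (cmod (?h x))\<^sup>2 \<partial>\<nu>)" by (rule err[OF h(1)])
      also have "\<dots> \<le> d * (L2_norm \<mu> f)\<^sup>2" using h(2) d by (intro mult_left_mono) auto
      finally show "(L2_norm \<mu> (operator_diff P S f))\<^sup>2 \<le> (\<epsilon> / 2 * L2_norm \<mu> f)\<^sup>2"
        by (simp only: d_def power_mult_distrib)
      show "0 \<le> \<epsilon> / 2 * L2_norm \<mu> f" using \<epsilon> by (simp add: L2_norm_nonneg)
    qed
    obtain C where C: "0 \<le> C" "\<And>f. f \<in> L2 \<mu> \<Longrightarrow> L2_norm \<mu> (P f) \<le> C * L2_norm \<mu> f"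
      using bounded_operator_bound[OF bounded_P] by blast
    have Sbound: "L2_norm \<mu> (S f) \<le> (2 * (C + \<epsilon> / 2)) * L2_norm \<mu> f" if f: "f \<in> L2 \<mu>" for f
    proof -
      have L: "operator_diff P S f \<in> L2 \<mu>" unfolding operator_diff_def by (intro L2_diff PL SL f)
      have "S f = (\<lambda>x. P f x - operator_diff P S f x)" by (simp add: operator_diff_def)
      then show ?thesis
        using L2_norm_diff[OF PL[OF f] L C(2)[OF f] diff[OF f]] by (simp add: algebra_simps)
    qed
    have Seq: "L2_eq \<mu> (S f) (S g)" if fg: "f \<in> L2 \<mu>" "g \<in> L2 \<mu>" "L2_eq \<mu> f g" for f g
    proof -
      let ?e = "\<lambda>x. f x - g x"
      have e: "?e \<in> L2 \<mu>" by (rule L2_diff[OF fg(1,2)])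
      have "L2_eq \<mu> ?e (\<lambda>x. 0)" using fg(3) by (simp add: L2_eq_def)
      then have "L2_norm \<mu> ?e = 0" using L2_eq_0_iff[OF e] by simp
      then have "L2_norm \<mu> (S ?e) = 0" using Sbound[OF e] L2_norm_nonneg[of \<mu> "S ?e"] by simp
      then have "L2_eq \<mu> (S ?e) (\<lambda>x. 0)" using L2_eq_0_iff[OF SL[OF e]] by simp
      moreover have "S ?e = (\<lambda>x. S f x - S g x)"
        using Sadd[of f "\<lambda>x. -1 * g x"] Smult[of "-1" g] by simp
      ultimately show ?thesis by (simp add: L2_eq_def)
    qed
    have bS: "bounded_operator \<mu> S"
      unfolding bounded_operator_def Sadd Smult
    proof (intro conjI)
      show "\<exists>C. \<forall>f\<in>L2 \<mu>. L2_norm \<mu> (S f) \<le> C * L2_norm \<mu> f" using Sbound by blast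
    qed (use SL Seq in \<open>simp_all add: L2_eq_def\<close>)
    define V where "V = restrict_arrows G X X W"
    have cV: "controlled \<mu> V" unfolding V_def by (rule controlled_\<nu>_to_\<mu>[OF W])
    obtain N L where hull: "0 < (N::nat)" "0 < (L::real)" "N_decomposable G l \<mu> N (symmetric_hull V)" 
        "set_length l (symmetric_hull V) \<le> ennreal L"
      using symmetric_hull_N_decomposable[OF space_\<mu> cV] by blast
    have cH: "controlled \<mu> (symmetric_hull V)" by (rule N_decomposable_controlled[OF space_\<mu> hull(3)])
    have "zero_operator \<mu> (char_mult A \<circ> S \<circ> char_mult B)"
      if A: "A \<in> sets \<mu>" and B: "B \<in> sets \<mu>" and n: "emeasure \<mu> (range_act G (symmetric_hull V) A \<inter> B) = 0" for A B
      unfolding zero_operator_def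
    proof
      fix f assume f: "f \<in> L2 \<mu>"
      let ?R = "range_act G (symmetric_hull V) A"
      have R: "?R \<in> sets \<mu>" by (rule controlled_range_act[OF cH A])
      \<comment> \<open>Removing the null set \<open>?R \<inter> B\<close> from \<open>B\<close> makes pointwise locality applicable.\<close>
      let ?B = "B - ?R"
      have B': "?B \<in> sets \<mu>" using B R by auto
      have "?R \<inter> B \<in> null_sets \<mu>" using n R B by auto
      then have "AE x in \<mu>. x \<notin> ?R \<inter> B" by (rule AE_not_in)
      then have "L2_eq \<mu> (char_mult B f) (char_mult ?B f)"
        unfolding L2_eq_def by eventually_elim (auto simp: char_mult_def indicator_def)
      then have "AE x in \<mu>. S (char_mult B f) x = S (char_mult ?B f) x"
        using Seq[OF L2_char_mult[OF f B] L2_char_mult[OF f B']] by (simp add: L2_eq_def)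
      moreover have "S (char_mult ?B f) x = 0" if x: "x \<in> A" for x
      proof (cases "\<xi> x = 0")
        case False
        have xs: "x \<in> space \<mu>" using x sets.sets_into_space[OF A] by blast
        then have xX: "x \<in> X" using False by (simp add: X_def)
        have "char_mult ?B f (rng G a) / \<xi> (rng G a) = 0" if a: "a \<in> W" "src G a = x" for a
        proof (cases "\<xi> (rng G a) = 0")
          case False
          have "rng G a \<in> space \<mu>" using a controlled_subset[OF W] rng_in_units space_\<mu> by blast
          then have "a \<in> V" using a xX False by (auto simp: V_def restrict_arrows_def X_def)
          then have "rng G a \<in> range_act G V A" using a x by (auto simp: range_act_def)
          then have "rng G a \<in> ?R" using range_act_subset_hull by blast
          then show ?thesis by (simp add: char_mult_def)
        qed simp
        then show ?thesis using loc xs space_\<mu> unfolding local_operator_def S_def by simp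
      qed (simp add: S_def)
      ultimately show "L2_eq \<mu> ((char_mult A \<circ> S \<circ> char_mult B) f) (\<lambda>x. 0)"
        unfolding L2_eq_def by (auto simp: char_mult_def indicator_def elim!: eventually_mono)
    qed
    then have "finite_dynamical_propagation G l \<mu> S"
      unfolding finite_dynamical_propagation_def using bS hull by blast
    moreover have "operator_norm \<mu> (operator_diff P S) \<le> \<epsilon> / 2"
    proof (rule operator_norm_le)
      fix f assume f: "f \<in> L2 \<mu>" "L2_norm \<mu> f \<le> 1"
      have "L2_norm \<mu> (operator_diff P S f) \<le> \<epsilon> / 2 * L2_norm \<mu> f" by (rule diff[OF f(1)])
      also have "\<dots> \<le> \<epsilon> / 2 * 1" using f(2) \<epsilon> by (intro mult_left_mono) auto
      finally show "L2_norm \<mu> (operator_diff P S f) \<le> \<epsilon> / 2" by simp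
    qed
    then have "operator_norm \<mu> (operator_diff P S) < \<epsilon>" using \<epsilon> by simp
    ultimately show ?thesis by blast
  qed
  then show ?thesis using bounded_P by (simp add: dynamical_Roe_algebra_def)
qed

end

theorem theorem4:
  fixes G :: "'g groupoid" and l :: "'g \<Rightarrow> real" and \<mu> \<nu> :: "'g measure"
    and P :: "'g operator"
  assumes "groupoid G"
    and "length_function G l"
    and "space \<mu> = units G"
    and "rank_one_projection \<mu> P"
    and "associated_measure \<mu> P \<nu>"
  shows "(P \<in> dynamical_Roe_algebra G l \<mu> \<longleftrightarrow> P \<in> dynamically_quasi_local G l \<mu>) \<and>
         (P \<in> dynamically_quasi_local G l \<mu> \<longleftrightarrow> asymptotically_expanding G l \<nu>)"
proof -
  obtain \<xi> f0 where \<xi>: "\<xi> \<in> L2 \<mu>" "L2_norm \<mu> \<xi> = 1" and f0: "f0 \<in> L2 \<mu>" "L2_eq \<mu> (P f0) \<xi>"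
    and \<nu>: "\<nu> = density \<mu> (\<lambda>x. ennreal ((cmod (\<xi> x))\<^sup>2))"
    using assms(5) unfolding associated_measure_def by blast
  interpret groupoid G by fact
  interpret R: rank_one_on_groupoid G l \<mu> P \<xi>
  proof unfold_locales
    show "bounded_operator \<mu> P" using assms(4) by (simp add: rank_one_projection_def)
  qed (use assms \<xi> rank_one_projection_formula[OF assms(4) \<xi> f0] in auto)
  have "\<nu> = R.\<nu>" by (simp add: \<nu> R.\<nu>_def)
  then show ?thesis
    using Roe_imp_quasi_local R.quasi_local_imp_expanding R.expanding_imp_Roe by blast
qed

end
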